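(* Let $\mathcal E$ be a separable Hilbert space and let $(T_t)_{t\ge0}$ be a strongly continuous semigroup of contractions on $H^2_{\mathbb D}(\mathcal E)$ such that $T_tM_{\varphi_t\circ\mathfrak z^{\mathcal E}}=M_{\varphi_t\circ\mathfrak z^{\mathcal E}}T_t$ for all $t\ge0$. Then there exists a unique $\psi\in\mathcal C$ such that $T_t=M_{\varphi_t\circ\psi}$ for all $t\ge0$.
   Context: $H^2_{\mathbb D}(\mathcal E)$ is the $\mathcal E$-valued Hardy space on the open unit disc $\mathbb D$; $H^\infty_{\mathbb D}(\mathcal B(\mathcal E))$ is the algebra of bounded holomorphic $\mathcal B(\mathcal E)$-valued functions with sup norm $\|\cdot\|_\infty$; $M_\psi$ denotes multiplication by $\psi$. $\mathcal C=\{\psi\in H^\infty_{\mathbb D}(\mathcal B(\mathcal E)):\|\psi\|_\infty\le1,\ 1\text{ is not an eigenvalue of }\psi(z)\text{ for any }z\in\mathbb D\}$. $\varphi_t(\lambda)=e^{t\frac{\lambda+1}{\lambda-1}}$ and $(\varphi_t\circ\psi)(z)=\varphi_t(\psi(z))$ (defined via the $H^\infty$ functional calculus, $\varphi_t(T)=\operatorname{s-lim}_{r\to1^-}e^{t(rT+I)(rT-I)^{-1}}$). $\mathfrak z^{\mathcal E}(w)=wI_{\mathcal E}$, so $M_{\varphi_t\circ\mathfrak z^{\mathcal E}}$ is multiplication by the scalar function $e^{t\frac{w+1}{w-1}}$; this semigroup is unitarily equivalent to the right shift semigroup on $L^2(\mathbb R_+,\mathcal E)$. *)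

theory Defs
  imports "HOL-Analysis.Analysis"
begin

text \<open>A complex Hilbert space E is modelled as a real Hilbert space (type class
  real_inner + complete_space) together with an orthogonal complex structure J
  (multiplication by i): a bounded real-linear isometry with J o J = -I.
  Complex scalar multiplication is then (a + i b) x = a x + b J x.\<close>

definition complex_structure :: "('e::real_inner \<Rightarrow>\<^sub>L 'e) \<Rightarrow> bool" where
  "complex_structure J \<longleftrightarrow> J o\<^sub>L J = - id_blinfun \<and> (\<forall>x. norm (J x) = norm x)"

definition separable_space :: "'e::metric_space itself \<Rightarrow> bool" where
  "separable_space _ \<longleftrightarrow> (\<exists>D::'e set. countable D \<and> closure D = UNIV)"

definition scC :: "('e::real_normed_vector \<Rightarrow>\<^sub>L 'e) \<Rightarrow> complex \<Rightarrow> 'e \<Rightarrow> 'e" where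
  "scC J c x = Re c *\<^sub>R x + Im c *\<^sub>R J x"

definition scCop :: "('e::real_normed_vector \<Rightarrow>\<^sub>L 'e) \<Rightarrow> complex \<Rightarrow> ('e \<Rightarrow>\<^sub>L 'e) \<Rightarrow> ('e \<Rightarrow>\<^sub>L 'e)" where
  "scCop J c A = Re c *\<^sub>R A + Im c *\<^sub>R (J o\<^sub>L A)"

definition clinear_op :: "('e::real_normed_vector \<Rightarrow>\<^sub>L 'e) \<Rightarrow> ('e \<Rightarrow>\<^sub>L 'e) \<Rightarrow> bool" where
  "clinear_op J A \<longleftrightarrow> A o\<^sub>L J = J o\<^sub>L A"

abbreviation disc :: "complex set" where "disc \<equiv> ball 0 1"

definition holo_E :: "('e::real_normed_vector \<Rightarrow>\<^sub>L 'e) \<Rightarrow> (complex \<Rightarrow> 'e) \<Rightarrow> complex set \<Rightarrow> bool" where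
  "holo_E J f S \<longleftrightarrow> (\<forall>z\<in>S. \<exists>v. (f has_derivative (\<lambda>h. scC J h v)) (at z))"

definition circ_mean :: "(complex \<Rightarrow> 'e::real_normed_vector) \<Rightarrow> real \<Rightarrow> real" where
  "circ_mean f r = integral {0..2*pi} (\<lambda>\<theta>. (norm (f (of_real r * exp (\<i> * of_real \<theta>))))\<^sup>2) / (2*pi)"

text \<open>Functions in H^2 are represented by their values on the disc; by convention they
  vanish outside the disc.\<close>
definition H2 :: "('e::real_normed_vector \<Rightarrow>\<^sub>L 'e) \<Rightarrow> (complex \<Rightarrow> 'e) set" where
  "H2 J = {f. holo_E J f disc \<and> (\<forall>z. z \<notin> disc \<longrightarrow> f z = 0)
              \<and> (\<exists>B. \<forall>r\<in>{0<..<1}. circ_mean f r \<le> B)}"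

definition h2norm :: "(complex \<Rightarrow> 'e::real_normed_vector) \<Rightarrow> real" where
  "h2norm f = sqrt (SUP r\<in>{0<..<1::real}. circ_mean f r)"

definition Hinf :: "('e::real_normed_vector \<Rightarrow>\<^sub>L 'e) \<Rightarrow> (complex \<Rightarrow> ('e \<Rightarrow>\<^sub>L 'e)) set" where
  "Hinf J = {\<psi>. (\<forall>z\<in>disc. clinear_op J (\<psi> z))
              \<and> (\<forall>z\<in>disc. \<exists>A. (\<psi> has_derivative (\<lambda>h. scCop J h A)) (at z))
              \<and> (\<exists>B. \<forall>z\<in>disc. norm (\<psi> z) \<le> B)}"

definition classC :: "('e::real_normed_vector \<Rightarrow>\<^sub>L 'e) \<Rightarrow> (complex \<Rightarrow> ('e \<Rightarrow>\<^sub>L 'e)) set" where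
  "classC J = {\<psi>\<in>Hinf J. (\<forall>z\<in>disc. norm (\<psi> z) \<le> 1)
                  \<and> (\<forall>z\<in>disc. \<forall>x. \<psi> z x = x \<longrightarrow> x = 0)}"

fun bpow :: "('e::real_normed_vector \<Rightarrow>\<^sub>L 'e) \<Rightarrow> nat \<Rightarrow> ('e \<Rightarrow>\<^sub>L 'e)" where
  "bpow A 0 = id_blinfun"
| "bpow A (Suc n) = A o\<^sub>L bpow A n"

definition bexp :: "('e::banach \<Rightarrow>\<^sub>L 'e) \<Rightarrow> ('e \<Rightarrow>\<^sub>L 'e)" where
  "bexp A = (\<Sum>n. inverse (fact n) *\<^sub>R bpow A n)"

definition binv :: "('e::real_normed_vector \<Rightarrow>\<^sub>L 'e) \<Rightarrow> ('e \<Rightarrow>\<^sub>L 'e)" where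
  "binv A = (SOME B. A o\<^sub>L B = id_blinfun \<and> B o\<^sub>L A = id_blinfun)"

definition phi_op :: "real \<Rightarrow> ('e::banach \<Rightarrow>\<^sub>L 'e) \<Rightarrow> 'e \<Rightarrow> 'e" where
  "phi_op t T = (\<lambda>x. Lim (at_left (1::real))
      (\<lambda>r. bexp (t *\<^sub>R ((r *\<^sub>R T + id_blinfun) o\<^sub>L binv (r *\<^sub>R T - id_blinfun))) x))"

definition M_phi_psi :: "real \<Rightarrow> (complex \<Rightarrow> ('e::banach \<Rightarrow>\<^sub>L 'e)) \<Rightarrow> (complex \<Rightarrow> 'e) \<Rightarrow> (complex \<Rightarrow> 'e)" where
  "M_phi_psi t \<psi> f = (\<lambda>z. if z \<in> disc then phi_op t (\<psi> z) (f z) else 0)"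

definition M_phi_z :: "('e::real_normed_vector \<Rightarrow>\<^sub>L 'e) \<Rightarrow> real \<Rightarrow> (complex \<Rightarrow> 'e) \<Rightarrow> (complex \<Rightarrow> 'e)" where
  "M_phi_z J t f = (\<lambda>w. if w \<in> disc then scC J (exp (of_real t * (w + 1) / (w - 1))) (f w) else 0)"

definition sc_contraction_semigroup ::
  "('e::real_normed_vector \<Rightarrow>\<^sub>L 'e) \<Rightarrow> (real \<Rightarrow> (complex \<Rightarrow> 'e) \<Rightarrow> (complex \<Rightarrow> 'e)) \<Rightarrow> bool" where
  "sc_contraction_semigroup J T \<longleftrightarrow>
     (\<forall>t\<ge>0. \<forall>f\<in>H2 J. T t f \<in> H2 J)
   \<and> (\<forall>t\<ge>0. \<forall>f\<in>H2 J. \<forall>g\<in>H2 J. T t (\<lambda>z. f z + g z) = (\<lambda>z. T t f z + T t g z))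
   \<and> (\<forall>t\<ge>0. \<forall>f\<in>H2 J. \<forall>c. T t (\<lambda>z. scC J c (f z)) = (\<lambda>z. scC J c (T t f z)))
   \<and> (\<forall>t\<ge>0. \<forall>f\<in>H2 J. h2norm (T t f) \<le> h2norm f)
   \<and> (\<forall>f\<in>H2 J. T 0 f = f)
   \<and> (\<forall>s\<ge>0. \<forall>t\<ge>0. \<forall>f\<in>H2 J. T (s + t) f = T s (T t f))
   \<and> (\<forall>f\<in>H2 J. ((\<lambda>t. h2norm (\<lambda>z. T t f z - f z)) \<longlongrightarrow> 0) (at_right 0))"

end

theory Submission
  imports Defs "HOL-Complex_Analysis.Complex_Analysis"
begin

text \<open>Since \<open>T\<^sub>t\<close> commutes with multiplication by \<open>\<phi>\<^sub>t\<close> for every \<open>t\<close>, for rational \<open>t\<close> it commutes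
  with multiplication by every \<open>\<phi>\<^sub>s\<close>, \<open>s\<close> rational, hence with multiplication by
  \<open>w = 1 - 2 \<integral> exp(-s) \<phi>\<^sub>s(w) ds\<close>. As \<open>f - f(w)\<close> is a multiple of \<open>z - w\<close>, it is multiplication by
  \<open>G w t x = (T\<^sub>t x)(w)\<close>, where \<open>x\<close> denotes a constant function; by continuity this holds for all \<open>t\<close>.
  For each \<open>w\<close>, \<open>G w\<close> is a strongly continuous contraction semigroup on the Hilbert space, and
  \<open>\<psi>(w) = I - 2 \<integral> exp(-t) G w t dt\<close> is its cogenerator. It determines and is determined by \<open>G w\<close>, and
  it is holomorphic in \<open>w\<close> because every \<open>G w t\<close> is, with uniform bounds.\<close>

section \<open>Exponentials of bounded operators\<close>

text \<open>Only eigenvalues are excluded in the class, so 1 may lie in the spectrum of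
  \<open>\<psi> w\<close>; the Cayley transform of \<open>\<psi> w\<close> is then unbounded, and
  \<open>phi_op\<close> is only a strong limit. Unbounded generators never appear: differential
  statements are made on the range of \<open>M\<close> squared (for a contraction) or of the
  resolvent \<open>R\<close> (for a semigroup), and density with contractivity does the rest.
  Commutation with the integral is reached through geometric Riemann sums. Such a sum is the
  reciprocal of an affine function of a single \<open>\<phi>\<^sub>e\<close>, so commuting with that
  one function is enough. Near the boundary point 1 the sums do not converge uniformly; the factor 1
  - z repairs this, and the density of the multiples of 1 - z in H2 removes it again. That each
  \<open>G w t\<close> is a contraction is a statement about one fibre. It follows without adjoints
  by playing the sharp constant of point evaluation against the Szego kernel, which attains it. The
  resulting bound does not depend on t, which is what carries holomorphy through the Laplace
  integral.\<close>

lemma norm_id_blinfun_le: "norm (id_blinfun :: 'a::real_normed_vector \<Rightarrow>\<^sub>L 'a) \<le> 1"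
  by (rule norm_blinfun_bound) auto

lemma blinfun_compose_assoc: "(A o\<^sub>L B) o\<^sub>L C = A o\<^sub>L (B o\<^sub>L C)"
  by (rule blinfun_eqI) simp

lemma norm_bpow_le: "norm (bpow A n) \<le> norm A ^ n"
proof (induction n)
  case 0
  show ?case by (simp add: norm_id_blinfun_le)
next
  case (Suc n)
  have "norm (bpow A (Suc n)) \<le> norm A * norm (bpow A n)"
    by (simp add: norm_blinfun_compose)
  also have "\<dots> \<le> norm A * norm A ^ n"
    by (intro mult_left_mono Suc) auto
  finally show ?case by simp
qed

lemma bpow_scaleR: "bpow (c *\<^sub>R A) n = c ^ n *\<^sub>R bpow A n"
  by (induction n) (auto simp: bounded_bilinear.scaleR_left[OF bounded_bilinear_blinfun_compose] bounded_bilinear.scaleR_right[OF bounded_bilinear_blinfun_compose])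

lemma bpow_commute:
  assumes "B o\<^sub>L A = A o\<^sub>L B"
  shows "B o\<^sub>L bpow A n = bpow A n o\<^sub>L B"
proof (induction n)
  case (Suc n)
  have "B o\<^sub>L bpow A (Suc n) = (B o\<^sub>L A) o\<^sub>L bpow A n"
    by (simp add: blinfun_compose_assoc)
  also have "\<dots> = A o\<^sub>L (B o\<^sub>L bpow A n)"
    by (simp add: assms blinfun_compose_assoc)
  also have "\<dots> = bpow A (Suc n) o\<^sub>L B"
    by (simp add: Suc blinfun_compose_assoc)
  finally show ?case .
qed (auto simp: blinfun_eqI)

lemma summable_bexp:
  fixes A :: "'e::banach \<Rightarrow>\<^sub>L 'e"
  shows "summable (\<lambda>n. inverse (fact n) *\<^sub>R bpow A n)"
proof (rule summable_comparison_test)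
  show "summable (\<lambda>n. inverse (fact n) * norm A ^ n)"
    by (rule summable_exp)
  show "\<exists>N. \<forall>n\<ge>N. norm (inverse (fact n) *\<^sub>R bpow A n) \<le> inverse (fact n) * norm A ^ n"
    by (auto intro!: mult_left_mono norm_bpow_le)
qed

lemma bexp_commute:
  fixes A :: "'e::banach \<Rightarrow>\<^sub>L 'e"
  assumes "B o\<^sub>L A = A o\<^sub>L B"
  shows "B o\<^sub>L bexp A = bexp A o\<^sub>L B"
proof -
  have "B o\<^sub>L bexp A = (\<Sum>n. B o\<^sub>L (inverse (fact n) *\<^sub>R bpow A n))"
    unfolding bexp_def
    by (rule bounded_linear.suminf[OF bounded_bilinear.bounded_linear_right[OF bounded_bilinear_blinfun_compose] summable_bexp])
  also have "\<dots> = (\<Sum>n. (inverse (fact n) *\<^sub>R bpow A n) o\<^sub>L B)"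
    by (simp add: bounded_bilinear.scaleR_left[OF bounded_bilinear_blinfun_compose] bounded_bilinear.scaleR_right[OF bounded_bilinear_blinfun_compose] bpow_commute[OF assms])
  also have "\<dots> = bexp A o\<^sub>L B"
    unfolding bexp_def
    by (rule bounded_linear.suminf[OF bounded_bilinear.bounded_linear_left[OF bounded_bilinear_blinfun_compose] summable_bexp, symmetric])
  finally show ?thesis .
qed

lemma bexp_zero: "bexp (0 :: 'e::banach \<Rightarrow>\<^sub>L 'e) = id_blinfun"
proof -
  have *: "bpow (0 :: 'e \<Rightarrow>\<^sub>L 'e) n = (if n = 0 then id_blinfun else 0)" for n
    by (cases n) auto
  have "(\<lambda>n. inverse (fact n) *\<^sub>R bpow (0 :: 'e \<Rightarrow>\<^sub>L 'e) n) sums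
      (\<Sum>n\<in>{0}. inverse (fact n) *\<^sub>R bpow (0 :: 'e \<Rightarrow>\<^sub>L 'e) n)"
    by (rule sums_finite) (auto simp: *)
  then show ?thesis
    by (simp add: bexp_def sums_iff)
qed

text \<open>Termwise differentiation of the exponential series: the derivative of each term is
  \<open>A\<close> times the preceding term, so the derived series is \<open>A\<close> composed with
  a shifted copy of the original one and converges uniformly along with it.\<close>

lemma bexp_has_vector_derivative:
  fixes A :: "'e::banach \<Rightarrow>\<^sub>L 'e"
  shows "((\<lambda>t. bexp (t *\<^sub>R A)) has_vector_derivative A o\<^sub>L bexp (t *\<^sub>R A)) (at t within X)"
proof -
  \<comment> \<open>The radius puts both \<open>t\<close> and the base point 0 of
    \<open>has_derivative_series\<close> into the open ball \<open>S\<close>.\<close>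
  define B where "B = \<bar>t\<bar> + 1"
  define S where "S = ball (0::real) B"
  define f where "f = (\<lambda>n x. inverse (fact n) *\<^sub>R bpow (x *\<^sub>R A) n)"
  have f_alt: "f n x = (x ^ n / fact n) *\<^sub>R bpow A n" for n x
    by (simp add: f_def bpow_scaleR divide_inverse mult.commute)
  define f' where "f' = (\<lambda>n x h::real. if n = 0 then 0 else h *\<^sub>R (A o\<^sub>L f (n - 1) x))"
  have unif: "uniform_limit S (\<lambda>n x. \<Sum>i<n. f i x) (\<lambda>x. \<Sum>i. f i x) sequentially"
  proof (rule Weierstrass_m_test)
    show "summable (\<lambda>n. inverse (fact n) * (B * norm A) ^ n)"
      by (rule summable_exp)
    show "norm (f n x) \<le> inverse (fact n) * (B * norm A) ^ n" if "x \<in> S" for n x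
    proof -
      have "norm (f n x) \<le> inverse (fact n) * norm (x *\<^sub>R A) ^ n"
        unfolding f_def norm_scaleR[of "inverse (fact n)"] by (auto intro!: mult_left_mono norm_bpow_le simp del: norm_scaleR)
      also have "\<dots> \<le> inverse (fact n) * (B * norm A) ^ n"
        using that by (intro mult_left_mono power_mono) (auto simp: S_def intro!: mult_right_mono)
      finally show ?thesis .
    qed
  qed
  have sumf': "(\<Sum>i<Suc n. f' i x h) = h *\<^sub>R (A o\<^sub>L (\<Sum>i<n. f i x))" for n x h
  proof -
    have "(\<Sum>i<Suc n. f' i x h) = (\<Sum>i<n. h *\<^sub>R (A o\<^sub>L f i x))"
      by (subst sum.lessThan_Suc_shift) (simp add: f'_def)
    also have "\<dots> = h *\<^sub>R (A o\<^sub>L (\<Sum>i<n. f i x))"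
      by (simp add: bounded_bilinear.sum_right[OF bounded_bilinear_blinfun_compose] scaleR_sum_right)
    finally show ?thesis .
  qed
  have "\<exists>g. \<forall>x\<in>S. (\<lambda>n. f n x) sums (g x) \<and>
     (g has_derivative (\<lambda>h. h *\<^sub>R (A o\<^sub>L (\<Sum>i. f i x)))) (at x within S)"
  proof (rule has_derivative_series)
    show "convex S" by (simp add: S_def)
    show "0 \<in> S" by (simp add: S_def B_def)
    show "(\<lambda>n. f n 0) sums bexp (0 *\<^sub>R A)"
      unfolding f_def bexp_def using summable_bexp by (rule summable_sums)
    show "(f n has_derivative f' n x) (at x within S)" for n x
    proof (cases n)
      case 0
      then show ?thesis by (simp add: f'_def f_alt[abs_def])
    next
      case (Suc m)
      have "((\<lambda>x. (x ^ Suc m / fact (Suc m)) *\<^sub>R bpow A (Suc m)) has_derivative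
         (\<lambda>h. (h * (x ^ m / fact m)) *\<^sub>R bpow A (Suc m))) (at x within S)"
        by (rule derivative_eq_intros refl | simp add: fun_eq_iff field_simps del: of_nat_Suc)+
      then show ?thesis
        unfolding Suc f_alt[abs_def] f'_def
        by (simp add: bounded_bilinear.scaleR_right[OF bounded_bilinear_blinfun_compose])
    qed
    fix e :: real assume "e > 0"
    \<comment> \<open>The \<open>+ 1\<close> keeps the quotient meaningful when
      \<open>A = 0\<close>.\<close>
    have "\<forall>\<^sub>F n in sequentially. \<forall>x\<in>S. dist (\<Sum>i<n. f i x) (\<Sum>i. f i x) < e / (norm A + 1)"
      using unif \<open>e > 0\<close> by (intro uniform_limitD) (auto intro!: divide_pos_pos add_nonneg_pos)
    then have "\<forall>\<^sub>F n in sequentially. \<forall>x\<in>S. \<forall>h. norm ((\<Sum>i<Suc n. f' i x h) - h *\<^sub>R (A o\<^sub>L (\<Sum>i. f i x))) \<le> e * norm h"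
    proof (rule eventually_mono, intro ballI allI)
      fix n x h assume "\<forall>x\<in>S. dist (\<Sum>i<n. f i x) (\<Sum>i. f i x) < e / (norm A + 1)" "x \<in> S"
      then have *: "norm ((\<Sum>i<n. f i x) - (\<Sum>i. f i x)) \<le> e / (norm A + 1)"
        by (auto simp: dist_norm intro: less_imp_le)
      have "norm ((\<Sum>i<Suc n. f' i x h) - h *\<^sub>R (A o\<^sub>L (\<Sum>i. f i x)))
          = \<bar>h\<bar> * norm (A o\<^sub>L ((\<Sum>i<n. f i x) - (\<Sum>i. f i x)))"
        unfolding sumf' by (simp add: scaleR_diff_right[symmetric] bounded_bilinear.diff_right[OF bounded_bilinear_blinfun_compose])
      also have "\<dots> \<le> \<bar>h\<bar> * (norm A * (e / (norm A + 1)))"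
        by (intro mult_left_mono order_trans[OF norm_blinfun_compose] * ) auto
      also have "\<dots> \<le> \<bar>h\<bar> * e"
        using \<open>e > 0\<close> pos_divide_le_eq[of "norm A + 1" "norm A * e" e] norm_ge_zero[of A]
        by (intro mult_left_mono) (simp_all add: algebra_simps add_nonneg_pos del: norm_ge_zero)
      finally show "norm ((\<Sum>i<Suc n. f' i x h) - h *\<^sub>R (A o\<^sub>L (\<Sum>i. f i x))) \<le> e * norm h"
        by (simp add: mult.commute)
    qed
    then show "\<forall>\<^sub>F n in sequentially. \<forall>x\<in>S. \<forall>h. norm ((\<Sum>i<n. f' i x h) - h *\<^sub>R (A o\<^sub>L (\<Sum>i. f i x))) \<le> e * norm h"
      by (rule eventually_sequentially_Suc[THEN iffD1])
  qed
  then obtain g where g: "\<And>x. x \<in> S \<Longrightarrow> (\<lambda>n. f n x) sums g x"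
    "\<And>x. x \<in> S \<Longrightarrow> (g has_derivative (\<lambda>h. h *\<^sub>R (A o\<^sub>L (\<Sum>i. f i x)))) (at x within S)"
    by blast
  have sg: "(\<Sum>i. f i x) = bexp (x *\<^sub>R A)" for x
    by (simp add: f_def bexp_def)
  have geq: "g x = bexp (x *\<^sub>R A)" if "x \<in> S" for x
    using g(1)[OF that] sg by (simp add: sums_iff)
  have "t \<in> S" and "open S" by (auto simp: S_def B_def)
  have "(g has_derivative (\<lambda>h. h *\<^sub>R (A o\<^sub>L bexp (t *\<^sub>R A)))) (at t)"
    using g(2)[OF \<open>t \<in> S\<close>] unfolding sg at_within_open[OF \<open>t \<in> S\<close> \<open>open S\<close>] .
  then have "((\<lambda>x. bexp (x *\<^sub>R A)) has_derivative (\<lambda>h. h *\<^sub>R (A o\<^sub>L bexp (t *\<^sub>R A)))) (at t)"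
    by (rule has_derivative_transform_within_open[OF _ \<open>open S\<close> \<open>t \<in> S\<close> geq])
  then show ?thesis
    unfolding has_vector_derivative_def by (rule has_derivative_at_withinI)
qed

text \<open>Lumer-Phillips for a bounded generator: the squared norm of an orbit u has derivative
  \<open>2 * inner (A u) u\<close>, hence never increases.\<close>

lemma bexp_contraction:
  fixes A :: "'e::{real_inner, banach} \<Rightarrow>\<^sub>L 'e"
  assumes diss: "\<And>x. inner (A x) x \<le> 0" and "t \<ge> 0"
  shows "norm (bexp (t *\<^sub>R A) x) \<le> norm x"
proof -
  define u where "u = (\<lambda>t. blinfun_apply (bexp (t *\<^sub>R A)) x)"
  have du: "(u has_vector_derivative A (u s)) (at s)" for s
    unfolding u_def
    using bounded_linear.has_vector_derivative[OF blinfun.bounded_linear_left[of x] bexp_has_vector_derivative[of A s UNIV]]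
    by simp
  have "((\<lambda>s. inner (u s) (u s)) has_vector_derivative inner (u s) (A (u s)) + inner (A (u s)) (u s)) (at s)" for s
    by (rule bounded_bilinear.has_vector_derivative[OF bounded_bilinear_inner du du])
  then have D: "((\<lambda>s. inner (u s) (u s)) has_real_derivative 2 * inner (A (u s)) (u s)) (at s)" for s
    by (simp add: has_real_derivative_iff_has_vector_derivative inner_commute)
  have "inner (u t) (u t) \<le> inner (u 0) (u 0)"
    using \<open>t \<ge> 0\<close>
  proof (rule DERIV_nonpos_imp_nonincreasing)
    fix s
    show "\<exists>y. ((\<lambda>s. inner (u s) (u s)) has_real_derivative y) (at s) \<and> y \<le> 0"
      using D[of s] diss[of "u s"] by (intro exI[of _ "2 * inner (A (u s)) (u s)"]) simp
  qed
  then show ?thesis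
    by (simp add: u_def bexp_zero norm_le)
qed

section \<open>Cayley transforms of contractions\<close>

lemma neumann_inverse:
  fixes S :: "'e::banach \<Rightarrow>\<^sub>L 'e"
  assumes "norm S < 1"
  obtains B where "(id_blinfun - S) o\<^sub>L B = id_blinfun" "B o\<^sub>L (id_blinfun - S) = id_blinfun"
proof -
  have summ: "summable (bpow S)"
    using assms by (intro summable_comparison_test[OF _ summable_geometric[of "norm S"]] exI[of _ 0])
      (auto intro: norm_bpow_le)
  define B where "B = (\<Sum>n. bpow S n)"
  have shift: "B = id_blinfun + (\<Sum>n. bpow S (Suc n))"
    using suminf_split_head[OF summ] by (simp add: B_def)
  have 1: "S o\<^sub>L B = (\<Sum>n. bpow S (Suc n))"
    unfolding B_def
    by (simp add: bounded_linear.suminf[OF bounded_bilinear.bounded_linear_right[OF bounded_bilinear_blinfun_compose] summ])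
  have "B o\<^sub>L S = (\<Sum>n. bpow S n o\<^sub>L S)"
    unfolding B_def
    by (rule bounded_linear.suminf[OF bounded_bilinear.bounded_linear_left[OF bounded_bilinear_blinfun_compose] summ])
  also have "\<dots> = (\<Sum>n. bpow S (Suc n))"
    by (simp add: bpow_commute[of S S])
  finally have 2: "B o\<^sub>L S = (\<Sum>n. bpow S (Suc n))" .
  have idl: "id_blinfun o\<^sub>L B = B" "B o\<^sub>L id_blinfun = B"
    by (rule blinfun_eqI, simp)+
  show thesis
  proof
    show "(id_blinfun - S) o\<^sub>L B = id_blinfun"
      unfolding bounded_bilinear.diff_left[OF bounded_bilinear_blinfun_compose] idl 1
      using shift by (simp del: bpow.simps)
    show "B o\<^sub>L (id_blinfun - S) = id_blinfun"
      unfolding bounded_bilinear.diff_right[OF bounded_bilinear_blinfun_compose] idl 2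
      using shift by (simp del: bpow.simps)
  qed
qed

lemma binv_works:
  assumes "A o\<^sub>L B = id_blinfun" "B o\<^sub>L A = id_blinfun"
  shows "A o\<^sub>L binv A = id_blinfun" "binv A o\<^sub>L A = id_blinfun"
proof -
  have "A o\<^sub>L binv A = id_blinfun \<and> binv A o\<^sub>L A = id_blinfun"
    unfolding binv_def by (rule someI[of _ B]) (use assms in auto)
  then show "A o\<^sub>L binv A = id_blinfun" "binv A o\<^sub>L A = id_blinfun" by auto
qed

text \<open>\<^const>\<open>phi_op\<close> is the limit of the exponentials of \<open>cay r\<close>, which equals
  \<open>I + 2 (rT - I)\<^sup>-\<^sup>1\<close> and so is bounded on the range of \<open>M = I - T\<close> uniformly in \<open>r\<close>.\<close>

locale contraction_op =
  fixes T :: "'e::{real_inner, banach} \<Rightarrow>\<^sub>L 'e"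
  assumes norm_T: "norm T \<le> 1"
begin

definition res :: "real \<Rightarrow> 'e \<Rightarrow>\<^sub>L 'e" where
  "res r = binv (r *\<^sub>R T - id_blinfun)"

definition cay :: "real \<Rightarrow> 'e \<Rightarrow>\<^sub>L 'e" where
  "cay r = (r *\<^sub>R T + id_blinfun) o\<^sub>L res r"

lemma norm_T_apply: "norm (T x) \<le> norm x"
  using norm_blinfun[of T x] norm_T mult_right_mono[OF norm_T, of "norm x"] by simp

lemma inner_T_le: "inner (T x) x \<le> (norm x)\<^sup>2"
  using norm_cauchy_schwarz[of "T x" x] mult_right_mono[OF norm_T_apply[of x], of "norm x"]
  by (simp add: power2_eq_square)

lemma res_inverse:
  assumes "0 < r" "r < 1"
  shows "r *\<^sub>R T (res r x) - res r x = x" "res r (r *\<^sub>R T x - x) = x"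
proof -
  have "norm (r *\<^sub>R T) < 1"
    using le_less_trans[OF mult_left_mono[OF norm_T, of r]] assms by simp
  then obtain B where B: "(id_blinfun - r *\<^sub>R T) o\<^sub>L B = id_blinfun" "B o\<^sub>L (id_blinfun - r *\<^sub>R T) = id_blinfun"
    using neumann_inverse by blast
  have "(r *\<^sub>R T - id_blinfun) o\<^sub>L (- B) = id_blinfun" "(- B) o\<^sub>L (r *\<^sub>R T - id_blinfun) = id_blinfun"
  proof -
    have "(r *\<^sub>R T - id_blinfun) o\<^sub>L (- B) = (id_blinfun - r *\<^sub>R T) o\<^sub>L B"
      by (rule blinfun_eqI) (simp add: blinfun.bilinear_simps)
    then show "(r *\<^sub>R T - id_blinfun) o\<^sub>L (- B) = id_blinfun" using B by simp
    have "(- B) o\<^sub>L (r *\<^sub>R T - id_blinfun) = B o\<^sub>L (id_blinfun - r *\<^sub>R T)"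
      by (rule blinfun_eqI) (simp add: blinfun.bilinear_simps)
    then show "(- B) o\<^sub>L (r *\<^sub>R T - id_blinfun) = id_blinfun" using B by simp
  qed
  note * = binv_works[OF this]
  have "((r *\<^sub>R T - id_blinfun) o\<^sub>L res r) x = x" "(res r o\<^sub>L (r *\<^sub>R T - id_blinfun)) x = x"
    using * by (simp_all add: res_def)
  then show "r *\<^sub>R T (res r x) - res r x = x" "res r (r *\<^sub>R T x - x) = x"
    by (simp_all add: blinfun.bilinear_simps)
qed

text \<open>Take norms in u = r T u - x for u = \<open>res r x\<close>. The bound degenerates as
  \<open>r\<close> tends to 1; \<open>norm_res_M\<close> is its uniform replacement on the range of
  \<open>M\<close>.\<close>

lemma norm_res:
  assumes "0 < r" "r < 1"
  shows "(1 - r) * norm (res r x) \<le> norm x"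
proof -
  have "norm (res r x) = norm (r *\<^sub>R T (res r x) - x)"
    using res_inverse(1)[OF assms, of x] by (simp add: algebra_simps)
  also have "\<dots> \<le> r * norm (T (res r x)) + norm x"
    using norm_triangle_ineq4[of "r *\<^sub>R T (res r x)" x] assms by simp
  also have "\<dots> \<le> r * norm (res r x) + norm x"
    using assms norm_T_apply by (simp add: mult_left_mono)
  finally show ?thesis by (simp add: algebra_simps)
qed

lemma res_commute:
  fixes B :: "'e \<Rightarrow>\<^sub>L 'e"
  assumes "0 < r" "r < 1" "\<And>x. B (T x) = T (B x)"
  shows "B (res r x) = res r (B x)"
proof -
  have "B (res r x) = res r (r *\<^sub>R T (B (res r x)) - B (res r x))"
    using res_inverse(2)[OF assms(1,2)] by simp
  also have "r *\<^sub>R T (B (res r x)) - B (res r x) = B (r *\<^sub>R T (res r x) - res r x)"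
    by (simp add: blinfun.bilinear_simps assms(3))
  finally show ?thesis
    using res_inverse(1)[OF assms(1,2)] by simp
qed

lemma T_res: "0 < r \<Longrightarrow> r < 1 \<Longrightarrow> T (res r x) = res r (T x)"
  by (rule res_commute) auto

lemma cay_apply:
  assumes "0 < r" "r < 1"
  shows "cay r x = x + 2 *\<^sub>R res r x"
proof -
  have "cay r x = r *\<^sub>R T (res r x) + res r x"
    by (simp add: cay_def blinfun.bilinear_simps)
  also have "\<dots> = (r *\<^sub>R T (res r x) - res r x) + 2 *\<^sub>R res r x"
    by (simp add: scaleR_2)
  finally show ?thesis using res_inverse(1)[OF assms] by simp
qed

lemma cay_commute:
  fixes B :: "'e \<Rightarrow>\<^sub>L 'e"
  assumes "0 < r" "r < 1" "\<And>x. B (T x) = T (B x)"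
  shows "B o\<^sub>L cay r = cay r o\<^sub>L B"
  by (rule blinfun_eqI) (simp add: cay_apply assms res_commute blinfun.bilinear_simps)

text \<open>With u = \<open>res r x\<close>, the vectors \<open>cay r x\<close> and \<open>x\<close>
  are r T u + u and r T u - u, so their inner product is a difference of squares.\<close>

lemma cay_dissipative:
  assumes "0 < r" "r < 1"
  shows "inner (cay r x) x \<le> 0"
proof -
  define u where "u = res r x"
  have "inner (cay r x) x = inner (r *\<^sub>R T u + u) (r *\<^sub>R T u - u)"
    using res_inverse(1)[OF assms, of x] by (simp add: cay_def blinfun.bilinear_simps u_def)
  also have "\<dots> = r\<^sup>2 * (norm (T u))\<^sup>2 - (norm u)\<^sup>2"
    by (simp add: inner_simps power2_norm_eq_inner inner_commute)
      (simp add: power2_eq_square)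
  also have "\<dots> \<le> 1 * (norm u)\<^sup>2 - (norm u)\<^sup>2"
    using assms by (intro diff_right_mono mult_mono power_mono norm_T_apply)
      (auto simp: power_le_one)
  finally show ?thesis by simp
qed

section \<open>Estimates on the range of I - T that are uniform in r\<close>

definition M :: "'e \<Rightarrow>\<^sub>L 'e" where "M = id_blinfun - T"

lemma M_apply: "M x = x - T x"
  by (simp add: M_def blinfun.bilinear_simps)

lemma norm_M: "norm (M x) \<le> 2 * norm x"
  using norm_triangle_ineq4[of x "T x"] norm_T_apply[of x] by (simp add: M_apply)

text \<open>Split \<open>M x\<close> as -(r T - I) x - (1 - r) T x: the resolvent cancels on the
  first summand, and on the second the factor 1 - r offsets its growth.\<close>

lemma res_M:
  assumes "0 < r" "r < 1"
  shows "res r (M x) = - x - (1 - r) *\<^sub>R res r (T x)"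
proof -
  have "M x = - (r *\<^sub>R T x - x) - (1 - r) *\<^sub>R T x"
    by (simp add: M_apply algebra_simps)
  then show ?thesis
    by (simp only: blinfun.bilinear_simps res_inverse(2)[OF assms, simplified blinfun.bilinear_simps])
qed

lemma norm_res_M:
  assumes "0 < r" "r < 1"
  shows "norm (res r (M x)) \<le> 2 * norm x"
proof -
  have "norm (res r (M x)) \<le> norm x + (1 - r) * norm (res r (T x))"
    unfolding res_M[OF assms] using norm_triangle_ineq4[of "- x" "(1 - r) *\<^sub>R res r (T x)"] assms by simp
  also have "\<dots> \<le> norm x + norm (T x)"
    using norm_res[OF assms] by simp
  also have "\<dots> \<le> 2 * norm x" using norm_T_apply[of x] by simp
  finally show ?thesis .
qed

text \<open>The vector subtracted is the formal value at \<open>M (M x)\<close> of the Cayley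
  transform for r = 1. One factor \<open>M\<close> cancels the inverse, the other keeps the error
  term \<open>res r (M (T x))\<close> bounded; what remains is of order 1 - r.\<close>

lemma res_M_approx:
  assumes "0 < r" "r < 1"
  shows "norm (cay r (M (M x)) - (M (M x) - 2 *\<^sub>R M x)) \<le> 4 * (1 - r) * norm x"
proof -
  have "cay r (M (M x)) - (M (M x) - 2 *\<^sub>R M x) = - (2 * (1 - r)) *\<^sub>R res r (T (M x))"
    unfolding cay_apply[OF assms] res_M[OF assms, of "M x"]
    by (simp add: scaleR_diff_right flip: scaleR_minus_left)
  also have "T (M x) = M (T x)"
    by (simp add: M_apply blinfun.bilinear_simps)
  finally have "norm (cay r (M (M x)) - (M (M x) - 2 *\<^sub>R M x)) = 2 * (1 - r) * norm (res r (M (T x)))"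
    using assms by simp
  also have "\<dots> \<le> 4 * (1 - r) * norm x"
  proof -
    have "norm (res r (M (T x))) \<le> 2 * norm x"
      using norm_res_M[OF assms, of "T x"] norm_T_apply[of x] by linarith
    then have "2 * (1 - r) * norm (res r (M (T x))) \<le> 2 * (1 - r) * (2 * norm x)"
      by (rule mult_left_mono) (use assms in simp)
    then show ?thesis by (simp add: algebra_simps)
  qed
  finally show ?thesis .
qed

section \<open>The contraction semigroups generated by \<open>cay r\<close>\<close>

definition U :: "real \<Rightarrow> real \<Rightarrow> 'e \<Rightarrow>\<^sub>L 'e" where
  "U r t = bexp (t *\<^sub>R cay r)"

lemma norm_U: "0 < r \<Longrightarrow> r < 1 \<Longrightarrow> t \<ge> 0 \<Longrightarrow> norm (U r t x) \<le> norm x"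
  unfolding U_def by (rule bexp_contraction) (auto intro: cay_dissipative)

lemma U_zero: "U r 0 = id_blinfun"
  by (simp add: U_def bexp_zero)

lemma U_cay: "U r t (cay r x) = cay r (U r t x)"
proof -
  have "cay r o\<^sub>L bexp (t *\<^sub>R cay r) = bexp (t *\<^sub>R cay r) o\<^sub>L cay r"
    by (rule bexp_commute) (rule blinfun_eqI, simp add: blinfun.bilinear_simps)
  then show ?thesis
    unfolding U_def by (metis blinfun_apply_blinfun_compose)
qed

lemma U_commute:
  fixes B :: "'e \<Rightarrow>\<^sub>L 'e"
  assumes "0 < r" "r < 1" "\<And>x. B (T x) = T (B x)"
  shows "B (U r t x) = U r t (B x)"
proof -
  have "B o\<^sub>L bexp (t *\<^sub>R cay r) = bexp (t *\<^sub>R cay r) o\<^sub>L B"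
    using cay_commute[OF assms] by (intro bexp_commute)
      (simp add: bounded_bilinear.scaleR_left[OF bounded_bilinear_blinfun_compose]
         bounded_bilinear.scaleR_right[OF bounded_bilinear_blinfun_compose])
  then show ?thesis
    unfolding U_def by (metis blinfun_apply_blinfun_compose)
qed

lemma U_deriv: "((\<lambda>t. U r t x) has_vector_derivative U r t (cay r x)) (at t within X)"
  using bounded_linear.has_vector_derivative[OF blinfun.bounded_linear_left[of x] bexp_has_vector_derivative[of "cay r" t X]]
  unfolding U_cay by (simp add: U_def)

text \<open>Variation of constants as an inequality: \<open>U r (t - s) (w s)\<close> runs from
  \<open>U r t (w 0)\<close> to \<open>w t\<close>, and its derivative is the image of the defect
  \<open>w' s - cay r (w s)\<close> under a contraction. It is applied with \<open>w\<close> an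
  orbit of another \<open>U\<close>, a constant, and an orbit of a given semigroup.\<close>

lemma duhamel:
  assumes r: "0 < r" "r < 1" and "t \<ge> 0"
    and w: "\<And>s. s \<in> {0..t} \<Longrightarrow> (w has_vector_derivative w' s) (at s within {0..t})"
    and K: "\<And>s. s \<in> {0..t} \<Longrightarrow> norm (w' s - cay r (w s)) \<le> K"
  shows "norm (w t - U r t (w 0)) \<le> t * K"
proof -
  define q where "q = (\<lambda>s. U r (t - s) (w s))"
  have dq: "(q has_vector_derivative U r (t - s) (w' s - cay r (w s))) (at s within {0..t})"
    if s: "s \<in> {0..t}" for s
  proof -
    have "((\<lambda>s. U r s) \<circ> (\<lambda>s. t - s) has_vector_derivative (-1) *\<^sub>R (cay r o\<^sub>L U r (t - s))) (at s within {0..t})"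
      unfolding U_def
      by (rule vector_diff_chain_within[OF _ bexp_has_vector_derivative])
         (auto intro!: derivative_eq_intros)
    then have dU: "((\<lambda>s. U r (t - s)) has_vector_derivative - (cay r o\<^sub>L U r (t - s))) (at s within {0..t})"
      by (simp add: o_def)
    have "(q has_vector_derivative U r (t - s) (w' s) + (- (cay r o\<^sub>L U r (t - s))) (w s)) (at s within {0..t})"
      unfolding q_def
      by (rule bounded_bilinear.has_vector_derivative[OF bounded_bilinear_blinfun_apply dU w[OF s]])
    then show ?thesis
      by (simp add: blinfun.bilinear_simps U_cay)
  qed
  have "norm (q t - q 0) \<le> K * norm (t - 0)"
  proof (rule differentiable_bound[where S = "{0..t}"])
    show "(q has_derivative (\<lambda>h. h *\<^sub>R U r (t - s) (w' s - cay r (w s)))) (at s within {0..t})"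
      if "s \<in> {0..t}" for s
      using dq[OF that] by (simp add: has_vector_derivative_def)
    show "onorm (\<lambda>h. h *\<^sub>R U r (t - s) (w' s - cay r (w s))) \<le> K" if s: "s \<in> {0..t}" for s
    proof (rule onorm_le)
      fix h :: real
      have "norm (U r (t - s) (w' s - cay r (w s))) \<le> K"
        using norm_U[OF r, of "t - s"] K[OF s] s order_trans by fastforce
      then show "norm (h *\<^sub>R U r (t - s) (w' s - cay r (w s))) \<le> K * norm h"
        by (simp add: mult.commute[of K] mult_left_mono)
    qed
  qed (use \<open>t \<ge> 0\<close> in auto)
  then show ?thesis
    using \<open>t \<ge> 0\<close> by (simp add: q_def U_zero mult.commute)
qed

lemma cay_diff:
  assumes r: "0 < r" "r < 1" and s: "0 < s" "s < 1"
  shows "norm (cay s (M (M y)) - cay r (M (M y))) \<le> 4 * \<bar>1 - s\<bar> * norm y + 4 * \<bar>1 - r\<bar> * norm y"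
  using res_M_approx[OF r, of y] res_M_approx[OF s, of y] r s
    norm_triangle_ineq4[of "cay s (M (M y)) - (M (M y) - 2 *\<^sub>R M y)" "cay r (M (M y)) - (M (M y) - 2 *\<^sub>R M y)"]
  by simp

text \<open>\<open>duhamel\<close> for \<open>U r\<close> along an orbit of \<open>U s\<close>.
  Since \<open>cay r\<close> commutes with \<open>U s\<close>, the defect is the image under
  \<open>U s\<close> of a fixed vector, the difference of the two Cayley transforms at
  \<open>M (M y)\<close>.\<close>

lemma U_diff:
  assumes r: "0 < r" "r < 1" and s: "0 < s" "s < 1" and t: "t \<ge> 0"
  shows "norm (U s t (M (M y)) - U r t (M (M y))) \<le> t * (4 * (1 - s) * norm y + 4 * (1 - r) * norm y)"
proof -
  have "norm (U s t (M (M y)) - U r t (U s 0 (M (M y)))) \<le> t * (4 * (1 - s) * norm y + 4 * (1 - r) * norm y)"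
  proof (rule duhamel[OF r t, where w' = "\<lambda>\<tau>. U s \<tau> (cay s (M (M y)))"])
    show "((\<lambda>a. U s a (M (M y))) has_vector_derivative U s \<tau> (cay s (M (M y)))) (at \<tau> within {0..t})" for \<tau>
      by (rule U_deriv)
    fix \<tau> assume \<tau>: "\<tau> \<in> {0..t}"
    have "cay r (U s \<tau> (M (M y))) = U s \<tau> (cay r (M (M y)))"
    proof (rule U_commute[OF s])
      show "cay r (T x) = T (cay r x)" for x
        by (simp add: cay_apply[OF r] blinfun.bilinear_simps T_res[OF r])
    qed
    then have "norm (U s \<tau> (cay s (M (M y))) - cay r (U s \<tau> (M (M y))))
        = norm (U s \<tau> (cay s (M (M y)) - cay r (M (M y))))"
      by (simp add: blinfun.bilinear_simps)
    also have "\<dots> \<le> norm (cay s (M (M y)) - cay r (M (M y)))"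
      using \<tau> by (intro norm_U[OF s]) auto
    finally show "norm (U s \<tau> (cay s (M (M y))) - cay r (U s \<tau> (M (M y)))) \<le> 4 * (1 - s) * norm y + 4 * (1 - r) * norm y"
      using cay_diff[OF r s, of y] r s by simp
  qed
  then show ?thesis by (simp add: U_zero)
qed

end

lemma eventually_at_left_1: "\<forall>\<^sub>F r in at_left (1::real). 0 < r \<and> r < 1"
  unfolding eventually_at_left_field by (intro exI[of _ 0]) auto

text \<open>This is the condition that the class imposes on each value of the symbol. It says that
  \<open>M\<close> is injective, and it enters through the density of the range of
  \<open>M\<close>.\<close>

locale contraction_no_fixed = contraction_op T for T :: "'e::{real_inner, banach} \<Rightarrow>\<^sub>L 'e" +
  assumes no_fixed: "T x = x \<Longrightarrow> x = 0"
begin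

text \<open>Mean ergodic argument: with \<open>u = -(1 - r) (rT - I)\<^sup>-\<^sup>1 x\<close> one has \<open>M u = a (x - u)\<close>,
  and monotonicity of \<open>M\<close> makes \<open>x - u\<close> converge as \<open>a\<close> tends to 0.\<close>

lemma closure_range_M: "closure (range M) = UNIV"
proof (intro set_eqI iffI UNIV_I)
  fix x :: 'e
  define a where "a = (\<lambda>n. inverse (real (Suc n)))"
  \<comment> \<open>Since \<open>a n * r n = 1 - r n\<close>, the resolvent equation for
    \<open>r n\<close> turns into a u + M u = a x.\<close>
  define r where "r = (\<lambda>n. 1 / (1 + a n))"
  define u where "u = (\<lambda>n. - (1 - r n) *\<^sub>R res (r n) x)"
  define p where "p = (\<lambda>n. x - u n)"
  have a: "a n > 0" for n by (simp add: a_def)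
  have r: "0 < r n" "r n < 1" for n
    using a[of n] by (auto simp: r_def)
  have Mu: "M (u n) = a n *\<^sub>R p n" for n
  proof -
    have ar: "a n * r n = 1 - r n"
      using a[of n] by (simp add: r_def field_simps)
    have "r n *\<^sub>R T (u n) - u n = - (1 - r n) *\<^sub>R (r n *\<^sub>R T (res (r n) x) - res (r n) x)"
      by (simp add: u_def blinfun.bilinear_simps algebra_simps)
    also have "\<dots> = - (1 - r n) *\<^sub>R x"
      using res_inverse(1)[OF r] by simp
    finally have "r n *\<^sub>R T (u n) = u n - (1 - r n) *\<^sub>R x"
      by (simp add: algebra_simps)
    then have "r n *\<^sub>R M (u n) = (1 - r n) *\<^sub>R p n"
      by (simp add: M_apply p_def algebra_simps)
    also have "\<dots> = r n *\<^sub>R (a n *\<^sub>R p n)"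
      using ar by (simp add: mult.commute)
    finally show ?thesis using r[of n] by (simp del: scaleR_scaleR)
  qed
  have p_range: "p n \<in> range M" for n
  proof -
    have "p n = M ((1 / a n) *\<^sub>R u n)"
      using Mu[of n] a[of n] by (simp add: blinfun.bilinear_simps)
    then show ?thesis by blast
  qed
  have nu: "norm (u n) \<le> norm x" for n
    using norm_res[OF r[of n], of x] r[of n] by (simp add: u_def)
  have np: "norm (p n) \<le> 2 * norm x" for n
    using norm_triangle_ineq4[of x "u n"] nu[of n] by (simp add: p_def)
  \<comment> \<open>Monotonicity of \<open>M\<close>, tested on \<open>u m - u n\<close>, makes the
    squared norms of \<open>p n\<close> increase and lets their increments dominate the squared
    distances. A bounded monotone real sequence then forces \<open>p\<close> to be Cauchy.\<close>
  have key: "(norm (p m - p n))\<^sup>2 \<le> (norm (p n))\<^sup>2 - (norm (p m))\<^sup>2" if "m \<le> n" for m n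
  proof (cases "m = n")
    case False
    with that have "a n < a m" by (simp add: a_def field_simps)
    have "0 \<le> inner (M (u m - u n)) (u m - u n)"
      using inner_T_le[of "u m - u n"] by (simp add: M_apply inner_diff_left power2_norm_eq_inner)
    also have "\<dots> = inner (a m *\<^sub>R p m - a n *\<^sub>R p n) (p n - p m)"
      by (simp only: blinfun.diff_right Mu) (simp add: p_def)
    finally have 0: "inner (a m *\<^sub>R p m - a n *\<^sub>R p n) (p n - p m) \<ge> 0" .
    have "(a m + a n) * (norm (p m - p n))\<^sup>2 + (a m - a n) * ((norm (p m))\<^sup>2 - (norm (p n))\<^sup>2)
       = - 2 * inner (a m *\<^sub>R p m - a n *\<^sub>R p n) (p n - p m)"
      by (simp add: power2_norm_eq_inner inner_simps inner_commute algebra_simps)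
    then have *: "(a m + a n) * (norm (p m - p n))\<^sup>2 \<le> (a m - a n) * ((norm (p n))\<^sup>2 - (norm (p m))\<^sup>2)"
      using 0 by (simp add: algebra_simps)
    have "(a m - a n) * (norm (p m - p n))\<^sup>2 \<le> (a m + a n) * (norm (p m - p n))\<^sup>2"
      using a[of n] by (intro mult_right_mono) auto
    with * have "(a m - a n) * (norm (p m - p n))\<^sup>2 \<le> (a m - a n) * ((norm (p n))\<^sup>2 - (norm (p m))\<^sup>2)"
      by linarith
    then show ?thesis
      using \<open>a n < a m\<close> by simp
  qed auto
  define q where "q = (\<lambda>n. (norm (p n))\<^sup>2)"
  have "convergent q"
  proof (rule Bseq_mono_convergent)
    have "\<bar>q n\<bar> \<le> (2 * norm x)\<^sup>2" for n
      unfolding q_def using power_mono[OF np[of n], of 2] by simp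
    then show "Bseq q" by (intro BseqI'[of _ "(2 * norm x)\<^sup>2"]) auto
    show "\<forall>m. \<forall>n\<ge>m. q m \<le> q n"
      using key unfolding q_def by (metis diff_ge_0_iff_ge order_trans zero_le_power2)
  qed
  then have Cq: "Cauchy q" by (rule convergent_Cauchy)
  have "Cauchy p"
  proof (rule metric_CauchyI)
    fix e :: real assume "e > 0"
    then have "e\<^sup>2 > 0" by simp
    then obtain N where N: "\<And>m n. m \<ge> N \<Longrightarrow> n \<ge> N \<Longrightarrow> dist (q m) (q n) < e\<^sup>2"
      using Cq unfolding Cauchy_def by blast
    have *: "dist (p m) (p n) < e" if "m \<ge> N" "n \<ge> N" "m \<le> n" for m n
    proof -
      have "(norm (p m - p n))\<^sup>2 < e\<^sup>2"
        using key[OF that(3)] N[OF that(1,2)] by (auto simp: q_def dist_real_def)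
      then show ?thesis
        using \<open>e > 0\<close> by (simp add: dist_norm power2_less_imp_less)
    qed
    show "\<exists>M. \<forall>m\<ge>M. \<forall>n\<ge>M. dist (p m) (p n) < e"
      using * by (metis dist_commute nat_le_linear)
  qed
  then obtain l where l: "p \<longlonglongrightarrow> l"
    using Cauchy_convergent convergent_def by blast
  have u: "u \<longlonglongrightarrow> x - l"
    using tendsto_diff[OF tendsto_const[of x] l] by (simp add: p_def)
  have "a \<longlonglongrightarrow> 0"
    unfolding a_def by (rule LIMSEQ_inverse_real_of_nat)
  then have "(\<lambda>n. a n *\<^sub>R p n) \<longlonglongrightarrow> 0 *\<^sub>R l"
    using l by (rule tendsto_scaleR)
  moreover have "(\<lambda>n. M (u n)) \<longlonglongrightarrow> M (x - l)"
    using u by (rule bounded_linear.tendsto[OF blinfun.bounded_linear_right])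
  \<comment> \<open>The limit of \<open>u\<close> is killed by \<open>M\<close>, whose kernel is
    trivial as \<open>T\<close> fixes only 0.\<close>
  ultimately have "M (x - l) = 0"
    using LIMSEQ_unique by (simp add: Mu)
  then have "x = l"
    using no_fixed[of "x - l"] by (simp add: M_apply)
  then show "x \<in> closure (range M)"
    using l p_range unfolding closure_sequential by blast
qed

lemma approx_M:
  assumes "e > 0"
  obtains y where "norm (x - M y) < e"
proof -
  have "x \<in> closure (range M)" by (simp add: closure_range_M)
  then obtain z where "z \<in> range M" "dist z x < e"
    using assms unfolding closure_approachable by blast
  then show thesis using that by (auto simp: dist_norm norm_minus_commute)
qed

lemma approx_MM:
  assumes "e > 0"
  obtains y where "norm (x - M (M y)) < e"
proof -
  obtain y where y: "norm (x - M y) < e / 2" using approx_M[of "e / 2"] assms by auto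
  obtain z where z: "norm (y - M z) < e / 4" using approx_M[of "e / 4"] assms by auto
  have "norm (x - M (M z)) \<le> norm (x - M y) + norm (M (y - M z))"
    using norm_triangle_ineq[of "x - M y" "M y - M (M z)"] by (simp add: blinfun.bilinear_simps)
  then have "norm (x - M (M z)) < e"
    using y z norm_M[of "y - M z"] by linarith
  then show thesis by (rule that)
qed

text \<open>Approximate \<open>x\<close> by some \<open>M (M y)\<close>: \<open>U_diff\<close>
  handles that vector, and contractivity of \<open>U s t\<close> and \<open>U r t\<close> handles
  the error of approximation.\<close>

lemma U_Cauchy:
  assumes "t \<ge> 0" "e > 0"
  obtains d where "0 < d" "d < 1"
    "\<And>r s. 1 - d < r \<Longrightarrow> r < 1 \<Longrightarrow> 1 - d < s \<Longrightarrow> s < 1 \<Longrightarrow> norm (U s t x - U r t x) < e"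
proof -
  obtain y where y: "norm (x - M (M y)) < e / 3" using approx_MM[of "e / 3"] assms by auto
  \<comment> \<open>Both summands of \<open>U_diff\<close> are at most
    \<open>4 * d * norm y\<close>; the added 1 keeps \<open>K\<close> positive for the division
    below.\<close>
  define K where "K = t * (8 * norm y) + 1"
  have K: "K \<ge> 1" using assms by (simp add: K_def)
  define d where "d = min (1 / 2) (e / (3 * K))"
  have d: "0 < d" "d < 1" "d * K \<le> e / 3"
    using assms K by (auto simp: d_def min_def field_simps)
  show thesis
  proof (rule that[OF d(1,2)])
    fix r s assume rs: "1 - d < r" "r < 1" "1 - d < s" "s < 1"
    then have r: "0 < r" "r < 1" and s: "0 < s" "s < 1" using d by auto
    have "4 * (1 - s) * norm y + 4 * (1 - r) * norm y \<le> 4 * d * norm y + 4 * d * norm y"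
      using rs by (intro add_mono mult_right_mono mult_left_mono) auto
    then have "t * (4 * (1 - s) * norm y + 4 * (1 - r) * norm y) \<le> t * (4 * d * norm y + 4 * d * norm y)"
      using assms by (intro mult_left_mono) auto
    also have "\<dots> \<le> d * K"
      using d by (simp add: K_def algebra_simps)
    finally have 1: "norm (U s t (M (M y)) - U r t (M (M y))) \<le> e / 3"
      using U_diff[OF r s assms(1), of y] d(3) by linarith
    have 2: "norm (U s t (x - M (M y))) < e / 3" "norm (U r t (x - M (M y))) < e / 3"
      using norm_U[OF s assms(1), of "x - M (M y)"] norm_U[OF r assms(1), of "x - M (M y)"] y by auto
    have eq: "U s t x - U r t x = (U s t (M (M y)) - U r t (M (M y))) + U s t (x - M (M y)) - U r t (x - M (M y))"
      by (simp add: blinfun.bilinear_simps)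
    show "norm (U s t x - U r t x) < e"
      unfolding eq using 1 2 norm_triangle_ineq4[of "(U s t (M (M y)) - U r t (M (M y))) + U s t (x - M (M y))" "U r t (x - M (M y))"]
        norm_triangle_ineq[of "U s t (M (M y)) - U r t (M (M y))" "U s t (x - M (M y))"] by linarith
  qed
qed

text \<open>\<open>Lim\<close> carries information only once the limit exists. Completeness yields
  it along one sequence tending to 1, and the uniform Cauchy estimate spreads it to the whole
  filter.\<close>

lemma phi_op_tendsto:
  assumes "t \<ge> 0"
  shows "((\<lambda>r. U r t x) \<longlongrightarrow> phi_op t T x) (at_left 1)"
proof -
  define \<rho> where "\<rho> = (\<lambda>n. 1 - inverse (real (Suc (Suc n))))"
  have \<rho>: "\<rho> n < 1" for n by (simp add: \<rho>_def)
  have \<rho>lim: "\<exists>N. \<forall>n\<ge>N. 1 - d < \<rho> n" if d: "d > 0" for d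
  proof -
    obtain N where N: "inverse (real (Suc N)) < d" using reals_Archimedean[OF d] by auto
    have "1 - d < \<rho> n" if "n \<ge> N" for n
    proof -
      have "inverse (real (Suc (Suc n))) \<le> inverse (real (Suc N))"
        using that by (intro le_imp_inverse_le) auto
      then show ?thesis using N unfolding \<rho>_def by linarith
    qed
    then show ?thesis by blast
  qed
  have "Cauchy (\<lambda>n. U (\<rho> n) t x)"
  proof (rule CauchyI)
    fix e :: real assume "e > 0"
    obtain d where d: "0 < d" "d < 1"
      "\<And>r s. 1 - d < r \<Longrightarrow> r < 1 \<Longrightarrow> 1 - d < s \<Longrightarrow> s < 1 \<Longrightarrow> norm (U s t x - U r t x) < e"
      using U_Cauchy[OF assms \<open>e > 0\<close>] by metis
    obtain N where "\<forall>n\<ge>N. 1 - d < \<rho> n" using \<rho>lim d by blast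
    then show "\<exists>M. \<forall>m\<ge>M. \<forall>n\<ge>M. norm (U (\<rho> m) t x - U (\<rho> n) t x) < e"
      using d(3) \<rho> by blast
  qed
  then obtain l where l: "(\<lambda>n. U (\<rho> n) t x) \<longlonglongrightarrow> l"
    using Cauchy_convergent convergent_def by blast
  have "((\<lambda>r. U r t x) \<longlongrightarrow> l) (at_left 1)"
  proof (rule tendstoI)
    fix e :: real assume "e > 0"
    then have "e / 2 > 0" by simp
    obtain d where d: "0 < d" "d < 1"
      "\<And>r s. 1 - d < r \<Longrightarrow> r < 1 \<Longrightarrow> 1 - d < s \<Longrightarrow> s < 1 \<Longrightarrow> norm (U s t x - U r t x) < e / 2"
      using U_Cauchy[OF assms \<open>e / 2 > 0\<close>] by metis
    obtain N where N: "\<forall>n\<ge>N. 1 - d < \<rho> n" using \<rho>lim d by blast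
    obtain N' where N': "\<forall>n\<ge>N'. dist (U (\<rho> n) t x) l < e / 2"
      using l \<open>e / 2 > 0\<close> unfolding lim_sequentially by blast
    define n where "n = max N N'"
    have "dist (U r t x) l < e" if "1 - d < r" "r < 1" for r
    proof -
      have "dist (U r t x) (U (\<rho> n) t x) < e / 2"
        using d(3)[of "\<rho> n" r] that N \<rho> by (auto simp: n_def dist_norm)
      moreover have "dist (U (\<rho> n) t x) l < e / 2" using N' by (auto simp: n_def)
      ultimately show ?thesis
        using dist_triangle[of "U r t x" l "U (\<rho> n) t x"] by linarith
    qed
    then show "\<forall>\<^sub>F r in at_left 1. dist (U r t x) l < e"
      unfolding eventually_at_left_field using d by (intro exI[of _ "1 - d"]) auto
  qed
  moreover have "phi_op t T x = Lim (at_left 1) (\<lambda>r. U r t x)"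
    by (simp add: phi_op_def U_def cay_def res_def)
  ultimately show ?thesis
    by (metis tendsto_Lim trivial_limit_at_left_real)
qed

text \<open>Stated for differences because \<open>phi_op t T\<close> is a plain function; in this
  form it transports identities from a dense set.\<close>

lemma phi_op_contraction:
  assumes "t \<ge> 0"
  shows "norm (phi_op t T x - phi_op t T y) \<le> norm (x - y)"
proof (rule tendsto_upperbound)
  show "((\<lambda>r. norm (U r t x - U r t y)) \<longlongrightarrow> norm (phi_op t T x - phi_op t T y)) (at_left 1)"
    by (intro tendsto_norm tendsto_diff phi_op_tendsto assms)
  show "\<forall>\<^sub>F r in at_left 1. norm (U r t x - U r t y) \<le> norm (x - y)"
    using eventually_at_left_1
    by (rule eventually_mono) (use norm_U[OF _ _ assms, of _ "x - y"] in \<open>auto simp: blinfun.bilinear_simps\<close>)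
qed auto

section \<open>Expansion of \<open>phi_op\<close> at t = 0\<close>

lemma norm_cay_M:
  assumes "0 < r" "r < 1"
  shows "norm (cay r (M y)) \<le> 6 * norm y"
proof -
  have "norm (cay r (M y)) \<le> norm (M y) + 2 * norm (res r (M y))"
    using norm_triangle_ineq[of "M y" "2 *\<^sub>R res r (M y)"] by (simp add: cay_apply[OF assms])
  then show ?thesis
    using norm_M[of y] norm_res_M[OF assms, of y] by linarith
qed

text \<open>Comparing with a constant path in \<open>duhamel\<close> gives a Lipschitz bound for
  orbits. Applied to \<open>cay r x\<close>, it bounds the derivative of the first-order remainder,
  and the mean value inequality supplies the second factor \<open>t\<close>.\<close>

lemma U_taylor:
  assumes r: "0 < r" "r < 1" and "t \<ge> 0"
  shows "norm (U r t x - x - t *\<^sub>R cay r x) \<le> t\<^sup>2 * norm (cay r (cay r x))"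
proof -
  have lip: "norm (U r t x - x) \<le> t * norm (cay r x)" if "t \<ge> 0" for t x
  proof -
    have "norm (x - U r t x) \<le> t * norm (cay r x)"
      by (rule duhamel[OF r that, where w = "\<lambda>_. x" and w' = "\<lambda>_. 0"]) auto
    then show ?thesis by (simp add: norm_minus_commute)
  qed
  define d where "d = (\<lambda>s. U r s x - s *\<^sub>R cay r x)"
  have "norm (d t - d 0) \<le> (t * norm (cay r (cay r x))) * norm (t - 0)"
  proof (rule differentiable_bound[where S = "{0..t}"])
    show "(d has_derivative (\<lambda>h. h *\<^sub>R (U r s (cay r x) - cay r x))) (at s within {0..t})" for s
    proof -
      have "(d has_vector_derivative U r s (cay r x) - 1 *\<^sub>R cay r x) (at s within {0..t})"
        unfolding d_def
        by (intro has_vector_derivative_diff U_deriv) (auto intro!: derivative_eq_intros)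
      then show ?thesis by (simp add: has_vector_derivative_def)
    qed
    show "onorm (\<lambda>h. h *\<^sub>R (U r s (cay r x) - cay r x)) \<le> t * norm (cay r (cay r x))" if s: "s \<in> {0..t}" for s
    proof (rule onorm_le)
      fix h :: real
      have "norm (U r s (cay r x) - cay r x) \<le> s * norm (cay r (cay r x))"
        using lip s by simp
      also have "\<dots> \<le> t * norm (cay r (cay r x))" using s by (simp add: mult_right_mono)
      finally show "norm (h *\<^sub>R (U r s (cay r x) - cay r x)) \<le> t * norm (cay r (cay r x)) * norm h"
        using mult_left_mono[of _ _ "\<bar>h\<bar>"] by (simp add: mult.commute[of _ "\<bar>h\<bar>"])
    qed
  qed (use assms in auto)
  then show ?thesis
    using assms by (simp add: d_def U_zero power2_eq_square mult_ac diff_diff_add add.commute)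
qed

text \<open>\<open>U_taylor\<close> in the limit r to 1. Each of the two factors \<open>M\<close>
  absorbs one factor \<open>cay r\<close> at a cost of 6, whence 36. The expansion identifies the
  derivative at t = 0, on which uniqueness rests.\<close>

lemma phi_op_taylor:
  assumes "t \<ge> 0"
  shows "norm (phi_op t T (M (M y)) - M (M y) - t *\<^sub>R (M (M y) - 2 *\<^sub>R M y)) \<le> t\<^sup>2 * (36 * norm y)"
proof (rule tendsto_upperbound)
  have "((\<lambda>r. cay r (M (M y))) \<longlongrightarrow> M (M y) - 2 *\<^sub>R M y) (at_left 1)"
  proof (rule Lim_transform_bound[where g = "\<lambda>r. 4 * (1 - r) * norm y" and f = "\<lambda>r. cay r (M (M y)) - (M (M y) - 2 *\<^sub>R M y)", THEN LIM_zero_cancel])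
    show "\<forall>\<^sub>F r in at_left 1. norm (cay r (M (M y)) - (M (M y) - 2 *\<^sub>R M y)) \<le> norm (4 * (1 - r) * norm y)"
      using eventually_at_left_1 by (rule eventually_mono) (use res_M_approx in auto)
    show "((\<lambda>r. 4 * (1 - r) * norm y) \<longlongrightarrow> 0) (at_left 1)"
      by (auto intro!: tendsto_eq_intros)
  qed
  then show "((\<lambda>r. norm (U r t (M (M y)) - M (M y) - t *\<^sub>R cay r (M (M y)))) \<longlongrightarrow>
      norm (phi_op t T (M (M y)) - M (M y) - t *\<^sub>R (M (M y) - 2 *\<^sub>R M y))) (at_left 1)"
    by (intro tendsto_norm tendsto_diff tendsto_scaleR phi_op_tendsto assms tendsto_const)
  show "\<forall>\<^sub>F r in at_left 1. norm (U r t (M (M y)) - M (M y) - t *\<^sub>R cay r (M (M y))) \<le> t\<^sup>2 * (36 * norm y)"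
    using eventually_at_left_1
  proof (rule eventually_mono)
    fix r :: real assume "0 < r \<and> r < 1"
    then have r: "0 < r" "r < 1" by auto
    have "cay r (M x) = M (cay r x)" for x
      by (simp add: cay_apply[OF r] M_apply blinfun.bilinear_simps T_res[OF r] algebra_simps)
    then have "norm (cay r (cay r (M (M y)))) \<le> 6 * norm (cay r (M y))"
      by (metis norm_cay_M[OF r])
    also have "\<dots> \<le> 36 * norm y" using norm_cay_M[OF r, of y] by simp
    finally have "t\<^sup>2 * norm (cay r (cay r (M (M y)))) \<le> t\<^sup>2 * (36 * norm y)"
      by (rule mult_left_mono) simp
    then show "norm (U r t (M (M y)) - M (M y) - t *\<^sub>R cay r (M (M y))) \<le> t\<^sup>2 * (36 * norm y)"
      using U_taylor[OF r assms, of "M (M y)"] by linarith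
  qed
qed auto

end

section \<open>Cogenerators of contraction semigroups\<close>

lemma right_derivative_tendsto:
  fixes f :: "real \<Rightarrow> 'a::real_normed_vector"
  assumes "(f has_vector_derivative d) (at 0 within {0..1})"
  shows "((\<lambda>t. (1 / t) *\<^sub>R (f t - f 0)) \<longlongrightarrow> d) (at_right 0)"
proof -
  have "((\<lambda>y. (1 / norm (y - 0)) *\<^sub>R (f y - (f 0 + (y - 0) *\<^sub>R d))) \<longlongrightarrow> 0) (at 0 within {0..1})"
    using assms unfolding has_vector_derivative_def has_derivative_within by blast
  then have "((\<lambda>y. (1 / norm (y - 0)) *\<^sub>R (f y - (f 0 + (y - 0) *\<^sub>R d))) \<longlongrightarrow> 0) (at_right 0)"
    by (simp only: at_within_Icc_at_right zero_less_one)
  then have "((\<lambda>t. (1 / t) *\<^sub>R (f t - f 0) - d) \<longlongrightarrow> 0) (at_right 0)"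
  proof (rule Lim_transform_eventually)
    show "\<forall>\<^sub>F t in at_right 0. (1 / norm (t - 0)) *\<^sub>R (f t - (f 0 + (t - 0) *\<^sub>R d)) = (1 / t) *\<^sub>R (f t - f 0) - d"
      using eventually_at_right_less[of "0::real"]
      by (rule eventually_mono) (auto simp: algebra_simps)
  qed
  then show ?thesis by (rule LIM_zero_cancel)
qed

locale c0_contraction =
  fixes G :: "real \<Rightarrow> 'e::{real_inner, banach} \<Rightarrow>\<^sub>L 'e"
  assumes G_0: "G 0 x = x"
    and G_add: "s \<ge> 0 \<Longrightarrow> t \<ge> 0 \<Longrightarrow> G (s + t) x = G s (G t x)"
    and norm_G: "t \<ge> 0 \<Longrightarrow> norm (G t x) \<le> norm x"
    and G_tendsto: "((\<lambda>t. G t x) \<longlongrightarrow> x) (at_right 0)"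
begin

lemma G_commute: "s \<ge> 0 \<Longrightarrow> t \<ge> 0 \<Longrightarrow> G s (G t x) = G t (G s x)"
  by (metis G_add add.commute)

lemma G_diff_le:
  assumes "0 \<le> s" "s \<le> t"
  shows "norm (G t x - G s x) \<le> norm (G (t - s) x - x)"
proof -
  have "G t x = G s (G (t - s) x)"
    using G_add[of s "t - s" x] assms by simp
  then have "G t x - G s x = G s (G (t - s) x - x)"
    by (simp add: blinfun.bilinear_simps)
  then show ?thesis using norm_G assms by simp
qed

text \<open>Contractivity bounds every increment by one that starts at time 0, so right continuity
  at 0 gives two-sided continuity everywhere.\<close>

lemma continuous_on_G: "continuous_on {0..} (\<lambda>t. G t x)"
  unfolding continuous_on_iff
proof (intro ballI allI impI)
  fix s e :: real assume s: "s \<in> {0..}" and "e > 0"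
  have "\<forall>\<^sub>F t in at_right 0. dist (G t x) x < e"
    using G_tendsto \<open>e > 0\<close> by (rule tendstoD)
  then obtain d where d: "d > 0" "\<And>t. 0 < t \<Longrightarrow> t < d \<Longrightarrow> dist (G t x) x < e"
    unfolding eventually_at_right_field by blast
  have "dist (G t x) (G s x) < e" if "t \<ge> 0" "dist t s < d" for t
  proof (cases t s rule: linorder_cases)
    case less
    then show ?thesis
      using G_diff_le[of t s x] d(2)[of "s - t"] that by (auto simp: dist_norm norm_minus_commute)
  next
    case greater
    then show ?thesis
      using G_diff_le[of s t x] d(2)[of "t - s"] that s by (auto simp: dist_norm)
  qed (use \<open>e > 0\<close> in auto)
  then show "\<exists>d>0. \<forall>x'\<in>{0..}. dist x' s < d \<longrightarrow> dist (G x' x) (G s x) < e"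
    using d(1) by auto
qed

section \<open>The Laplace transform at 1 and its range\<close>

definition P :: "'e \<Rightarrow> real \<Rightarrow> 'e" where
  "P x b = integral {0..b} (\<lambda>t. exp (- t) *\<^sub>R G t x)"

lemma continuous_on_expG: "0 \<le> a \<Longrightarrow> continuous_on {a..b} (\<lambda>t. exp (- t) *\<^sub>R G t x)"
  by (intro continuous_intros continuous_on_subset[OF continuous_on_G]) auto

lemma integrable_expG: "0 \<le> a \<Longrightarrow> (\<lambda>t. exp (- t) *\<^sub>R G t x) integrable_on {a..b}"
  by (rule integrable_continuous_real[OF continuous_on_expG])

lemma P_diff:
  assumes "0 \<le> a" "a \<le> b"
  shows "P x b - P x a = integral {a..b} (\<lambda>t. exp (- t) *\<^sub>R G t x)"
  using Henstock_Kurzweil_Integration.integral_combine[OF assms integrable_expG[of 0 x b]]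
  by (simp add: P_def algebra_simps)

lemma norm_P_diff:
  assumes "0 \<le> a" "a \<le> b"
  shows "norm (P x b - P x a) \<le> exp (- a) * norm x"
proof -
  have I: "((\<lambda>t. exp (- t) * norm x) has_integral (- exp (- b) * norm x - (- exp (- a) * norm x))) {a..b}"
    by (rule fundamental_theorem_of_calculus[OF assms(2)])
      (auto intro!: derivative_eq_intros simp flip: has_real_derivative_iff_has_vector_derivative)
  have "norm (P x b - P x a) \<le> integral {a..b} (\<lambda>t. exp (- t) * norm x)"
    unfolding P_diff[OF assms]
  proof (rule integral_norm_bound_integral)
    show "(\<lambda>t. exp (- t) * norm x) integrable_on {a..b}" using I by blast
    show "norm (exp (- t) *\<^sub>R G t x) \<le> exp (- t) * norm x" if "t \<in> {a..b}" for t
      using that assms by (simp add: norm_G)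
  qed (use assms in \<open>simp add: integrable_expG\<close>)
  also have "\<dots> = (exp (- a) - exp (- b)) * norm x"
    using integral_unique[OF I] by (simp add: algebra_simps)
  also have "\<dots> \<le> exp (- a) * norm x"
    by (intro mult_right_mono) auto
  finally show ?thesis .
qed

lemma P_add: "P (x + y) b = P x b + P y b"
  unfolding P_def
  by (subst integral_add[symmetric]) (auto simp: integrable_expG blinfun.bilinear_simps scaleR_add_right)

lemma P_scaleR: "P (c *\<^sub>R x) b = c *\<^sub>R P x b"
  unfolding P_def
  by (subst integral_cmul[symmetric]) (auto simp: blinfun.bilinear_simps mult.commute)

lemma exp_minus_tendsto: "(\<lambda>n. exp (- real n) * c) \<longlonglongrightarrow> 0"
proof -
  have "(\<lambda>n. (exp (- 1 :: real)) ^ n) \<longlonglongrightarrow> 0"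
    by (rule LIMSEQ_power_zero) auto
  then have "(\<lambda>n. exp (- real n)) \<longlonglongrightarrow> 0"
    by (simp add: exp_of_nat_mult[symmetric])
  then show ?thesis by (rule tendsto_mult_left_zero)
qed

lemma P_convergent: "convergent (\<lambda>n. P x (real n))"
proof (rule Cauchy_convergent, rule CauchyI)
  fix e :: real assume "e > 0"
  obtain N where N: "\<And>n. n \<ge> N \<Longrightarrow> exp (- real n) * norm x < e"
    using exp_minus_tendsto[of "norm x"] \<open>e > 0\<close> unfolding lim_sequentially by force
  have *: "norm (P x (real n) - P x (real m)) < e" if "N \<le> m" "m \<le> n" for m n
    using le_less_trans[OF norm_P_diff N[OF that(1)]] that by simp
  show "\<exists>M. \<forall>m\<ge>M. \<forall>n\<ge>M. norm (P x (real m) - P x (real n)) < e"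
    using * by (metis nat_le_linear norm_minus_commute)
qed

text \<open>For the generator A of the semigroup, this is the resolvent (I - A)^(-1) as a Laplace
  integral.\<close>

definition R :: "'e \<Rightarrow>\<^sub>L 'e" where
  "R = Blinfun (\<lambda>x. lim (\<lambda>n. P x (real n)))"

lemma norm_P_le: "norm (P x (real n)) \<le> norm x"
  using norm_P_diff[of 0 "real n" x] by (simp add: P_def)

lemma P_lim: "(\<lambda>n. P x (real n)) \<longlonglongrightarrow> lim (\<lambda>n. P x (real n))"
  using P_convergent convergent_LIMSEQ_iff by blast

lemma P_tendsto: "(\<lambda>n. P x (real n)) \<longlonglongrightarrow> R x"
proof -
  have "bounded_linear (\<lambda>x. lim (\<lambda>n. P x (real n)))"
  proof (rule bounded_linear_intro[where K = 1])
    show "lim (\<lambda>n. P (x + y) (real n)) = lim (\<lambda>n. P x (real n)) + lim (\<lambda>n. P y (real n))" for x y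
      unfolding P_add by (intro limI tendsto_add P_lim)
    show "lim (\<lambda>n. P (r *\<^sub>R x) (real n)) = r *\<^sub>R lim (\<lambda>n. P x (real n))" for r x
      unfolding P_scaleR by (intro limI tendsto_scaleR tendsto_const P_lim)
    show "norm (lim (\<lambda>n. P x (real n))) \<le> norm x * 1" for x
      using P_lim[of x] by (auto intro!: LIMSEQ_le_const2[OF tendsto_norm] simp: norm_P_le)
  qed
  then show ?thesis
    using P_lim by (simp add: R_def bounded_linear_Blinfun_apply)
qed

lemma G_R_commute:
  assumes "s \<ge> 0"
  shows "G s (R x) = R (G s x)"
proof -
  have "G s (P x (real n)) = P (G s x) (real n)" for n
  proof -
    have "G s (P x (real n)) = integral {0..real n} (G s \<circ> (\<lambda>t. exp (- t) *\<^sub>R G t x))"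
      unfolding P_def by (rule integral_linear[symmetric])
        (auto simp: integrable_expG blinfun.bounded_linear_right)
    also have "\<dots> = P (G s x) (real n)"
      unfolding P_def by (rule integral_cong) (auto simp: blinfun.bilinear_simps G_commute assms)
    finally show ?thesis .
  qed
  then have "(\<lambda>n. P (G s x) (real n)) \<longlonglongrightarrow> G s (R x)"
    using bounded_linear.tendsto[OF blinfun.bounded_linear_right P_tendsto, of "G s" x] by simp
  then show ?thesis using P_tendsto LIMSEQ_unique by blast
qed

lemma P_deriv:
  assumes "t \<in> {0..b}"
  shows "((\<lambda>t. P x t) has_vector_derivative exp (- t) *\<^sub>R G t x) (at t within {0..b})"
  unfolding P_def by (rule integral_has_vector_derivative[OF continuous_on_expG assms]) simp

text \<open>The substitution s to t + s, done through antiderivatives: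
  \<open>exp t *\<^sub>R P x (t + s)\<close> has derivative
  \<open>exp (- s) *\<^sub>R G t (G s x)\<close> in s.\<close>

lemma G_P:
  assumes "t \<ge> 0" "b \<ge> 0"
  shows "G t (P x b) = exp t *\<^sub>R (P x (t + b) - P x t)"
proof -
  have "((\<lambda>s. exp (- s) *\<^sub>R G t (G s x)) has_integral exp t *\<^sub>R P x (t + b) - exp t *\<^sub>R P x (t + 0)) {0..b}"
  proof (rule fundamental_theorem_of_calculus[OF assms(2)])
    fix s assume s: "s \<in> {0..b}"
    have "((\<lambda>u. P x u) \<circ> (\<lambda>s. t + s) has_vector_derivative 1 *\<^sub>R (exp (- (t + s)) *\<^sub>R G (t + s) x)) (at s within {0..b})"
    proof (rule vector_diff_chain_within)
      show "((+) t has_vector_derivative 1) (at s within {0..b})"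
        by (auto intro!: derivative_eq_intros)
      show "(P x has_vector_derivative exp (- (t + s)) *\<^sub>R G (t + s) x) (at (t + s) within (+) t ` {0..b})"
        by (rule has_vector_derivative_within_subset[OF P_deriv[of _ "t + b"]]) (use s assms in auto)
    qed
    then have "((\<lambda>s. exp t *\<^sub>R P x (t + s)) has_vector_derivative exp t *\<^sub>R (exp (- (t + s)) *\<^sub>R G (t + s) x)) (at s within {0..b})"
      by (intro bounded_linear.has_vector_derivative[OF bounded_linear_scaleR_right]) (simp add: o_def)
    then show "((\<lambda>s. exp t *\<^sub>R P x (t + s)) has_vector_derivative exp (- s) *\<^sub>R G t (G s x)) (at s within {0..b})"
      using s assms exp_add[of t "- (t + s)"] by (simp add: G_add)
  qed
  moreover have "((\<lambda>s. exp (- s) *\<^sub>R G t (G s x)) has_integral G t (P x b)) {0..b}"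
    using has_integral_linear[OF integrable_integral[OF integrable_expG[of 0 x b]] blinfun.bounded_linear_right[of "G t"]]
    by (simp add: P_def o_def blinfun.bilinear_simps)
  ultimately show ?thesis
    by (auto simp: scaleR_diff_right dest: has_integral_unique)
qed

text \<open>\<open>G_P\<close> for b tending to infinity. Orbits that start in the range of
  \<open>R\<close> become visibly differentiable, because \<open>t\<close> occurs on the right only
  in \<open>exp t\<close> and in an integration bound.\<close>

lemma G_R:
  assumes "t \<ge> 0"
  shows "G t (R x) = exp t *\<^sub>R (R x - P x t)"
proof -
  have "(\<lambda>n. P x (t + real n) - P x (real n)) \<longlonglongrightarrow> 0"
    using norm_P_diff[of "real n" "t + real n" x for n] assms
    by (intro Lim_null_comparison[OF _ exp_minus_tendsto[of "norm x"]]) auto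
  then have "(\<lambda>n. (P x (t + real n) - P x (real n)) + P x (real n)) \<longlonglongrightarrow> 0 + R x"
    by (rule tendsto_add) (rule P_tendsto)
  then have "(\<lambda>n. exp t *\<^sub>R (P x (t + real n) - P x t)) \<longlonglongrightarrow> exp t *\<^sub>R (R x - P x t)"
    by (intro tendsto_scaleR tendsto_diff tendsto_const) simp
  moreover have "(\<lambda>n. G t (P x (real n))) \<longlonglongrightarrow> G t (R x)"
    by (rule bounded_linear.tendsto[OF blinfun.bounded_linear_right P_tendsto])
  ultimately show ?thesis
    using LIMSEQ_unique G_P[OF assms] by simp
qed

text \<open>This is A R = R - I for the generator A, phrased without introducing A.\<close>

lemma G_R_deriv:
  assumes "t \<in> {0..b}"
  shows "((\<lambda>t. G t (R x)) has_vector_derivative G t (R x - x)) (at t within {0..b})"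
proof -
  have "((\<lambda>t. exp t *\<^sub>R (R x - P x t)) has_vector_derivative
     exp t *\<^sub>R (- (exp (- t) *\<^sub>R G t x)) + exp t *\<^sub>R (R x - P x t)) (at t within {0..b})"
  proof (rule has_vector_derivative_scaleR)
    show "((\<lambda>t. R x - P x t) has_vector_derivative - (exp (- t) *\<^sub>R G t x)) (at t within {0..b})"
      using has_vector_derivative_diff[OF has_vector_derivative_const P_deriv[OF assms]] by simp
  qed (auto intro!: derivative_eq_intros)
  also have "exp t *\<^sub>R (- (exp (- t) *\<^sub>R G t x)) + exp t *\<^sub>R (R x - P x t) = G t (R x - x)"
    using assms by (simp add: G_R blinfun.bilinear_simps exp_minus)
  finally show ?thesis
    by (rule has_vector_derivative_transform[OF assms, rotated]) (auto simp: G_R)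
qed

lemma G_R_deriv_0: "((\<lambda>t. (1 / t) *\<^sub>R (G t (R x) - R x)) \<longlongrightarrow> R x - x) (at_right 0)"
  using right_derivative_tendsto[OF G_R_deriv[of 0 1 x]] by (simp add: G_0)

text \<open>If \<open>R x = 0\<close>, the orbit of \<open>R x\<close> is constantly 0, while its
  derivative at 0 is \<open>- x\<close>.\<close>

lemma R_inj:
  assumes "R x = 0"
  shows "x = 0"
proof -
  have "((\<lambda>t. 0) \<longlongrightarrow> - x) (at_right (0::real))"
    using G_R_deriv_0[of x] by (simp add: assms blinfun.bilinear_simps)
  then show ?thesis
    using tendsto_unique[OF trivial_limit_at_right_real _ tendsto_const] by fastforce
qed

text \<open>With \<open>R\<close> = (I - A)^(-1) this is (A + I)(A - I)^(-1), the Cayley transform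
  of the generator A.\<close>

definition cogen :: "'e \<Rightarrow>\<^sub>L 'e" where "cogen = id_blinfun - 2 *\<^sub>R R"

lemma cogen_apply: "cogen x = x - 2 *\<^sub>R R x"
  by (simp add: cogen_def blinfun.bilinear_simps)

text \<open>\<open>R x - x\<close> is the right derivative at 0 of the orbit of \<open>R x\<close>,
  whose norm cannot grow. Four times this inner product is the difference of the squared norms of
  \<open>cogen x\<close> and \<open>x\<close>.\<close>

lemma R_dissipative: "inner (R x - x) (R x) \<le> 0"
proof (rule tendsto_upperbound)
  show "((\<lambda>t. inner ((1 / t) *\<^sub>R (G t (R x) - R x)) (R x)) \<longlongrightarrow> inner (R x - x) (R x)) (at_right 0)"
    by (intro tendsto_inner tendsto_const G_R_deriv_0)
  show "\<forall>\<^sub>F t in at_right 0. inner ((1 / t) *\<^sub>R (G t (R x) - R x)) (R x) \<le> 0"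
    using eventually_at_right_less[of "0::real"]
  proof (rule eventually_mono)
    fix t :: real assume "0 < t"
    have "inner (G t (R x)) (R x) \<le> norm (R x) * norm (R x)"
      using norm_cauchy_schwarz[of "G t (R x)" "R x"] mult_right_mono[OF norm_G[of t "R x"], of "norm (R x)"] \<open>0 < t\<close>
      by simp
    then show "inner ((1 / t) *\<^sub>R (G t (R x) - R x)) (R x) \<le> 0"
      using \<open>0 < t\<close> by (simp add: inner_diff_left divide_le_0_iff power2_norm_eq_inner[symmetric] power2_eq_square)
  qed
qed auto

lemma norm_cogen_apply: "norm (cogen x) \<le> norm x"
proof -
  have "(norm (cogen x))\<^sup>2 = (norm x)\<^sup>2 + 4 * inner (R x - x) (R x)"
    by (simp add: cogen_apply power2_norm_eq_inner inner_simps inner_commute)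
  then have "(norm (cogen x))\<^sup>2 \<le> (norm x)\<^sup>2"
    using R_dissipative[of x] by simp
  then show ?thesis by (rule power2_le_imp_le) simp
qed

sublocale cog: contraction_no_fixed cogen
proof
  show "norm cogen \<le> 1"
    by (rule norm_blinfun_bound) (auto simp: norm_cogen_apply)
  show "x = 0" if "cogen x = x" for x
    using that R_inj[of x] by (simp add: cogen_apply)
qed

lemma cog_M: "cog.M x = 2 *\<^sub>R R x"
  by (simp add: cog.M_apply cogen_apply)

text \<open>For the cogenerator, \<open>M (M y)\<close> is \<open>4 *\<^sub>R R (R y)\<close>, so
  its orbit is differentiable, with the derivative that \<open>cay r\<close> reproduces up to an
  error of order 1 - r. Hence \<open>duhamel\<close> compares it with \<open>U r\<close>; density of
  these vectors and contractivity of both sides give all \<open>x\<close>.\<close>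

lemma phi_op_cogen:
  assumes "t \<ge> 0"
  shows "phi_op t cogen x = G t x"
proof -
  have range: "phi_op t cogen (cog.M (cog.M y)) = G t (cog.M (cog.M y))" for y
  proof -
    have "norm (G t (cog.M (cog.M y)) - cog.U r t (cog.M (cog.M y))) \<le> t * (4 * (1 - r) * norm y)"
      if r: "0 < r" "r < 1" for r
    proof -
      have "norm (G t (cog.M (cog.M y)) - cog.U r t (G 0 (cog.M (cog.M y)))) \<le> t * (4 * (1 - r) * norm y)"
      proof (rule cog.duhamel[OF r assms, where w' = "\<lambda>s. G s (cog.M (cog.M y) - 2 *\<^sub>R cog.M y)"])
        fix s assume s: "s \<in> {0..t}"
        have "((\<lambda>s. 4 *\<^sub>R G s (R (R y))) has_vector_derivative 4 *\<^sub>R G s (R (R y) - R y)) (at s within {0..t})"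
          using bounded_linear.has_vector_derivative[OF bounded_linear_scaleR_right G_R_deriv[OF s, of "R y"]] .
        then show "((\<lambda>s. G s (cog.M (cog.M y))) has_vector_derivative G s (cog.M (cog.M y) - 2 *\<^sub>R cog.M y)) (at s within {0..t})"
          by (simp add: cog_M blinfun.bilinear_simps scaleR_diff_right)
        have "cogen (G s z) = G s (cogen z)" for z
          using s by (simp add: cogen_apply blinfun.bilinear_simps G_R_commute)
        then have "cog.cay r (G s z) = G s (cog.cay r z)" for z
          using cog.cay_commute[OF r, of "G s"] by (metis blinfun_apply_blinfun_compose)
        then have "G s (cog.M (cog.M y) - 2 *\<^sub>R cog.M y) - cog.cay r (G s (cog.M (cog.M y)))
            = - G s (cog.cay r (cog.M (cog.M y)) - (cog.M (cog.M y) - 2 *\<^sub>R cog.M y))"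
          by (simp add: blinfun.bilinear_simps)
        then have "norm (G s (cog.M (cog.M y) - 2 *\<^sub>R cog.M y) - cog.cay r (G s (cog.M (cog.M y))))
            \<le> norm (cog.cay r (cog.M (cog.M y)) - (cog.M (cog.M y) - 2 *\<^sub>R cog.M y))"
          using s norm_G by simp
        then show "norm (G s (cog.M (cog.M y) - 2 *\<^sub>R cog.M y) - cog.cay r (G s (cog.M (cog.M y)))) \<le> 4 * (1 - r) * norm y"
          using cog.res_M_approx[OF r, of y] by linarith
      qed
      then show ?thesis by (simp add: G_0)
    qed
    note bound = this
    have "((\<lambda>r. cog.U r t (cog.M (cog.M y))) \<longlongrightarrow> G t (cog.M (cog.M y))) (at_left 1)"
    proof (rule Lim_transform_bound[where g = "\<lambda>r. t * (4 * (1 - r) * norm y)" and f = "\<lambda>r. cog.U r t (cog.M (cog.M y)) - G t (cog.M (cog.M y))", THEN LIM_zero_cancel])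
      show "\<forall>\<^sub>F r in at_left 1. norm (cog.U r t (cog.M (cog.M y)) - G t (cog.M (cog.M y))) \<le> norm (t * (4 * (1 - r) * norm y))"
        using eventually_at_left_1
      proof (rule eventually_mono)
        fix r :: real assume "0 < r \<and> r < 1"
        then have "norm (cog.U r t (cog.M (cog.M y)) - G t (cog.M (cog.M y))) \<le> t * (4 * (1 - r) * norm y)"
          using bound[of r] by (simp add: norm_minus_commute)
        then show "norm (cog.U r t (cog.M (cog.M y)) - G t (cog.M (cog.M y))) \<le> norm (t * (4 * (1 - r) * norm y))"
          by (rule order_trans) simp
      qed
      show "((\<lambda>r. t * (4 * (1 - r) * norm y)) \<longlongrightarrow> 0) (at_left 1)"
        by (auto intro!: tendsto_eq_intros)
    qed
    then show ?thesis
      using cog.phi_op_tendsto[OF assms] tendsto_unique[OF trivial_limit_at_left_real] by blast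
  qed
  have "norm (phi_op t cogen x - G t x) \<le> 0 + e" if "e > 0" for e
  proof -
    have "e / 2 > 0" using that by simp
    then obtain y where y: "norm (x - cog.M (cog.M y)) < e / 2" by (rule cog.approx_MM)
    have "norm (G t (cog.M (cog.M y)) - G t x) \<le> norm (x - cog.M (cog.M y))"
      using norm_G[OF assms, of "cog.M (cog.M y) - x"] by (simp add: blinfun.bilinear_simps norm_minus_commute)
    then have "norm (phi_op t cogen x - G t x) \<le> 2 * norm (x - cog.M (cog.M y))"
      using cog.phi_op_contraction[OF assms, of x "cog.M (cog.M y)"]
        norm_triangle_ineq[of "phi_op t cogen x - phi_op t cogen (cog.M (cog.M y))" "G t (cog.M (cog.M y)) - G t x"]
      by (simp add: range)
    then show ?thesis using y by simp
  qed
  then have "norm (phi_op t cogen x - G t x) \<le> 0" by (rule field_le_epsilon)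
  then show ?thesis by simp
qed

text \<open>Uniqueness: \<open>G\<^sub>t R M\<^sup>2 y\<close> is differentiated at 0 in two ways.\<close>

lemma cogen_unique:
  assumes S: "contraction_no_fixed S" and eq: "\<And>t x. t \<ge> 0 \<Longrightarrow> G t x = phi_op t S x"
  shows "S = cogen"
proof -
  interpret S: contraction_no_fixed S by (rule S)
  have taylor: "((\<lambda>t. (1 / t) *\<^sub>R (G t (S.M (S.M y)) - S.M (S.M y))) \<longlongrightarrow> S.M (S.M y) - 2 *\<^sub>R S.M y) (at_right 0)" for y
  proof (rule Lim_transform_bound[where g = "\<lambda>t. t * (36 * norm y)" and f = "\<lambda>t. (1 / t) *\<^sub>R (G t (S.M (S.M y)) - S.M (S.M y)) - (S.M (S.M y) - 2 *\<^sub>R S.M y)", THEN LIM_zero_cancel])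
    show "\<forall>\<^sub>F t in at_right 0. norm ((1 / t) *\<^sub>R (G t (S.M (S.M y)) - S.M (S.M y)) - (S.M (S.M y) - 2 *\<^sub>R S.M y)) \<le> norm (t * (36 * norm y))"
      using eventually_at_right_less[of "0::real"]
    proof (rule eventually_mono)
      fix t :: real assume t: "0 < t"
      have "(1 / t) *\<^sub>R (G t (S.M (S.M y)) - S.M (S.M y)) - (S.M (S.M y) - 2 *\<^sub>R S.M y)
         = (1 / t) *\<^sub>R (G t (S.M (S.M y)) - S.M (S.M y) - t *\<^sub>R (S.M (S.M y) - 2 *\<^sub>R S.M y))"
        using t by (simp add: scaleR_diff_right)
      also have "norm \<dots> \<le> (1 / t) * (t\<^sup>2 * (36 * norm y))"
        using S.phi_op_taylor[of t y] t eq[of t] by (simp add: mult_left_mono divide_right_mono)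
      also have "\<dots> = t * (36 * norm y)" using t by (simp add: power2_eq_square)
      finally show "norm ((1 / t) *\<^sub>R (G t (S.M (S.M y)) - S.M (S.M y)) - (S.M (S.M y) - 2 *\<^sub>R S.M y)) \<le> norm (t * (36 * norm y))"
        using t by simp
    qed
    show "((\<lambda>t. t * (36 * norm y)) \<longlongrightarrow> 0) (at_right 0)"
      by (auto intro!: tendsto_eq_intros)
  qed
  \<comment> \<open>\<open>R\<close> commutes with \<open>G t\<close>, so the expansion of
    \<open>phi_op\<close> and \<open>G_R_deriv_0\<close> both compute the derivative; cancelling
    \<open>R (S.M (S.M y))\<close> leaves the claim.\<close>
  have M_eq: "2 *\<^sub>R R (S.M y) = S.M (S.M y)" for y
  proof -
    have "((\<lambda>t. R ((1 / t) *\<^sub>R (G t (S.M (S.M y)) - S.M (S.M y)))) \<longlongrightarrow> R (S.M (S.M y) - 2 *\<^sub>R S.M y)) (at_right 0)"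
      by (rule bounded_linear.tendsto[OF blinfun.bounded_linear_right taylor])
    then have "((\<lambda>t. (1 / t) *\<^sub>R (G t (R (S.M (S.M y))) - R (S.M (S.M y)))) \<longlongrightarrow> R (S.M (S.M y) - 2 *\<^sub>R S.M y)) (at_right 0)"
    proof (rule Lim_transform_eventually)
      show "\<forall>\<^sub>F t in at_right 0. R ((1 / t) *\<^sub>R (G t (S.M (S.M y)) - S.M (S.M y))) = (1 / t) *\<^sub>R (G t (R (S.M (S.M y))) - R (S.M (S.M y)))"
        using eventually_at_right_less[of "0::real"]
        by (rule eventually_mono) (simp add: blinfun.bilinear_simps G_R_commute)
    qed
    then have "R (S.M (S.M y) - 2 *\<^sub>R S.M y) = R (S.M (S.M y)) - S.M (S.M y)"
      using G_R_deriv_0 tendsto_unique[OF trivial_limit_at_right_real] by blast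
    then show ?thesis by (simp add: blinfun.bilinear_simps)
  qed
  \<comment> \<open>The bounded operators \<open>2 *\<^sub>R R\<close> and \<open>S.M\<close> agree
    on the range of \<open>S.M\<close>, which is dense because \<open>S\<close> has no nonzero fixed
    vector.\<close>
  have "S x = cogen x" for x
  proof -
    have "norm (2 *\<^sub>R R x - S.M x) \<le> 0 + e" if "e > 0" for e
    proof -
      have "e / 4 > 0" using that by simp
      then obtain y where y: "norm (x - S.M y) < e / 4" by (rule S.approx_M)
      have "2 *\<^sub>R R x - S.M x = cog.M (x - S.M y) - S.M (x - S.M y)"
        using M_eq[of y] by (simp add: blinfun.bilinear_simps cog_M scaleR_diff_right)
      also have "norm \<dots> \<le> 4 * norm (x - S.M y)"
        using norm_triangle_ineq4[of "cog.M (x - S.M y)" "S.M (x - S.M y)"] cog.norm_M[of "x - S.M y"] S.norm_M[of "x - S.M y"]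
        by linarith
      finally show ?thesis using y by simp
    qed
    then have "norm (2 *\<^sub>R R x - S.M x) \<le> 0" by (rule field_le_epsilon)
    then show ?thesis by (simp add: S.M_apply cogen_apply algebra_simps)
  qed
  then show ?thesis by (rule blinfun_eqI)
qed

end

section \<open>Vector-valued holomorphic functions\<close>

text \<open>Separated from the Hilbert space setting because it is used twice: for vectors and, with
  \<open>Jop\<close>, for operators, whose norm comes from no inner product.\<close>

locale complex_banach =
  fixes J :: "'x::banach \<Rightarrow>\<^sub>L 'x"
  assumes norm_scC: "norm (scC J c x) = norm c * norm x"
    and scC_scC: "scC J c (scC J d x) = scC J (c * d) x"
begin

lemma scC_add_right: "scC J c (x + y) = scC J c x + scC J c y"
  by (simp add: scC_def blinfun.bilinear_simps scaleR_add_right)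

lemma scC_diff_right: "scC J c (x - y) = scC J c x - scC J c y"
  by (simp add: scC_def blinfun.bilinear_simps scaleR_diff_right)

lemma scC_add_left: "scC J (c + d) x = scC J c x + scC J d x"
  by (simp add: scC_def scaleR_add_left)

lemma scC_diff_left: "scC J (c - d) x = scC J c x - scC J d x"
  by (simp add: scC_def scaleR_diff_left)

lemma scC_scaleR_right: "scC J c (a *\<^sub>R x) = a *\<^sub>R scC J c x"
  by (simp add: scC_def blinfun.bilinear_simps scaleR_add_right mult.commute)

lemma scC_scaleR_left: "scC J (a *\<^sub>R c) x = a *\<^sub>R scC J c x"
  by (simp add: scC_def scaleR_add_right)

lemma scC_simps [simp]: "scC J 0 x = 0" "scC J 1 x = x" "scC J c 0 = 0" "scC J (- c) x = - scC J c x"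
  by (simp_all add: scC_def blinfun.bilinear_simps)

lemma bounded_bilinear_scC: "bounded_bilinear (scC J)"
  by (rule bounded_bilinear.intro)
    (auto simp: scC_add_left scC_add_right scC_scaleR_left scC_scaleR_right norm_scC intro: exI[of _ 1])

lemma bounded_linear_scC_left: "bounded_linear (\<lambda>c. scC J c x)"
  by (rule bounded_bilinear.bounded_linear_left[OF bounded_bilinear_scC])

text \<open>\<open>dq w \<rho> C f\<close>: the difference quotients of \<open>f\<close> at \<open>w\<close> are \<open>C\<close>-Lipschitz in the increment (with
  denominators cleared). The condition implies complex differentiability and survives limits,
  integrals and suprema.\<close>

definition dq :: "complex \<Rightarrow> real \<Rightarrow> real \<Rightarrow> (complex \<Rightarrow> 'x) \<Rightarrow> bool" where
  "dq w \<rho> C f \<longleftrightarrow> 0 \<le> C \<and> (\<forall>h k. norm h \<le> \<rho> \<longrightarrow> norm k \<le> \<rho> \<longrightarrow>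
     norm (scC J k (f (w + h) - f w) - scC J h (f (w + k) - f w)) \<le> C * (norm h * norm k * norm (h - k)))"

text \<open>The quotients \<open>Q h\<close> are Lipschitz in \<open>h\<close>, so by completeness
  they converge to some \<open>v\<close> along a sequence of increments tending to 0, and
  \<open>norm (Q h - v) \<le> C * norm h\<close> is differentiability with a rate.\<close>

lemma dq_has_derivative:
  assumes dq: "dq w \<rho> C f" and \<rho>: "\<rho> > 0"
  obtains v where "(f has_derivative (\<lambda>h. scC J h v)) (at w)"
proof -
  define Q where "Q = (\<lambda>h. scC J (1 / h) (f (w + h) - f w))"
  have C: "C \<ge> 0" using dq by (simp add: dq_def)
  have QQ: "norm (Q h - Q k) \<le> C * norm (h - k)"
    if "h \<noteq> 0" "k \<noteq> 0" "norm h \<le> \<rho>" "norm k \<le> \<rho>" for h k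
  proof -
    have "Q h - Q k = scC J (1 / (h * k)) (scC J k (f (w + h) - f w) - scC J h (f (w + k) - f w))"
      using that by (simp add: Q_def scC_diff_right scC_scC)
    then have "norm (Q h - Q k) = (1 / norm (h * k)) * norm (scC J k (f (w + h) - f w) - scC J h (f (w + k) - f w))"
      by (simp add: norm_scC norm_divide)
    also have "\<dots> \<le> (1 / norm (h * k)) * (C * (norm h * norm k * norm (h - k)))"
      using dq that unfolding dq_def by (intro mult_left_mono) auto
    also have "\<dots> = C * norm (h - k)" using that by (simp add: norm_mult)
    finally show ?thesis .
  qed
  \<comment> \<open>Nonzero increments that stay within the radius where the hypothesis
    applies.\<close>
  define s where "s = (\<lambda>n. complex_of_real (\<rho> * inverse (real (Suc n))))"
  have s0: "s n \<noteq> 0" "norm (s n) \<le> \<rho>" for n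
    using \<rho> mult_left_le[of "inverse (real (Suc n))" \<rho>] inverse_le_1_iff[of "real (Suc n)"]
    by (simp_all add: s_def norm_mult del: of_real_mult of_nat_Suc)
  have "(\<lambda>n. \<rho> * inverse (real (Suc n))) \<longlonglongrightarrow> \<rho> * 0"
    by (intro tendsto_mult tendsto_const LIMSEQ_inverse_real_of_nat)
  then have "(\<lambda>n. complex_of_real (\<rho> * inverse (real (Suc n)))) \<longlonglongrightarrow> complex_of_real (\<rho> * 0)"
    by (rule tendsto_of_real)
  then have slim: "s \<longlonglongrightarrow> 0"
    by (simp add: s_def)
  have "Cauchy (\<lambda>n. Q (s n))"
  proof (rule CauchyI)
    fix e :: real assume "e > 0"
    then have "e / (C + 1) > 0" using C by simp
    moreover have "Cauchy s" using slim by (rule LIMSEQ_imp_Cauchy)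
    ultimately obtain N where N: "\<And>m n. m \<ge> N \<Longrightarrow> n \<ge> N \<Longrightarrow> norm (s m - s n) < e / (C + 1)"
      unfolding Cauchy_iff by blast
    have "norm (Q (s m) - Q (s n)) < e" if "m \<ge> N" "n \<ge> N" for m n
    proof -
      have "norm (Q (s m) - Q (s n)) \<le> C * norm (s m - s n)" by (rule QQ) (rule s0)+
      also have "\<dots> \<le> (C + 1) * norm (s m - s n)" by (intro mult_right_mono) auto
      also have "\<dots> < e" using N[OF that] C by (simp add: pos_less_divide_eq mult.commute)
      finally show ?thesis .
    qed
    then show "\<exists>M. \<forall>m\<ge>M. \<forall>n\<ge>M. norm (Q (s m) - Q (s n)) < e" by blast
  qed
  then obtain v where v: "(\<lambda>n. Q (s n)) \<longlonglongrightarrow> v"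
    using Cauchy_convergent convergent_def by blast
  have Qv: "norm (Q h - v) \<le> C * norm h" if h: "h \<noteq> 0" "norm h \<le> \<rho>" for h
  proof (rule LIMSEQ_le)
    show "(\<lambda>n. norm (Q h - Q (s n))) \<longlonglongrightarrow> norm (Q h - v)"
      by (intro tendsto_norm tendsto_diff tendsto_const v)
    have "(\<lambda>n. C * norm (h - s n)) \<longlonglongrightarrow> C * norm (h - 0)"
      by (intro tendsto_mult tendsto_norm tendsto_diff tendsto_const slim)
    then show "(\<lambda>n. C * norm (h - s n)) \<longlonglongrightarrow> C * norm h" by simp
    show "\<exists>N. \<forall>n\<ge>N. norm (Q h - Q (s n)) \<le> C * norm (h - s n)"
      using QQ[OF h(1) s0(1) h(2) s0(2)] by blast
  qed
  have "(f has_derivative (\<lambda>h. scC J h v)) (at w)"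
    unfolding has_derivative_iff_norm
  proof (intro conjI bounded_linear_scC_left)
    show "((\<lambda>y. norm (f y - f w - scC J (y - w) v) / norm (y - w)) \<longlongrightarrow> 0) (at w)"
    proof (rule Lim_transform_bound[where g = "\<lambda>y. C * norm (y - w)"])
      show "((\<lambda>y. C * norm (y - w)) \<longlongrightarrow> 0) (at w)"
        by (auto intro!: tendsto_eq_intros)
      have "\<forall>\<^sub>F y in at w. dist y w < \<rho> \<and> y \<noteq> w"
        using \<rho> by (auto simp: eventually_at)
      then show "\<forall>\<^sub>F y in at w. norm (norm (f y - f w - scC J (y - w) v) / norm (y - w)) \<le> norm (C * norm (y - w))"
      proof (rule eventually_mono)
        fix y assume y: "dist y w < \<rho> \<and> y \<noteq> w"
        define h where "h = y - w"
        have h: "h \<noteq> 0" "norm h \<le> \<rho>" using y by (auto simp: h_def dist_norm)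
        have "f y - f w - scC J h v = scC J h (Q h - v)"
          using h(1) by (simp add: Q_def scC_diff_right scC_scC h_def)
        then have "norm (f y - f w - scC J h v) / norm h = norm (Q h - v)"
          using h by (simp add: norm_scC)
        then show "norm (norm (f y - f w - scC J (y - w) v) / norm (y - w)) \<le> norm (C * norm (y - w))"
          using Qv[OF h] C by (simp add: h_def abs_mult)
      qed
    qed
  qed
  then show thesis by (rule that)
qed

end

text \<open>Cauchy's formula on the circle of radius \<open>2 * \<rho>\<close>: the four kernels
  combine to hk(h - k) / (z(z - h)(z - k)), whose denominator is at least
  \<open>2 * \<rho> * \<rho> * \<rho>\<close> there.\<close>

lemma holomorphic_difference_quotient:
  assumes F: "F holomorphic_on ball w r" and \<rho>: "0 < \<rho>" "2 * \<rho> < r"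
    and B: "\<And>z. z \<in> ball w r \<Longrightarrow> norm (F z) \<le> B"
    and hk: "norm h \<le> \<rho>" "norm k \<le> \<rho>"
  shows "norm (k * (F (w + h) - F w) - h * (F (w + k) - F w)) \<le> B / \<rho>\<^sup>2 * (norm h * norm k * norm (h - k))"
proof -
  have hol: "F holomorphic_on cball w (2 * \<rho>)"
    using \<rho> by (intro holomorphic_on_subset[OF F]) auto
  have B0: "B \<ge> 0" using order_trans[OF norm_ge_zero B[of w]] \<rho> by simp
  have C: "((\<lambda>u. F u / (u - v)) has_contour_integral (2 * of_real pi * \<i> * F v)) (circlepath w (2 * \<rho>))"
    if "norm (v - w) \<le> \<rho>" for v
    by (rule Cauchy_integral_circlepath_simple[OF hol]) (use that \<rho> in auto)
  have "((\<lambda>u. k * (F u / (u - (w + h)) - F u / (u - w)) - h * (F u / (u - (w + k)) - F u / (u - w)))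
     has_contour_integral k * (2 * of_real pi * \<i> * F (w + h) - 2 * of_real pi * \<i> * F w)
       - h * (2 * of_real pi * \<i> * F (w + k) - 2 * of_real pi * \<i> * F w)) (circlepath w (2 * \<rho>))"
    using hk \<rho> by (intro has_contour_integral_diff has_contour_integral_lmul C) auto
  moreover have "k * (2 * of_real pi * \<i> * F (w + h) - 2 * of_real pi * \<i> * F w)
       - h * (2 * of_real pi * \<i> * F (w + k) - 2 * of_real pi * \<i> * F w)
     = 2 * of_real pi * \<i> * (k * (F (w + h) - F w) - h * (F (w + k) - F w))"
    by (simp add: algebra_simps)
  moreover define K where "K = B * (norm h * norm k * norm (h - k)) / (2 * \<rho> * \<rho> * \<rho>)"
  ultimately have "norm (2 * of_real pi * \<i> * (k * (F (w + h) - F w) - h * (F (w + k) - F w))) \<le> K * (2 * pi * (2 * \<rho>))"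
  proof (intro has_contour_integral_bound_circlepath[where f = "\<lambda>u. k * (F u / (u - (w + h)) - F u / (u - w)) - h * (F u / (u - (w + k)) - F u / (u - w))" and z = w])
    show "0 \<le> K" using B0 \<rho> by (simp add: K_def)
    show "0 < 2 * \<rho>" using \<rho> by simp
    fix u assume u: "norm (u - w) = 2 * \<rho>"
    define z where "z = u - w"
    have z: "norm z = 2 * \<rho>" using u by (simp add: z_def)
    have zh: "norm (z - h) \<ge> \<rho>" using norm_triangle_ineq2[of z h] hk z by simp
    have zk: "norm (z - k) \<ge> \<rho>" using norm_triangle_ineq2[of z k] hk z by simp
    have nz: "z \<noteq> 0" "z - h \<noteq> 0" "z - k \<noteq> 0" using z zh zk \<rho> by auto
    have "k * (F u / (u - (w + h)) - F u / (u - w)) - h * (F u / (u - (w + k)) - F u / (u - w))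
       = F u * (k * (1 / (z - h) - 1 / z) - h * (1 / (z - k) - 1 / z))"
      by (simp add: z_def algebra_simps)
    also have "k * (1 / (z - h) - 1 / z) - h * (1 / (z - k) - 1 / z) = h * k * (h - k) / (z * (z - h) * (z - k))"
      using nz by (simp add: divide_simps) (simp add: algebra_simps)
    also have "norm (F u * (h * k * (h - k) / (z * (z - h) * (z - k))))
       = norm (F u) * (norm h * norm k * norm (h - k)) / (norm z * norm (z - h) * norm (z - k))"
      by (simp add: norm_mult norm_divide)
    also have "\<dots> \<le> B * (norm h * norm k * norm (h - k)) / (2 * \<rho> * \<rho> * \<rho>)"
    proof (rule frac_le)
      show "norm (F u) * (norm h * norm k * norm (h - k)) \<le> B * (norm h * norm k * norm (h - k))"
        using B[of u] u \<rho> by (intro mult_right_mono) (auto simp: dist_norm norm_minus_commute)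
      show "2 * \<rho> * \<rho> * \<rho> \<le> norm z * norm (z - h) * norm (z - k)"
        using \<rho> zh zk unfolding z by (intro mult_mono) auto
    qed (use B0 \<rho> in auto)
    finally show "norm (k * (F u / (u - (w + h)) - F u / (u - w)) - h * (F u / (u - (w + k)) - F u / (u - w))) \<le> K"
      by (simp add: K_def)
  qed simp
  moreover have "norm (2 * of_real pi * \<i> * (k * (F (w + h) - F w) - h * (F (w + k) - F w)))
      = (2 * pi) * norm (k * (F (w + h) - F w) - h * (F (w + k) - F w))"
    unfolding norm_mult by simp
  ultimately have "(2 * pi) * norm (k * (F (w + h) - F w) - h * (F (w + k) - F w)) \<le> (2 * pi) * (K * (2 * \<rho>))"
    by (simp only: mult_ac)
  then have "norm (k * (F (w + h) - F w) - h * (F (w + k) - F w)) \<le> K * (2 * \<rho>)"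
    by (rule mult_left_le_imp_le) simp
  also have "\<dots> = B / \<rho>\<^sup>2 * (norm h * norm k * norm (h - k))"
    using \<rho> by (simp add: K_def power2_eq_square)
  finally show ?thesis .
qed

lemma continuous_on_locally_bounded:
  fixes f :: "'a::metric_space \<Rightarrow> 'b::real_normed_vector"
  assumes "continuous_on S f" "open S" "w \<in> S"
  obtains r B where "r > 0" "ball w r \<subseteq> S" "\<And>z. z \<in> ball w r \<Longrightarrow> norm (f z) \<le> B"
proof -
  obtain d where d: "d > 0" "\<And>z. z \<in> S \<Longrightarrow> dist z w < d \<Longrightarrow> dist (f z) (f w) < 1"
    using assms unfolding continuous_on_iff by (metis zero_less_one)
  obtain r where r: "r > 0" "ball w r \<subseteq> S" using assms open_contains_ball by blast
  show thesis
  proof (rule that[of "min r d" "norm (f w) + 1"])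
    fix z assume "z \<in> ball w (min r d)"
    then have "z \<in> S" "dist z w < d" using r by (auto simp: dist_commute)
    then have "dist (f z) (f w) < 1" by (rule d(2))
    then show "norm (f z) \<le> norm (f w) + 1"
      using norm_triangle_sub[of "f z" "f w"] by (simp add: dist_norm)
  qed (use d r in auto)
qed

section \<open>The complex inner product and weak holomorphy\<close>

locale complex_hilbert =
  fixes J :: "'e::{real_inner, banach} \<Rightarrow>\<^sub>L 'e"
  assumes complex_structure: "complex_structure J"
begin

lemma J_J [simp]: "J (J x) = - x"
proof -
  have "(J o\<^sub>L J) x = (- id_blinfun) x"
    using complex_structure by (simp add: complex_structure_def)
  then show ?thesis by (simp add: blinfun.bilinear_simps)
qed

lemma norm_J [simp]: "norm (J x) = norm x"
  using complex_structure by (simp add: complex_structure_def)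

lemma inner_J_J [simp]: "inner (J x) (J y) = inner x y"
proof -
  have *: "inner (J z) (J z) = inner z z" for z
    using norm_J[of z] by (simp only: norm_eq)
  show ?thesis
    using *[of "x + y"] by (simp add: blinfun.bilinear_simps inner_simps inner_commute *)
qed

lemma inner_J_left: "inner (J x) y = - inner x (J y)"
  using inner_J_J[of x "J y"] by simp

text \<open>The complex inner product recovered from the real one, complex linear in its second
  argument.\<close>

definition cin :: "'e \<Rightarrow> 'e \<Rightarrow> complex" where
  "cin y x = Complex (inner x y) (inner x (J y))"

lemma cin_scC: "cin y (scC J c x) = c * cin y x"
  by (simp add: cin_def scC_def complex_eq_iff inner_simps inner_J_left algebra_simps)

lemma Re_cin: "Re (cin y x) = inner x y"
  by (simp add: cin_def)

lemma cin_diff: "cin y (x - x') = cin y x - cin y x'"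
  by (simp add: cin_def complex_eq_iff inner_simps)

lemma inner_J_self [simp]: "inner x (J x) = 0"
  using inner_J_left[of x x] by (simp add: inner_commute)

lemma cin_self: "cin x x = of_real ((norm x)\<^sup>2)"
  by (simp add: cin_def complex_eq_iff power2_norm_eq_inner)

sublocale complex_banach J
proof
  show "scC J c (scC J d x) = scC J (c * d) x" for c d x
    by (simp add: scC_def blinfun.bilinear_simps algebra_simps)
  show "norm (scC J c x) = norm c * norm x" for c x
  proof (rule power2_eq_imp_eq)
    have "(norm (scC J c x))\<^sup>2 = (Re c)\<^sup>2 * (norm x)\<^sup>2 + (Im c)\<^sup>2 * (norm x)\<^sup>2"
      by (simp add: scC_def power2_norm_eq_inner inner_simps inner_commute[of "J x" x])
        (simp add: power2_eq_square)
    also have "\<dots> = (norm c * norm x)\<^sup>2"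
      by (simp add: power_mult_distrib cmod_power2 algebra_simps)
    finally show "(norm (scC J c x))\<^sup>2 = (norm c * norm x)\<^sup>2" .
  qed auto
qed

text \<open>A unimodular multiple of \<open>x\<close> makes the product real and nonnegative, where
  the real Cauchy-Schwarz inequality applies.\<close>

lemma norm_cin_le: "norm (cin y x) \<le> norm x * norm y"
proof (cases "cin y x = 0")
  case False
  define c where "c = cnj (cin y x) / of_real (norm (cin y x))"
  have "norm c = 1" using False by (simp add: c_def norm_divide)
  have "cin y (scC J c x) = of_real (norm (cin y x))"
    using False complex_norm_square[of "cin y x"]
    by (simp add: cin_scC c_def divide_eq_eq mult.commute power2_eq_square)
  then have "norm (cin y x) = inner (scC J c x) y"
    by (metis Re_cin Re_complex_of_real)
  also have "\<dots> \<le> norm (scC J c x) * norm y" by (rule norm_cauchy_schwarz)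
  finally show ?thesis using \<open>norm c = 1\<close> by (simp add: norm_scC)
qed auto

lemma norm_le_cinI:
  assumes "0 \<le> K" "\<And>y. norm (cin y x) \<le> K * norm y"
  shows "norm x \<le> K"
proof (cases "x = 0")
  case False
  have "norm x * norm x \<le> K * norm x"
    using assms(2)[of x] by (simp add: cin_self power2_eq_square norm_mult)
  then show ?thesis using False by simp
qed (use assms in simp)

lemma bounded_linear_cin: "bounded_linear (cin y)"
  by (rule bounded_linear_intro[where K = "norm y"])
    (auto simp: cin_def complex_eq_iff inner_simps intro: norm_cin_le[unfolded cin_def])

lemma holo_E_continuous_on: "holo_E J f S \<Longrightarrow> continuous_on S f"
  unfolding holo_E_def continuous_on_eq_continuous_within
  by (meson continuous_at_imp_continuous_at_within has_derivative_continuous)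

lemma holo_E_cin:
  assumes "holo_E J f S"
  shows "(\<lambda>z. cin y (f z)) holomorphic_on S"
  unfolding holomorphic_on_def
proof
  fix z assume "z \<in> S"
  then obtain v where "(f has_derivative (\<lambda>h. scC J h v)) (at z)"
    using assms by (auto simp: holo_E_def)
  then have "((\<lambda>z. cin y (f z)) has_derivative (\<lambda>h. cin y (scC J h v))) (at z)"
    by (rule bounded_linear.has_derivative[OF bounded_linear_cin])
  then have "((\<lambda>z. cin y (f z)) has_field_derivative cin y v) (at z)"
    by (simp add: has_field_derivative_def cin_scC mult.commute[of _ "cin y v"])
  then show "(\<lambda>z. cin y (f z)) field_differentiable at z within S"
    using field_differentiable_at_within field_differentiable_def by blast
qed

text \<open>The scalar estimate for \<open>cin y (f z)\<close> has the bound
  \<open>B * norm y\<close>. This homogeneity in \<open>y\<close> lets \<open>norm_le_cinI\<close>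
  return to vectors with the same constant.\<close>

lemma dq_weakI:
  assumes "\<And>y. (\<lambda>z. cin y (f z)) holomorphic_on ball w r" "0 < \<rho>" "2 * \<rho> < r"
    and B: "\<And>z. z \<in> ball w r \<Longrightarrow> norm (f z) \<le> B"
  shows "dq w \<rho> (B / \<rho>\<^sup>2) f"
  unfolding dq_def
proof (intro conjI allI impI)
  show B0: "0 \<le> B / \<rho>\<^sup>2"
    using order_trans[OF norm_ge_zero B[of w]] assms(2,3) by simp
  fix h k :: complex assume hk: "norm h \<le> \<rho>" "norm k \<le> \<rho>"
  show "norm (scC J k (f (w + h) - f w) - scC J h (f (w + k) - f w)) \<le> B / \<rho>\<^sup>2 * (norm h * norm k * norm (h - k))"
  proof (rule norm_le_cinI)
    show "0 \<le> B / \<rho>\<^sup>2 * (norm h * norm k * norm (h - k))" by (intro mult_nonneg_nonneg B0) auto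
    fix y
    have "norm (cin y (f z)) \<le> B * norm y" if "z \<in> ball w r" for z
      using order_trans[OF norm_cin_le mult_right_mono[OF B[OF that]]] by simp
    from holomorphic_difference_quotient[OF assms(1-3) this hk]
    show "norm (cin y (scC J k (f (w + h) - f w) - scC J h (f (w + k) - f w)))
       \<le> B / \<rho>\<^sup>2 * (norm h * norm k * norm (h - k)) * norm y"
      by (simp add: cin_diff cin_scC mult_ac)
  qed
qed

text \<open>Weak holomorphy implies strong holomorphy; continuity enters as local boundedness, which
  makes \<open>dq_weakI\<close> applicable.\<close>

lemma holo_E_weakI:
  assumes "open S" "continuous_on S f" "\<And>y. (\<lambda>z. cin y (f z)) holomorphic_on S"
  shows "holo_E J f S"
  unfolding holo_E_def
proof
  fix w assume "w \<in> S"
  obtain r B where r: "r > 0" "ball w r \<subseteq> S" "\<And>z. z \<in> ball w r \<Longrightarrow> norm (f z) \<le> B"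
    using continuous_on_locally_bounded[OF assms(2,1) \<open>w \<in> S\<close>] by metis
  have "dq w (r / 4) (B / (r / 4)\<^sup>2) f"
  proof (rule dq_weakI)
    show "(\<lambda>z. cin y (f z)) holomorphic_on ball w r" for y
      using assms(3) r(2) holomorphic_on_subset by blast
  qed (use r in auto)
  then show "\<exists>v. (f has_derivative (\<lambda>h. scC J h v)) (at w)"
    by (rule dq_has_derivative) (use r in auto)
qed

lemma holo_E_scC:
  assumes "open S" "m holomorphic_on S" "holo_E J f S"
  shows "holo_E J (\<lambda>z. scC J (m z) (f z)) S"
proof (rule holo_E_weakI[OF assms(1)])
  show "continuous_on S (\<lambda>z. scC J (m z) (f z))"
    by (intro bounded_bilinear.continuous_on[OF bounded_bilinear_scC]
        holomorphic_on_imp_continuous_on holo_E_continuous_on assms)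
  show "(\<lambda>z. cin y (scC J (m z) (f z))) holomorphic_on S" for y
    unfolding cin_scC by (intro holomorphic_intros holo_E_cin assms)
qed

lemma holo_E_add:
  assumes "holo_E J f S" "holo_E J g S"
  shows "holo_E J (\<lambda>z. f z + g z) S"
  unfolding holo_E_def
proof
  fix z assume "z \<in> S"
  then obtain u v where "(f has_derivative (\<lambda>h. scC J h u)) (at z)" "(g has_derivative (\<lambda>h. scC J h v)) (at z)"
    using assms unfolding holo_E_def by blast
  then have "((\<lambda>z. f z + g z) has_derivative (\<lambda>h. scC J h (u + v))) (at z)"
    unfolding scC_add_right by (rule has_derivative_add)
  then show "\<exists>v. ((\<lambda>z. f z + g z) has_derivative (\<lambda>h. scC J h v)) (at z)" ..
qed

lemma holo_E_const: "holo_E J (\<lambda>z. x) S"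
  unfolding holo_E_def by (intro ballI exI[of _ 0]) simp

lemma holo_E_cong:
  assumes "open S" "holo_E J f S" "\<And>z. z \<in> S \<Longrightarrow> f z = g z"
  shows "holo_E J g S"
  using assms unfolding holo_E_def by (meson has_derivative_transform_within_open)

text \<open>Removable singularities, argued weakly: the quotient extends continuously to
  \<open>w\<close> by the derivative, and a continuous scalar function holomorphic off one point is
  holomorphic.\<close>

lemma holo_E_quotient:
  assumes "open S" "w \<in> S" "holo_E J f S"
  obtains g where "holo_E J g S" "\<And>z. z \<in> S \<Longrightarrow> f z = f w + scC J (z - w) (g z)"
proof -
  obtain v where v: "(f has_derivative (\<lambda>h. scC J h v)) (at w)"
    using assms by (auto simp: holo_E_def)
  define g where "g = (\<lambda>z. if z = w then v else scC J (1 / (z - w)) (f z - f w))"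
  have eq: "f z = f w + scC J (z - w) (g z)" for z
    by (simp add: g_def scC_scC)
  have off: "holo_E J (\<lambda>z. scC J (1 / (z - w)) (f z - f w)) (S - {w})"
  proof (rule holo_E_scC)
    show "open (S - {w})" using assms by auto
    show "(\<lambda>z. 1 / (z - w)) holomorphic_on S - {w}" by (auto intro!: holomorphic_intros)
    have "holo_E J (\<lambda>z. f z + (- f w)) (S - {w})"
      using assms by (intro holo_E_add holo_E_const) (auto simp: holo_E_def)
    then show "holo_E J (\<lambda>z. f z - f w) (S - {w})" by simp
  qed
  have goff: "holo_E J g (S - {w})"
    by (rule holo_E_cong[OF _ off]) (use assms in \<open>auto simp: g_def\<close>)
  have "continuous_on S g"
    unfolding continuous_on_eq_continuous_within
  proof
    fix z assume z: "z \<in> S"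
    show "continuous (at z within S) g"
    proof (cases "z = w")
      case False
      then have "continuous (at z) g"
        using goff z unfolding holo_E_def by (blast intro: has_derivative_continuous)
      then show ?thesis by (rule continuous_at_imp_continuous_at_within)
    next
      case True
      have "((\<lambda>y. norm (f y - f w - scC J (y - w) v) / norm (y - w)) \<longlongrightarrow> 0) (at w)"
        using v unfolding has_derivative_iff_norm by blast
      then have "((\<lambda>y. norm (g y - v)) \<longlongrightarrow> 0) (at w)"
      proof (rule Lim_transform_eventually)
        have "norm (f y - f w - scC J (y - w) v) / norm (y - w) = norm (g y - v)" if "y \<noteq> w" for y
        proof -
          have "f y - f w - scC J (y - w) v = scC J (y - w) (g y - v)"
            using that by (simp add: g_def scC_diff_right scC_scC)
          then show ?thesis using that by (simp add: norm_scC)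
        qed
        then show "\<forall>\<^sub>F y in at w. norm (f y - f w - scC J (y - w) v) / norm (y - w) = norm (g y - v)"
          by (auto simp: eventually_at intro: exI[of _ 1])
      qed
      then have "((\<lambda>y. g y - v) \<longlongrightarrow> 0) (at w)" by (rule tendsto_norm_zero_cancel)
      then have "(g \<longlongrightarrow> g w) (at w)"
        using LIM_zero_cancel by (simp add: g_def)
      then show ?thesis unfolding True continuous_within
        by (rule tendsto_within_subset) auto
    qed
  qed
  then have "holo_E J g S"
  proof (rule holo_E_weakI[OF assms(1)])
    fix y
    show "(\<lambda>z. cin y (g z)) holomorphic_on S"
    proof (rule no_isolated_singularity)
      show "continuous_on S (\<lambda>z. cin y (g z))"
        using \<open>continuous_on S g\<close> by (rule bounded_linear.continuous_on[OF bounded_linear_cin])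
      show "(\<lambda>z. cin y (g z)) holomorphic_on S - {w}"
        using goff by (rule holo_E_cin)
    qed (use assms in auto)
  qed
  then show thesis using eq by (rule that)
qed

end

section \<open>The vector-valued Hardy space\<close>

lemma circ_mean_cis: "circ_mean f r = integral {0..2*pi} (\<lambda>\<theta>. (norm (f (of_real r * cis \<theta>)))\<^sup>2) / (2*pi)"
  by (simp add: circ_mean_def cis_conv_exp)

lemma norm_circle [simp]: "norm (complex_of_real r * cis \<theta>) = \<bar>r\<bar>"
  by (simp add: norm_mult)

lemma continuous_on_circle:
  assumes "continuous_on disc f" "0 \<le> r" "r < 1"
  shows "continuous_on X (\<lambda>\<theta>. f (complex_of_real r * cis \<theta>))"
proof (rule continuous_on_compose2[OF assms(1)])
  show "continuous_on X (\<lambda>\<theta>. complex_of_real r * cis \<theta>)"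
    by (intro continuous_intros)
qed (use assms in auto)

lemma Cauchy_circle:
  assumes F: "F holomorphic_on disc" and z: "norm z < r" "r < 1"
  shows "((\<lambda>\<theta>. F (of_real r * cis \<theta>) * (of_real r * cis \<theta>) / (of_real r * cis \<theta> - z)) has_integral
     2 * of_real pi * F z) {0..2*pi}"
proof -
  have r: "r > 0" using z norm_ge_zero[of z] by linarith
  have "F holomorphic_on cball 0 r"
    using F z by (rule_tac holomorphic_on_subset) auto
  then have "((\<lambda>u. F u / (u - z)) has_contour_integral 2 * of_real pi * \<i> * F z) (circlepath 0 r)"
    using z by (intro Cauchy_integral_circlepath_simple) auto
  then have "((\<lambda>\<theta>. F (0 + of_real r * cis \<theta>) / ((0 + of_real r * cis \<theta>) - z) * of_real r * \<i> * cis \<theta>)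
      has_integral 2 * of_real pi * \<i> * F z) {0..2*pi}"
    unfolding circlepath_def by (subst (asm) has_contour_integral_part_circlepath_iff) auto
  from has_integral_mult_right[OF this, of "- \<i>"]
  show ?thesis by (simp add: algebra_simps)
qed

lemma norm_le_circle_mean:
  assumes F: "F holomorphic_on disc" and z: "norm z < r" "r < 1"
  shows "norm (F z) \<le> r / (r - norm z) * (integral {0..2*pi} (\<lambda>\<theta>. norm (F (of_real r * cis \<theta>))) / (2*pi))"
proof -
  have r: "r > 0" using z norm_ge_zero[of z] by linarith
  have cF: "continuous_on disc F" using F by (rule holomorphic_on_imp_continuous_on)
  note I = Cauchy_circle[OF F z]
  have "norm (2 * of_real pi * F z) \<le> integral {0..2*pi} (\<lambda>\<theta>. r / (r - norm z) * norm (F (of_real r * cis \<theta>)))"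
    unfolding integral_unique[OF I, symmetric]
  proof (rule integral_norm_bound_integral)
    show "(\<lambda>\<theta>. r / (r - norm z) * norm (F (of_real r * cis \<theta>))) integrable_on {0..2*pi}"
      using r z by (intro integrable_continuous_real continuous_intros continuous_on_circle[OF cF]) auto
    fix \<theta>
    define u where "u = complex_of_real r * cis \<theta>"
    have "r - norm z \<le> norm (u - z)"
      using norm_triangle_ineq2[of u z] r by (simp add: u_def)
    then have "norm (F u) * r / norm (u - z) \<le> norm (F u) * r / (r - norm z)"
      using z r by (intro divide_left_mono mult_pos_pos) auto
    then show "norm (F u * u / (u - z)) \<le> r / (r - norm z) * norm (F u)"
      using r by (simp add: norm_mult norm_divide u_def mult.commute)
  qed (use I in blast)
  then have "norm (F z) * (2*pi) \<le> r / (r - norm z) * integral {0..2*pi} (\<lambda>\<theta>. norm (F (of_real r * cis \<theta>)))"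
    by (simp add: norm_mult mult.commute[of _ "norm (F z)"])
  then have "norm (F z) \<le> r / (r - norm z) * integral {0..2*pi} (\<lambda>\<theta>. norm (F (of_real r * cis \<theta>))) / (2*pi)"
    by (subst pos_le_divide_eq) auto
  then show ?thesis by simp
qed

lemma mean_value_circle:
  assumes F: "F holomorphic_on disc" and "0 < r" "r < 1"
  shows "((\<lambda>\<theta>. F (of_real r * cis \<theta>)) has_integral 2 * of_real pi * F 0) {0..2*pi}"
  using Cauchy_circle[OF F, of 0 r] assms by simp

context complex_hilbert
begin

text \<open>The value 0 off the disc follows the convention of \<open>H2\<close>, so identities
  between products hold as equations of total functions.\<close>

definition mul :: "(complex \<Rightarrow> complex) \<Rightarrow> (complex \<Rightarrow> 'e) \<Rightarrow> complex \<Rightarrow> 'e" where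
  "mul m f = (\<lambda>z. if z \<in> disc then scC J (m z) (f z) else 0)"

definition konst :: "'e \<Rightarrow> complex \<Rightarrow> 'e" where
  "konst x = (\<lambda>z. if z \<in> disc then x else 0)"

lemma konst_scC: "konst (scC J c x) = (\<lambda>z. scC J c (konst x z))"
  by (auto simp: konst_def)

lemma konst_add: "konst (x + y) = (\<lambda>z. konst x z + konst y z)"
  by (auto simp: konst_def)

lemma circ_integrable:
  assumes "holo_E J f disc" "0 \<le> r" "r < 1"
  shows "(\<lambda>\<theta>. (norm (f (of_real r * cis \<theta>)))\<^sup>2) integrable_on {0..2*pi}"
  by (intro integrable_continuous_real continuous_intros continuous_on_circle
      holo_E_continuous_on assms)

lemma circ_mean_nonneg: "0 \<le> circ_mean f r"
  unfolding circ_mean_cis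
  by (cases "(\<lambda>\<theta>. (norm (f (of_real r * cis \<theta>)))\<^sup>2) integrable_on {0..2*pi}")
    (auto intro!: divide_nonneg_pos integral_nonneg simp: not_integrable_integral)

lemma circ_mean_le:
  assumes f: "holo_E J f disc" and g: "holo_E J g disc" and h: "holo_E J h disc" and r: "0 \<le> r" "r < 1"
    and le: "\<And>z. norm z = r \<Longrightarrow> (norm (f z))\<^sup>2 \<le> a * (norm (g z))\<^sup>2 + b * (norm (h z))\<^sup>2"
  shows "circ_mean f r \<le> a * circ_mean g r + b * circ_mean h r"
proof -
  have "integral {0..2*pi} (\<lambda>\<theta>. (norm (f (of_real r * cis \<theta>)))\<^sup>2)
     \<le> integral {0..2*pi} (\<lambda>\<theta>. a * (norm (g (of_real r * cis \<theta>)))\<^sup>2 + b * (norm (h (of_real r * cis \<theta>)))\<^sup>2)"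
    by (intro integral_le integrable_add integrable_on_mult_right circ_integrable f g h r le) (use r in auto)
  also have "\<dots> = a * integral {0..2*pi} (\<lambda>\<theta>. (norm (g (of_real r * cis \<theta>)))\<^sup>2)
      + b * integral {0..2*pi} (\<lambda>\<theta>. (norm (h (of_real r * cis \<theta>)))\<^sup>2)"
    by (subst integral_add) (auto intro!: integrable_on_mult_right circ_integrable f g h r)
  finally show ?thesis
    unfolding circ_mean_cis by (simp add: divide_right_mono flip: add_divide_distrib)
qed

lemma circ_mean_bound:
  assumes f: "holo_E J f disc" and r: "0 \<le> r" "r < 1" and le: "\<And>z. norm z = r \<Longrightarrow> (norm (f z))\<^sup>2 \<le> K"
  shows "circ_mean f r \<le> K"
proof -
  have "integral {0..2*pi} (\<lambda>\<theta>. (norm (f (of_real r * cis \<theta>)))\<^sup>2) \<le> integral {0..2*pi} (\<lambda>\<theta>. K)"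
    by (intro integral_le circ_integrable f r le) (use r in auto)
  then show ?thesis unfolding circ_mean_cis by (simp add: divide_simps mult.commute)
qed

text \<open>Apply the scalar mean estimate to the square of \<open>cin (f z) (f u)\<close>,
  holomorphic in u. At u = z it is the fourth power of \<open>norm (f z)\<close>, on the circle at
  most the product of the two squared norms. Squaring first turns an L1 estimate into an L2
  estimate.\<close>

lemma point_estimate:
  assumes f: "holo_E J f disc" and z: "norm z < r" "r < 1"
  shows "(norm (f z))\<^sup>2 \<le> r / (r - norm z) * circ_mean f r"
proof (cases "f z = 0")
  case True
  have "r > 0" using z norm_ge_zero[of z] by linarith
  then show ?thesis using True z by (auto intro!: mult_nonneg_nonneg divide_nonneg_nonneg circ_mean_nonneg)
next
  case False
  have r: "r > 0" using z norm_ge_zero[of z] by linarith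
  define x where "x = f z"
  define F where "F = (\<lambda>u. (cin x (f u))\<^sup>2)"
  have F: "F holomorphic_on disc"
    unfolding F_def by (intro holomorphic_intros holo_E_cin f)
  have "integral {0..2*pi} (\<lambda>\<theta>. norm (F (of_real r * cis \<theta>)))
      \<le> integral {0..2*pi} (\<lambda>\<theta>. (norm x)\<^sup>2 * (norm (f (of_real r * cis \<theta>)))\<^sup>2)"
  proof (rule integral_le)
    show "(\<lambda>\<theta>. norm (F (of_real r * cis \<theta>))) integrable_on {0..2*pi}"
      using r z by (intro integrable_continuous_real continuous_intros continuous_on_circle
          holomorphic_on_imp_continuous_on[OF F]) auto
    show "(\<lambda>\<theta>. (norm x)\<^sup>2 * (norm (f (of_real r * cis \<theta>)))\<^sup>2) integrable_on {0..2*pi}"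
      using r z by (intro integrable_on_mult_right circ_integrable f) auto
    show "norm (F (of_real r * cis \<theta>)) \<le> (norm x)\<^sup>2 * (norm (f (of_real r * cis \<theta>)))\<^sup>2" for \<theta>
      unfolding F_def norm_power power_mult_distrib[symmetric]
      by (intro power_mono) (use norm_cin_le in \<open>auto simp: mult.commute\<close>)
  qed
  then have "integral {0..2*pi} (\<lambda>\<theta>. norm (F (of_real r * cis \<theta>))) / (2*pi) \<le> (norm x)\<^sup>2 * circ_mean f r"
    by (simp add: circ_mean_cis divide_right_mono)
  then have "norm (F z) \<le> r / (r - norm z) * ((norm x)\<^sup>2 * circ_mean f r)"
    using norm_le_circle_mean[OF F z] r z
    by (meson divide_nonneg_nonneg mult_left_mono order_trans less_imp_le diff_ge_0_iff_ge)
  moreover have "norm (F z) = (norm x)\<^sup>2 * (norm x)\<^sup>2"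
    by (simp add: F_def x_def cin_self norm_power power2_eq_square norm_mult)
  ultimately have "(norm x)\<^sup>2 * (norm x)\<^sup>2 \<le> (norm x)\<^sup>2 * (r / (r - norm z) * circ_mean f r)"
    by (simp only: mult_ac)
  moreover have "0 < (norm x)\<^sup>2" using False by (simp add: x_def)
  ultimately show ?thesis
    unfolding x_def by (rule mult_left_le_imp_le)
qed

text \<open>The cross term is the real part of a holomorphic function that vanishes at 0, so its
  mean is 0. Iteration gives Parseval's identity, and taking \<open>g\<close> to be a multiple of
  \<open>f\<close> gives the norm of the Szego kernel.\<close>

lemma circ_mean_step:
  assumes f: "holo_E J f disc" and g: "holo_E J g disc"
    and eq: "\<And>z. z \<in> disc \<Longrightarrow> f z = x + scC J z (g z)" and r: "0 < r" "r < 1"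
  shows "circ_mean f r = (norm x)\<^sup>2 + r\<^sup>2 * circ_mean g r"
proof -
  define F where "F = (\<lambda>z. z * cin x (g z))"
  have F: "F holomorphic_on disc"
    unfolding F_def by (intro holomorphic_intros holo_E_cin g)
  have "((\<lambda>\<theta>. F (of_real r * cis \<theta>)) has_integral 0) {0..2*pi}"
    using mean_value_circle[OF F r] by (simp add: F_def)
  then have IF: "((\<lambda>\<theta>. Re (F (of_real r * cis \<theta>))) has_integral 0) {0..2*pi}"
    by (auto dest: has_integral_linear[OF _ bounded_linear_Re] simp: o_def)
  have Ig: "((\<lambda>\<theta>. (norm (g (of_real r * cis \<theta>)))\<^sup>2) has_integral 2 * pi * circ_mean g r) {0..2*pi}"
    using circ_integrable[OF g] r by (simp add: circ_mean_cis integrable_integral)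
  have "((\<lambda>\<theta>. (norm x)\<^sup>2) has_integral (norm x)\<^sup>2 * (2 * pi)) {0..2*pi}"
    using has_integral_const_real[of "(norm x)\<^sup>2" 0 "2*pi"] by (simp add: mult.commute)
  from has_integral_add[OF has_integral_add[OF this has_integral_mult_right[OF IF, of 2]] has_integral_mult_right[OF Ig, of "r\<^sup>2"]]
  have "((\<lambda>\<theta>. (norm x)\<^sup>2 + 2 * Re (F (of_real r * cis \<theta>)) + r\<^sup>2 * (norm (g (of_real r * cis \<theta>)))\<^sup>2)
     has_integral (norm x)\<^sup>2 * (2 * pi) + 2 * 0 + r\<^sup>2 * (2 * pi * circ_mean g r)) {0..2*pi}" .
  moreover have "(norm (f z))\<^sup>2 = (norm x)\<^sup>2 + 2 * Re (F z) + r\<^sup>2 * (norm (g z))\<^sup>2" if "norm z = r" for z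
  proof -
    have "Re (F z) = inner (scC J z (g z)) x"
      using Re_cin[of x "scC J z (g z)"] by (simp add: F_def cin_scC)
    moreover have "(norm (scC J z (g z)))\<^sup>2 = r\<^sup>2 * (norm (g z))\<^sup>2"
      by (simp add: norm_scC that power_mult_distrib)
    moreover have "f z = x + scC J z (g z)" using eq that r by simp
    ultimately show ?thesis
      by (simp add: power2_norm_eq_inner inner_simps inner_commute)
  qed
  ultimately have "((\<lambda>\<theta>. (norm (f (of_real r * cis \<theta>)))\<^sup>2)
     has_integral (norm x)\<^sup>2 * (2 * pi) + 2 * 0 + r\<^sup>2 * (2 * pi * circ_mean g r)) {0..2*pi}"
    using r by simp
  then show ?thesis
    unfolding circ_mean_cis[of f] by (simp add: integral_unique field_simps)
qed

lemma H2_holo: "f \<in> H2 J \<Longrightarrow> holo_E J f disc"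
  and H2_outside: "f \<in> H2 J \<Longrightarrow> z \<notin> disc \<Longrightarrow> f z = 0"
  by (auto simp: H2_def)

text \<open>Means over circles near the boundary control \<open>f\<close> inside, by
  \<open>point_estimate\<close>. Bounds for \<open>r > r0\<close> thus suffice, which is what
  division by z - w can offer.\<close>

lemma H2I:
  assumes f: "holo_E J f disc" and out: "\<And>z. z \<notin> disc \<Longrightarrow> f z = 0"
    and r0: "0 \<le> r0" "r0 < 1" and B: "\<And>r. r0 < r \<Longrightarrow> r < 1 \<Longrightarrow> circ_mean f r \<le> B"
  shows "f \<in> H2 J"
proof -
  define s where "s = (1 + r0) / 2"
  have s: "r0 < s" "s < 1" "0 < s" using r0 by (auto simp: s_def)
  have B0: "0 \<le> B" using B[OF s(1,2)] circ_mean_nonneg[of f s] by linarith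
  have small: "circ_mean f r \<le> s / (s - r0) * B" if "0 < r" "r \<le> r0" for r
  proof (rule circ_mean_bound[OF f])
    fix z :: complex assume z: "norm z = r"
    have "(norm (f z))\<^sup>2 \<le> s / (s - r) * circ_mean f s"
      using point_estimate[OF f, of z s] z that s by simp
    also have "\<dots> \<le> s / (s - r0) * B"
      using that s B[OF s(1,2)] by (intro mult_mono divide_left_mono mult_pos_pos circ_mean_nonneg) auto
    finally show "(norm (f z))\<^sup>2 \<le> s / (s - r0) * B" .
  qed (use that r0 in auto)
  have "circ_mean f r \<le> max B (s / (s - r0) * B)" if "r \<in> {0<..<1}" for r
    using small[of r] B[of r] that by (cases "r \<le> r0") auto
  then show ?thesis
    unfolding H2_def using f out by blast
qed

text \<open>The square of \<open>h2norm\<close>. It keeps the estimates free of roots, at the price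
  of the factors 2 in \<open>H2_add\<close>.\<close>

definition N :: "(complex \<Rightarrow> 'e) \<Rightarrow> real" where
  "N f = (SUP r\<in>{0<..<1::real}. circ_mean f r)"

lemma N_ge:
  assumes "f \<in> H2 J" "0 < r" "r < 1"
  shows "circ_mean f r \<le> N f"
proof -
  have "bdd_above (circ_mean f ` {0<..<1})"
    using assms by (auto simp: H2_def bdd_above_def)
  then show ?thesis
    unfolding N_def using assms by (intro cSUP_upper) auto
qed

lemma N_le:
  assumes "\<And>r. 0 < r \<Longrightarrow> r < 1 \<Longrightarrow> circ_mean f r \<le> K"
  shows "N f \<le> K"
  unfolding N_def by (rule cSUP_least) (use assms in auto)

lemma N_nonneg: "f \<in> H2 J \<Longrightarrow> 0 \<le> N f"
  using N_ge[of f "1/2"] circ_mean_nonneg[of f "1/2"] by auto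

lemma h2norm_N: "h2norm f = sqrt (N f)"
  by (simp add: h2norm_def N_def)

lemma H2_add:
  assumes "f \<in> H2 J" "g \<in> H2 J"
  shows "(\<lambda>z. f z + g z) \<in> H2 J" "N (\<lambda>z. f z + g z) \<le> 2 * N f + 2 * N g"
proof -
  have le: "circ_mean (\<lambda>z. f z + g z) r \<le> 2 * N f + 2 * N g" if r: "0 < r" "r < 1" for r
  proof -
    have "circ_mean (\<lambda>z. f z + g z) r \<le> 2 * circ_mean f r + 2 * circ_mean g r"
    proof (rule circ_mean_le)
      fix z
      have "0 \<le> (norm (f z - g z))\<^sup>2" by simp
      then show "(norm (f z + g z))\<^sup>2 \<le> 2 * (norm (f z))\<^sup>2 + 2 * (norm (g z))\<^sup>2"
        by (simp add: power2_norm_eq_inner inner_simps inner_commute)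
    qed (use assms r in \<open>auto intro: H2_holo holo_E_add\<close>)
    then show ?thesis using N_ge[OF assms(1) r] N_ge[OF assms(2) r] by linarith
  qed
  show "(\<lambda>z. f z + g z) \<in> H2 J"
    by (rule H2I[of _ 0, OF _ _ _ _ le]) (use assms in \<open>auto intro: H2_holo holo_E_add simp: H2_outside\<close>)
  show "N (\<lambda>z. f z + g z) \<le> 2 * N f + 2 * N g" using le by (rule N_le)
qed

lemma mul_holo:
  assumes "m holomorphic_on disc" "holo_E J f disc"
  shows "holo_E J (mul m f) disc"
  by (rule holo_E_cong[OF _ holo_E_scC[OF _ assms]]) (auto simp: mul_def)

lemma H2_mul:
  assumes "m holomorphic_on disc" "\<And>z. z \<in> disc \<Longrightarrow> norm (m z) \<le> C" "f \<in> H2 J"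
  shows "mul m f \<in> H2 J" "N (mul m f) \<le> C\<^sup>2 * N f"
proof -
  have le: "circ_mean (mul m f) r \<le> C\<^sup>2 * N f" if r: "0 < r" "r < 1" for r
  proof -
    have "circ_mean (mul m f) r \<le> C\<^sup>2 * circ_mean f r + 0 * circ_mean f r"
    proof (rule circ_mean_le)
      fix z :: complex assume z: "norm z = r"
      have "norm (m z) * norm (f z) \<le> C * norm (f z)"
        using assms(2)[of z] z r by (intro mult_right_mono) auto
      then show "(norm (mul m f z))\<^sup>2 \<le> C\<^sup>2 * (norm (f z))\<^sup>2 + 0 * (norm (f z))\<^sup>2"
        using z r by (simp add: mul_def norm_scC power_mono flip: power_mult_distrib)
    qed (use assms r in \<open>auto intro: H2_holo mul_holo\<close>)
    also have "\<dots> \<le> C\<^sup>2 * N f" using N_ge[OF assms(3) r] by (simp add: mult_left_mono)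
    finally show ?thesis .
  qed
  show "mul m f \<in> H2 J"
    by (rule H2I[of _ 0, OF mul_holo[OF assms(1) H2_holo[OF assms(3)]] _ _ _ le]) (auto simp: mul_def)
  show "N (mul m f) \<le> C\<^sup>2 * N f" using le by (rule N_le)
qed

lemma H2_scC:
  assumes "f \<in> H2 J"
  shows "(\<lambda>z. scC J c (f z)) \<in> H2 J" "N (\<lambda>z. scC J c (f z)) \<le> (norm c)\<^sup>2 * N f"
proof -
  have "(\<lambda>z. scC J c (f z)) = mul (\<lambda>_. c) f"
    using H2_outside[OF assms] by (auto simp: mul_def)
  then show "(\<lambda>z. scC J c (f z)) \<in> H2 J" "N (\<lambda>z. scC J c (f z)) \<le> (norm c)\<^sup>2 * N f"
    using H2_mul[OF _ _ assms, of "\<lambda>_. c" "norm c"] by auto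
qed

lemma H2_diff:
  assumes "f \<in> H2 J" "g \<in> H2 J"
  shows "(\<lambda>z. f z - g z) \<in> H2 J" "N (\<lambda>z. f z - g z) \<le> 2 * N f + 2 * N g"
  using H2_add[OF assms(1) H2_scC(1)[OF assms(2), of "-1"]] H2_scC(2)[OF assms(2), of "-1"] by auto

lemma konst_holo: "holo_E J (konst x) disc"
  by (rule holo_E_cong[OF _ holo_E_const]) (auto simp: konst_def)

lemma H2_konst: "konst x \<in> H2 J" "N (konst x) \<le> (norm x)\<^sup>2"
proof -
  have le: "circ_mean (konst x) r \<le> (norm x)\<^sup>2" if r: "0 < r" "r < 1" for r
    by (rule circ_mean_bound[OF konst_holo]) (use r in \<open>auto simp: konst_def\<close>)
  show "konst x \<in> H2 J"
    by (rule H2I[of _ 0, OF konst_holo _ _ _ le]) (auto simp: konst_def)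
  show "N (konst x) \<le> (norm x)\<^sup>2" using le by (rule N_le)
qed

lemma H2_eval:
  assumes "norm z < 1"
  obtains K where "K > 0" "\<And>f. f \<in> H2 J \<Longrightarrow> (norm (f z))\<^sup>2 \<le> K * N f"
proof -
  define r where "r = (1 + norm z) / 2"
  have r: "norm z < r" "r < 1" "0 < r" using assms norm_ge_zero[of z] by (auto simp: r_def simp del: norm_ge_zero)
  have "(norm (f z))\<^sup>2 \<le> r / (r - norm z) * N f" if "f \<in> H2 J" for f
    using point_estimate[OF H2_holo[OF that] r(1,2)] N_ge[OF that r(3,2)] r
    by (meson divide_nonneg_nonneg mult_left_mono order_trans less_imp_le diff_ge_0_iff_ge)
  then show thesis using that[of "r / (r - norm z)"] r by simp
qed

lemma H2_quotient:
  assumes f: "f \<in> H2 J" and w: "norm w < 1"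
  obtains g where "g \<in> H2 J" "f = (\<lambda>z. konst (f w) z + mul (\<lambda>z. z - w) g z)"
proof -
  obtain g0 where g0: "holo_E J g0 disc" "\<And>z. z \<in> disc \<Longrightarrow> f z = f w + scC J (z - w) (g0 z)"
    using holo_E_quotient[OF _ _ H2_holo[OF f], of w] w by (metis mem_ball_0 open_ball)
  define g where "g = (\<lambda>z. if z \<in> disc then g0 z else 0)"
  have g: "holo_E J g disc"
    by (rule holo_E_cong[OF _ g0(1)]) (auto simp: g_def)
  \<comment> \<open>Points with \<open>norm z > r0\<close> have distance at least \<open>d\<close>
    from \<open>w\<close>.\<close>
  define r0 where "r0 = (1 + norm w) / 2"
  define d where "d = (1 - norm w) / 2"
  have d: "d > 0" using w by (simp add: d_def)
  have "g \<in> H2 J"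
  proof (rule H2I[OF g])
    show "0 \<le> r0" "r0 < 1" using w by (auto simp: r0_def)
    show "g z = 0" if "z \<notin> disc" for z using that by (simp add: g_def)
    fix r assume r: "r0 < r" "r < 1"
    have "0 < r0" unfolding r0_def by (simp add: add_pos_nonneg)
    then have r0: "0 < r" using r by linarith
    have "circ_mean g r \<le> (2 / d\<^sup>2) * circ_mean f r + (2 / d\<^sup>2) * circ_mean (konst (f w)) r"
    proof (rule circ_mean_le[OF g H2_holo[OF f] konst_holo])
      fix z :: complex assume z: "norm z = r"
      then have zd: "z \<in> disc" using r by simp
      have "d \<le> norm (z - w)"
        using norm_triangle_ineq2[of z w] z r by (simp add: r0_def d_def field_simps)
      then have "d * norm (g z) \<le> norm (scC J (z - w) (g z))"
        by (simp add: norm_scC mult_right_mono)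
      also have "scC J (z - w) (g z) = f z - konst (f w) z"
        using g0(2)[OF zd] zd by (simp add: g_def konst_def)
      finally have "(d * norm (g z))\<^sup>2 \<le> (norm (f z - konst (f w) z))\<^sup>2"
        using d by (intro power_mono) auto
      also have "\<dots> \<le> 2 * (norm (f z))\<^sup>2 + 2 * (norm (konst (f w) z))\<^sup>2"
        using zero_le_power2[of "norm (f z + konst (f w) z)"]
        unfolding power2_norm_eq_inner by (simp add: inner_simps inner_commute)
      finally show "(norm (g z))\<^sup>2 \<le> (2 / d\<^sup>2) * (norm (f z))\<^sup>2 + (2 / d\<^sup>2) * (norm (konst (f w) z))\<^sup>2"
        using d by (simp add: field_simps power_mult_distrib)
    qed (use r r0 in auto)
    also have "\<dots> \<le> (2 / d\<^sup>2) * N f + (2 / d\<^sup>2) * N (konst (f w))"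
      using N_ge[OF f r0 r(2)] N_ge[OF H2_konst(1) r0 r(2), of "f w"] by (intro add_mono mult_left_mono) auto
    finally show "circ_mean g r \<le> (2 / d\<^sup>2) * N f + (2 / d\<^sup>2) * N (konst (f w))" .
  qed
  moreover have "f = (\<lambda>z. konst (f w) z + mul (\<lambda>z. z - w) g z)"
    using g0(2) H2_outside[OF f] by (auto simp: konst_def mul_def g_def)
  ultimately show thesis by (rule that)
qed

text \<open>\<open>L\<close> is the backward shift \<open>f \<mapsto> (f - f 0) / z\<close>, \<open>coef f n\<close> the \<open>n\<close>-th Taylor coefficient.\<close>

definition L :: "(complex \<Rightarrow> 'e) \<Rightarrow> complex \<Rightarrow> 'e" where
  "L f = (SOME g. g \<in> H2 J \<and> f = (\<lambda>z. konst (f 0) z + mul (\<lambda>z. z) g z))"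

lemma
  assumes "f \<in> H2 J"
  shows H2_L: "L f \<in> H2 J" and L_eq: "f = (\<lambda>z. konst (f 0) z + mul (\<lambda>z. z) (L f) z)"
proof -
  have "\<exists>g. g \<in> H2 J \<and> f = (\<lambda>z. konst (f 0) z + mul (\<lambda>z. z) g z)"
    using H2_quotient[OF assms, of 0] by (metis (no_types, lifting) diff_zero norm_zero zero_less_one ext)
  then have "L f \<in> H2 J \<and> f = (\<lambda>z. konst (f 0) z + mul (\<lambda>z. z) (L f) z)"
    unfolding L_def by (rule someI_ex)
  then show "L f \<in> H2 J" "f = (\<lambda>z. konst (f 0) z + mul (\<lambda>z. z) (L f) z)" by auto
qed

section \<open>Taylor coefficients and Parseval's identity\<close>

lemma H2_Ln: "f \<in> H2 J \<Longrightarrow> (L ^^ n) f \<in> H2 J"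
  by (induction n) (auto intro: H2_L)

definition coef :: "(complex \<Rightarrow> 'e) \<Rightarrow> nat \<Rightarrow> 'e" where
  "coef f n = (L ^^ n) f 0"

lemma expansion:
  assumes "f \<in> H2 J" "z \<in> disc"
  shows "f z = (\<Sum>k<n. scC J (z ^ k) (coef f k)) + scC J (z ^ n) ((L ^^ n) f z)"
proof (induction n)
  case (Suc n)
  have "(L ^^ n) f z = coef f n + scC J z ((L ^^ Suc n) f z)"
    using fun_cong[OF L_eq[OF H2_Ln[OF assms(1), of n]], of z] assms(2)
    by (simp add: konst_def mul_def coef_def)
  then show ?case
    using Suc by (simp add: scC_add_right scC_scC mult.commute)
qed simp

lemma circ_mean_L:
  assumes "f \<in> H2 J" "0 < r" "r < 1"
  shows "circ_mean f r = (norm (f 0))\<^sup>2 + r\<^sup>2 * circ_mean (L f) r"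
proof (rule circ_mean_step[OF H2_holo[OF assms(1)] H2_holo[OF H2_L[OF assms(1)]] _ assms(2,3)])
  fix z :: complex assume "z \<in> disc"
  then show "f z = f 0 + scC J z (L f z)"
    using fun_cong[OF L_eq[OF assms(1)], of z] by (simp add: konst_def mul_def)
qed

lemma Parseval_partial:
  assumes "f \<in> H2 J" "0 < r" "r < 1"
  shows "circ_mean f r = (\<Sum>k<n. r ^ (2 * k) * (norm (coef f k))\<^sup>2) + r ^ (2 * n) * circ_mean ((L ^^ n) f) r"
proof (induction n)
  case (Suc n)
  show ?case
    using Suc circ_mean_L[OF H2_Ln[OF assms(1)] assms(2,3), of n]
    by (simp add: coef_def algebra_simps power2_eq_square)
qed simp

text \<open>By \<open>Parseval_partial\<close> the mean of the n-th shift on the circle of radius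
  \<open>r\<close> grows at most like r^(-2n), and \<open>point_estimate\<close> costs a factor
  independent of \<open>n\<close>; the remainder decays geometrically.\<close>

lemma remainder_bound:
  assumes f: "f \<in> H2 J" and r: "norm z < r" "r < 1"
  shows "norm z ^ (2 * n) * (norm ((L ^^ n) f z))\<^sup>2 \<le> (norm z / r) ^ (2 * n) * (r / (r - norm z) * circ_mean f r)"
proof -
  have r0: "0 < r" using r norm_ge_zero[of z] by linarith
  have "0 \<le> (\<Sum>k<n. r ^ (2 * k) * (norm (coef f k))\<^sup>2)"
    using r0 by (intro sum_nonneg) auto
  then have le: "r ^ (2 * n) * circ_mean ((L ^^ n) f) r \<le> circ_mean f r"
    using Parseval_partial[OF f r0 r(2), of n] by linarith
  have "(norm ((L ^^ n) f z))\<^sup>2 \<le> r / (r - norm z) * circ_mean ((L ^^ n) f) r"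
    by (rule point_estimate[OF H2_holo[OF H2_Ln[OF f]] r])
  then have "r ^ (2 * n) * (norm ((L ^^ n) f z))\<^sup>2 \<le> r ^ (2 * n) * (r / (r - norm z) * circ_mean ((L ^^ n) f) r)"
    using r0 by (intro mult_left_mono) auto
  also have "\<dots> = r / (r - norm z) * (r ^ (2 * n) * circ_mean ((L ^^ n) f) r)"
    by simp
  also have "\<dots> \<le> r / (r - norm z) * circ_mean f r"
    using le r r0 by (intro mult_left_mono) auto
  finally have "(norm z / r) ^ (2 * n) * (r ^ (2 * n) * (norm ((L ^^ n) f z))\<^sup>2)
      \<le> (norm z / r) ^ (2 * n) * (r / (r - norm z) * circ_mean f r)"
    using r0 by (intro mult_left_mono) auto
  then show ?thesis
    using r0 by (simp add: power_divide)
qed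

lemma geometric_tendsto_0:
  assumes "0 \<le> (a::real)" "a < 1"
  shows "(\<lambda>n. a ^ (2 * n) * K) \<longlonglongrightarrow> 0"
proof -
  have "(\<lambda>n. (a\<^sup>2) ^ n) \<longlonglongrightarrow> 0"
    by (rule LIMSEQ_power_zero) (use assms in \<open>auto simp: abs_square_less_1\<close>)
  then show ?thesis
    by (intro tendsto_mult_left_zero) (simp add: power_mult)
qed

lemma Parseval_sums:
  assumes f: "f \<in> H2 J" and r: "0 < r" "r < 1"
  shows "(\<lambda>k. r ^ (2 * k) * (norm (coef f k))\<^sup>2) sums circ_mean f r"
proof -
  define s where "s = (1 + r) / 2"
  have s: "r < s" "s < 1" "0 < s" using r by (auto simp: s_def)
  define K where "K = s / (s - r) * circ_mean f s"
  have rem: "r ^ (2 * n) * circ_mean ((L ^^ n) f) r \<le> (r / s) ^ (2 * n) * K" for n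
  proof -
    have "circ_mean ((L ^^ n) f) r \<le> (r / s) ^ (2 * n) * K / r ^ (2 * n)"
    proof (rule circ_mean_bound[OF H2_holo[OF H2_Ln[OF f]]])
      fix z :: complex assume "norm z = r"
      then show "(norm ((L ^^ n) f z))\<^sup>2 \<le> (r / s) ^ (2 * n) * K / r ^ (2 * n)"
        using remainder_bound[OF f, of z s n] s r by (simp add: K_def pos_le_divide_eq mult.commute)
    qed (use r in auto)
    then show ?thesis using r by (simp add: pos_le_divide_eq mult.commute)
  qed
  have "(\<lambda>n. r ^ (2 * n) * circ_mean ((L ^^ n) f) r) \<longlonglongrightarrow> 0"
  proof (rule Lim_null_comparison)
    show "\<forall>\<^sub>F n in sequentially. norm (r ^ (2 * n) * circ_mean ((L ^^ n) f) r) \<le> (r / s) ^ (2 * n) * K"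
      using rem r by (auto simp: abs_mult abs_of_nonneg[OF circ_mean_nonneg])
    show "(\<lambda>n. (r / s) ^ (2 * n) * K) \<longlonglongrightarrow> 0"
      by (rule geometric_tendsto_0) (use r s in auto)
  qed
  then have "(\<lambda>n. circ_mean f r - r ^ (2 * n) * circ_mean ((L ^^ n) f) r) \<longlonglongrightarrow> circ_mean f r - 0"
    by (intro tendsto_diff tendsto_const)
  moreover have "circ_mean f r - r ^ (2 * n) * circ_mean ((L ^^ n) f) r = (\<Sum>k<n. r ^ (2 * k) * (norm (coef f k))\<^sup>2)" for n
    using Parseval_partial[OF f r, of n] by simp
  ultimately show ?thesis
    by (simp add: sums_def)
qed

lemma coef_sum_le:
  assumes f: "f \<in> H2 J"
  shows "(\<Sum>k<n. (norm (coef f k))\<^sup>2) \<le> N f"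
proof (rule tendsto_upperbound)
  show "((\<lambda>r. \<Sum>k<n. r ^ (2 * k) * (norm (coef f k))\<^sup>2) \<longlongrightarrow> (\<Sum>k<n. (norm (coef f k))\<^sup>2)) (at_left 1)"
    by (rule tendsto_eq_intros refl | simp)+
  show "\<forall>\<^sub>F r in at_left (1::real). (\<Sum>k<n. r ^ (2 * k) * (norm (coef f k))\<^sup>2) \<le> N f"
    using eventually_at_left_1
  proof (rule eventually_mono)
    fix r :: real assume r: "0 < r \<and> r < 1"
    have "0 \<le> r ^ (2 * n) * circ_mean ((L ^^ n) f) r"
      using r by (intro mult_nonneg_nonneg circ_mean_nonneg) auto
    then show "(\<Sum>k<n. r ^ (2 * k) * (norm (coef f k))\<^sup>2) \<le> N f"
      using Parseval_partial[OF f, of r n] N_ge[OF f, of r] r by linarith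
  qed
qed auto

lemma summable_coef:
  assumes "f \<in> H2 J"
  shows "summable (\<lambda>k. (norm (coef f k))\<^sup>2)"
  by (rule summableI_nonneg_bounded[where x = "N f"]) (auto intro: coef_sum_le[OF assms])

text \<open>Parseval for the shifted function, with its weights bounded by 1. Tails of a convergent
  series appear, so the backward shift tends strongly to 0.\<close>

lemma N_Ln_le:
  assumes f: "f \<in> H2 J"
  shows "N ((L ^^ n) f) \<le> (\<Sum>k. (norm (coef f (k + n)))\<^sup>2)"
proof (rule N_le)
  fix r :: real assume r: "0 < r" "r < 1"
  have c: "coef ((L ^^ n) f) k = coef f (k + n)" for k
    by (simp add: coef_def funpow_add)
  have sm: "summable (\<lambda>k. (norm (coef f (k + n)))\<^sup>2)"
    using summable_coef[OF f] by (rule summable_ignore_initial_segment)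
  have "(\<lambda>k. r ^ (2 * k) * (norm (coef f (k + n)))\<^sup>2) sums circ_mean ((L ^^ n) f) r"
    using Parseval_sums[OF H2_Ln[OF f] r, of n] by (simp add: c)
  then have "circ_mean ((L ^^ n) f) r = (\<Sum>k. r ^ (2 * k) * (norm (coef f (k + n)))\<^sup>2)"
    and "summable (\<lambda>k. r ^ (2 * k) * (norm (coef f (k + n)))\<^sup>2)"
    by (auto simp: sums_iff)
  moreover have "r ^ (2 * k) * (norm (coef f (k + n)))\<^sup>2 \<le> (norm (coef f (k + n)))\<^sup>2" for k
    using r by (intro mult_left_le_one_le) (auto simp: power_le_one)
  ultimately show "circ_mean ((L ^^ n) f) r \<le> (\<Sum>k. (norm (coef f (k + n)))\<^sup>2)"
    using suminf_le[OF _ _ sm] by simp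
qed

lemma N_Ln_small:
  assumes "f \<in> H2 J" "e > 0"
  obtains n where "N ((L ^^ n) f) < e"
proof -
  obtain n where "norm (\<Sum>k. (norm (coef f (k + n)))\<^sup>2) < e"
    using suminf_exist_split[OF assms(2) summable_coef[OF assms(1)]] by blast
  then show thesis
    using N_Ln_le[OF assms(1), of n] by (intro that[of n]) simp
qed

text \<open>Cauchy-Schwarz for Taylor sums against the geometric series. The exact constant matters:
  a cruder one, as in \<open>H2_eval\<close>, would spoil the contractivity in
  \<open>norm_T_konst\<close>.\<close>

lemma sharp_eval:
  assumes f: "f \<in> H2 J" and z: "norm z < 1"
  shows "(1 - (norm z)\<^sup>2) * (norm (f z))\<^sup>2 \<le> N f"
proof -
  define S where "S = (\<lambda>n. \<Sum>k<n. scC J (z ^ k) (coef f k))"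
  have z2: "(norm z)\<^sup>2 < 1" using z by (simp add: abs_square_less_1)
  have S_le: "(1 - (norm z)\<^sup>2) * (norm (S n))\<^sup>2 \<le> N f" for n
  proof -
    have "norm (S n) \<le> (\<Sum>k<n. norm z ^ k * norm (coef f k))"
      unfolding S_def by (rule order_trans[OF norm_sum]) (simp add: norm_scC norm_power)
    then have "(norm (S n))\<^sup>2 \<le> (\<Sum>k<n. norm z ^ k * norm (coef f k))\<^sup>2"
      by (intro power_mono) auto
    also have "\<dots> \<le> (\<Sum>k<n. (norm z ^ k)\<^sup>2) * (\<Sum>k<n. (norm (coef f k))\<^sup>2)"
      by (rule Cauchy_Schwarz_ineq_sum)
    also have "(\<Sum>k<n. (norm z ^ k)\<^sup>2) = (\<Sum>k<n. ((norm z)\<^sup>2) ^ k)"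
      by (simp add: power_mult[symmetric] mult.commute)
    finally have "(1 - (norm z)\<^sup>2) * (norm (S n))\<^sup>2 \<le> (1 - (norm z)\<^sup>2) * ((\<Sum>k<n. ((norm z)\<^sup>2) ^ k) * (\<Sum>k<n. (norm (coef f k))\<^sup>2))"
      using z2 by (intro mult_left_mono) auto
    also have "\<dots> = (1 - ((norm z)\<^sup>2) ^ n) * (\<Sum>k<n. (norm (coef f k))\<^sup>2)"
      by (simp add: one_diff_power_eq flip: mult.assoc)
    also have "\<dots> \<le> 1 * N f"
      using coef_sum_le[OF f, of n] z2 by (intro mult_mono) (auto intro!: sum_nonneg simp: power_le_one)
    finally show ?thesis by simp
  qed
  define r where "r = (1 + norm z) / 2"
  have r: "norm z < r" "r < 1" "0 < r" using z norm_ge_zero[of z] by (auto simp: r_def simp del: norm_ge_zero)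
  have "(\<lambda>n. (norm (S n - f z))\<^sup>2) \<longlonglongrightarrow> 0"
  proof (rule Lim_null_comparison)
    show "(\<lambda>n. (norm z / r) ^ (2 * n) * (r / (r - norm z) * circ_mean f r)) \<longlonglongrightarrow> 0"
      by (rule geometric_tendsto_0) (use r in auto)
    have "(norm (S n - f z))\<^sup>2 \<le> (norm z / r) ^ (2 * n) * (r / (r - norm z) * circ_mean f r)" for n
      using remainder_bound[OF f r(1,2), of n] expansion[OF f, of z n] z
      by (simp add: S_def norm_scC norm_power power_mult_distrib power_mult[symmetric] mult.commute)
    then show "\<forall>\<^sub>F n in sequentially. norm ((norm (S n - f z))\<^sup>2) \<le> (norm z / r) ^ (2 * n) * (r / (r - norm z) * circ_mean f r)"
      by simp
  qed
  then have "(\<lambda>n. sqrt ((norm (S n - f z))\<^sup>2)) \<longlonglongrightarrow> sqrt 0" by (rule tendsto_real_sqrt)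
  then have "S \<longlonglongrightarrow> f z"
    by (simp add: tendsto_norm_zero_iff LIM_zero_iff)
  then have "(\<lambda>n. (1 - (norm z)\<^sup>2) * (norm (S n))\<^sup>2) \<longlonglongrightarrow> (1 - (norm z)\<^sup>2) * (norm (f z))\<^sup>2"
    by (intro tendsto_intros)
  then show ?thesis
    by (rule LIMSEQ_le_const2) (use S_le in blast)
qed

text \<open>The function f = x / (1 - c z) satisfies f = x + z (c f), so
  \<open>circ_mean_step\<close> becomes an equation for its circular mean alone.\<close>

lemma N_kernel:
  assumes c: "norm c < 1"
  shows "mul (\<lambda>z. 1 / (1 - c * z)) (konst x) \<in> H2 J"
    and "(1 - (norm c)\<^sup>2) * N (mul (\<lambda>z. 1 / (1 - c * z)) (konst x)) \<le> (norm x)\<^sup>2"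
proof -
  define f where "f = mul (\<lambda>z. 1 / (1 - c * z)) (konst x)"
  have cz: "norm (c * z) \<le> norm c" if "z \<in> disc" for z
    using that mult_left_le[of "norm z" "norm c"] by (simp add: norm_mult)
  have nz: "1 - c * z \<noteq> 0" "1 - norm c \<le> norm (1 - c * z)" if "z \<in> disc" for z
    using cz[OF that] c norm_triangle_ineq2[of 1 "c * z"] by auto
  have hol: "(\<lambda>z. 1 / (1 - c * z)) holomorphic_on disc"
    by (intro holomorphic_intros) (use nz in auto)
  have bd: "norm (1 / (1 - c * z)) \<le> 1 / (1 - norm c)" if "z \<in> disc" for z
    using nz[OF that] c by (simp add: norm_divide frac_le)
  show fH: "mul (\<lambda>z. 1 / (1 - c * z)) (konst x) \<in> H2 J"
    by (rule H2_mul(1)[OF hol bd H2_konst(1)])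
  have fholo: "holo_E J f disc" using H2_holo[OF fH] by (simp add: f_def)
  have c2: "(norm c)\<^sup>2 < 1" using c by (simp add: abs_square_less_1)
  have "circ_mean f r \<le> (norm x)\<^sup>2 / (1 - (norm c)\<^sup>2)" if r: "0 < r" "r < 1" for r
  proof -
    have "circ_mean f r = (norm x)\<^sup>2 + r\<^sup>2 * circ_mean (\<lambda>z. scC J c (f z)) r"
    proof (rule circ_mean_step[OF fholo holo_E_scC[OF _ _ fholo] _ r])
      fix z :: complex assume z: "z \<in> disc"
      have "scC J (1 - c * z) (f z) = x"
        using z nz[OF z] by (simp add: f_def mul_def konst_def scC_scC)
      then show "f z = x + scC J z (scC J c (f z))"
        by (simp add: scC_diff_left scC_scC mult.commute algebra_simps)
    qed auto
    also have "circ_mean (\<lambda>z. scC J c (f z)) r = (norm c)\<^sup>2 * circ_mean f r"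
      by (simp add: circ_mean_cis norm_scC power_mult_distrib)
    finally have eq: "(norm x)\<^sup>2 = (1 - r\<^sup>2 * (norm c)\<^sup>2) * circ_mean f r"
      by algebra
    have "1 - (norm c)\<^sup>2 \<le> 1 - r\<^sup>2 * (norm c)\<^sup>2"
      using r mult_right_le_one_le[of "(norm c)\<^sup>2" "r\<^sup>2"] by (simp add: power_le_one mult.commute)
    then have "(1 - (norm c)\<^sup>2) * circ_mean f r \<le> (norm x)\<^sup>2"
      unfolding eq by (intro mult_right_mono circ_mean_nonneg)
    then show ?thesis using c2 by (simp add: pos_le_divide_eq mult.commute)
  qed
  then have "N f \<le> (norm x)\<^sup>2 / (1 - (norm c)\<^sup>2)" by (rule N_le)
  then show "(1 - (norm c)\<^sup>2) * N (mul (\<lambda>z. 1 / (1 - c * z)) (konst x)) \<le> (norm x)\<^sup>2"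
    using c2 by (simp add: f_def pos_le_divide_eq mult.commute)
qed

end

section \<open>Operators commuting with the scalar semigroup\<close>

definition phi :: "real \<Rightarrow> complex \<Rightarrow> complex" where
  "phi t w = exp (of_real t * (w + 1) / (w - 1))"

text \<open>\<open>phi_sum e w\<close> is \<open>e \<Sum>\<^sub>k exp(-k e) phi (k e) w\<close>, a Riemann sum for the integral of \<open>exp(-t) phi t w\<close> over
  \<open>t \<ge> 0\<close>, whose value is \<open>(1 - w) / 2\<close>.\<close>

definition phi_sum :: "real \<Rightarrow> complex \<Rightarrow> complex" where
  "phi_sum e w = of_real e / (1 - exp (of_real e * (2 / (w - 1))))"

lemma disc_neq_1: "w \<in> disc \<Longrightarrow> w - 1 \<noteq> 0"
  by auto

text \<open>2 / (w - 1) is (w + 1) / (w - 1) minus 1, and the latter quotient has negative real part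
  on the disc.\<close>

lemma Re_cayley:
  assumes "w \<in> disc"
  shows "Re (2 / (w - 1)) \<le> - 1"
proof -
  have w: "w \<noteq> 1" using assms by auto
  have n: "(norm w)\<^sup>2 < 1" using assms by (simp add: abs_square_less_1)
  have "(norm (w - 1))\<^sup>2 = (norm w)\<^sup>2 - 2 * Re w + 1"
    by (simp add: cmod_power2) (simp add: power2_eq_square algebra_simps)
  then have le: "(norm (w - 1))\<^sup>2 \<le> 2 * (1 - Re w)"
    using n by simp
  have eq: "Re (2 / (w - 1)) = - (2 * (1 - Re w)) / (norm (w - 1))\<^sup>2"
    by (simp add: Re_divide cmod_power2)
  have "0 < (norm (w - 1))\<^sup>2" using w by simp
  then show ?thesis
    unfolding eq using le by (subst pos_divide_le_eq) auto
qed

lemma phi_alt: "w \<in> disc \<Longrightarrow> exp (- of_real e) * phi e w = exp (of_real e * (2 / (w - 1)))"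
  using disc_neq_1[of w] unfolding phi_def exp_add[symmetric]
  by (intro arg_cong[where f = exp]) (simp add: divide_simps, simp add: algebra_simps)

lemma phi_holo: "phi t holomorphic_on disc"
  unfolding phi_def by (intro holomorphic_intros) auto

lemma norm_phi:
  assumes "w \<in> disc" "t \<ge> 0"
  shows "norm (phi t w) \<le> 1"
proof -
  have "phi t w = exp (of_real t) * (exp (- of_real t) * phi t w)"
    by (simp add: exp_minus)
  also have "\<dots> = exp (of_real t) * exp (of_real t * (2 / (w - 1)))"
    using phi_alt[OF assms(1), of t] by simp
  finally have "norm (phi t w) = exp (t + t * Re (2 / (w - 1)))"
    by (simp add: norm_mult exp_add del: times_divide_eq_right)
  also have "\<dots> \<le> 1"
    using mult_left_mono[OF Re_cayley[OF assms(1)] assms(2)] by simp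
  finally show ?thesis .
qed

lemma norm_exp_minus_1_le:
  assumes "Re u \<le> 0"
  shows "norm (exp u - 1) \<le> norm u"
proof -
  have "norm (exp u - exp 0) \<le> 1 * norm (u - 0)"
  proof (rule field_differentiable_bound[where S = "{z. Re z \<le> 0}" and f' = exp])
    show "convex {z. Re z \<le> 0}" by (rule convex_halfspace_Re_le)
    show "(exp has_field_derivative exp z) (at z within {z. Re z \<le> 0})" for z :: complex
      by (rule DERIV_subset[OF DERIV_exp]) auto
  qed (use assms in auto)
  then show ?thesis by simp
qed

lemma norm_exp_minus_1_minus_le:
  assumes "Re u \<le> 0"
  shows "norm (exp u - 1 - u) \<le> (norm u)\<^sup>2"
proof -
  define S where "S = {z. Re z \<le> 0} \<inter> cball 0 (norm u)"
  have "norm ((exp u - u) - (exp 0 - 0)) \<le> norm u * norm (u - 0)"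
  proof (rule field_differentiable_bound[where S = S and f' = "\<lambda>z. exp z - 1"])
    show "convex S" unfolding S_def by (intro convex_Int convex_halfspace_Re_le convex_cball)
    show "((\<lambda>z. exp z - z) has_field_derivative exp z - 1) (at z within S)" for z
      by (auto intro!: derivative_eq_intros)
    show "norm (exp z - 1) \<le> norm u" if "z \<in> S" for z
      using that norm_exp_minus_1_le[of z] by (auto simp: S_def)
  qed (use assms in \<open>auto simp: S_def\<close>)
  then show ?thesis by (simp add: power2_eq_square algebra_simps)
qed

text \<open>The exponential has modulus at most exp(-e), and exp(-e) is at most 1 / (1 + e), hence
  at most 1 - e/2 since e is at most 1.\<close>

lemma phi_sum_denom:
  assumes "w \<in> disc" "0 < e" "e \<le> 1"
  shows "e / 2 \<le> norm (1 - exp (of_real e * (2 / (w - 1))))"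
proof -
  have "norm (exp (of_real e * (2 / (w - 1)))) = exp (e * Re (2 / (w - 1)))"
    by (simp del: times_divide_eq_right)
  also have "\<dots> \<le> exp (- e)"
    using mult_left_mono[OF Re_cayley[OF assms(1)], of e] assms by simp
  also have "\<dots> \<le> 1 / (1 + e)"
    using exp_ge_add_one_self[of e] assms by (simp add: exp_minus divide_simps)
  also have "\<dots> \<le> 1 - e / 2"
  proof -
    have "1 \<le> (1 - e / 2) * (1 + e)"
      using mult_left_le[of e e] assms by (simp add: algebra_simps)
    then show ?thesis using assms by (simp add: pos_divide_le_eq)
  qed
  finally show ?thesis
    using norm_triangle_ineq2[of 1 "exp (of_real e * (2 / (w - 1)))"] by simp
qed

lemma phi_sum_holo:
  assumes "0 < e" "e \<le> 1"
  shows "phi_sum e holomorphic_on disc"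
  unfolding phi_sum_def
proof (intro holomorphic_intros)
  fix w :: complex assume w: "w \<in> disc"
  then show "w - 1 \<noteq> 0" by (rule disc_neq_1)
  show "1 - exp (of_real e * (2 / (w - 1))) \<noteq> 0"
    using phi_sum_denom[OF w assms] assms by auto
qed

lemma norm_phi_sum:
  assumes "w \<in> disc" "0 < e" "e \<le> 1"
  shows "norm (phi_sum e w) \<le> 2"
proof -
  have "norm (phi_sum e w) \<le> e / (e / 2)"
    unfolding phi_sum_def norm_divide using phi_sum_denom[OF assms] assms by (intro frac_le) auto
  then show ?thesis using assms by simp
qed

text \<open>With b = 2 / (w - 1), the error is a second-order Taylor remainder of exp at e b. The
  factor 1 - w, which is -2 / b, supplies the missing power of b in the denominator, so the bound is
  uniform in \<open>w\<close>.\<close>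

lemma phi_sum_approx:
  assumes w: "w \<in> disc" and e: "0 < e" "e \<le> 1"
  shows "norm ((phi_sum e w - (1 - w) / 2) * (1 - w)) \<le> 4 * e"
proof -
  define b where "b = 2 / (w - 1)"
  define d where "d = 1 - exp (of_real e * b)"
  have b0: "b \<noteq> 0" using w by (auto simp: b_def)
  have wb: "1 - w = - (2 / b)" using w by (auto simp: b_def diff_divide_distrib)
  have d: "e / 2 \<le> norm d" using phi_sum_denom[OF assms] by (simp add: d_def b_def)
  then have d0: "d \<noteq> 0" using e by auto
  have Re: "Re (of_real e * b) \<le> 0"
    using mult_left_mono[OF Re_cayley[OF w], of e] e by (simp add: b_def del: times_divide_eq_right)
  have "(phi_sum e w - (1 - w) / 2) * (1 - w) = (of_real e / d + 1 / b) * (- (2 / b))"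
    unfolding wb by (simp add: phi_sum_def d_def b_def)
  also have "\<dots> = 2 * (exp (of_real e * b) - 1 - of_real e * b) / (d * b\<^sup>2)"
  proof -
    have E: "exp (of_real e * b) = 1 - d" by (simp add: d_def)
    show ?thesis unfolding E using d0 b0 by (simp add: field_simps power2_eq_square)
  qed
  finally have "norm ((phi_sum e w - (1 - w) / 2) * (1 - w))
      = 2 * norm (exp (of_real e * b) - 1 - of_real e * b) / (norm d * (norm b)\<^sup>2)"
    by (simp add: norm_mult norm_divide norm_power del: right_diff_distrib_numeral)
  also have "\<dots> \<le> 2 * (norm (of_real e * b))\<^sup>2 / (e / 2 * (norm b)\<^sup>2)"
    using norm_exp_minus_1_minus_le[OF Re] d e b0 by (intro frac_le mult_right_mono) auto
  also have "\<dots> = 4 * e"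
    using e b0 by (simp add: norm_mult power_mult_distrib power2_eq_square)
  finally show ?thesis .
qed

locale h2_contraction = complex_hilbert J for J :: "'e::{real_inner, banach} \<Rightarrow>\<^sub>L 'e" +
  fixes T :: "(complex \<Rightarrow> 'e) \<Rightarrow> (complex \<Rightarrow> 'e)"
  assumes T_H2: "f \<in> H2 J \<Longrightarrow> T f \<in> H2 J"
    and T_add: "f \<in> H2 J \<Longrightarrow> g \<in> H2 J \<Longrightarrow> T (\<lambda>z. f z + g z) = (\<lambda>z. T f z + T g z)"
    and T_scC: "f \<in> H2 J \<Longrightarrow> T (\<lambda>z. scC J c (f z)) = (\<lambda>z. scC J c (T f z))"
    and N_T: "f \<in> H2 J \<Longrightarrow> N (T f) \<le> N f"

context complex_hilbert
begin

section \<open>Multiplication operators and density of the multiples of 1 - z\<close>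

lemma mul_mul: "mul m (mul n f) = mul (\<lambda>z. m z * n z) f"
  by (auto simp: mul_def scC_scC)

lemma mul_cong: "(\<And>z. z \<in> disc \<Longrightarrow> m z = n z) \<Longrightarrow> mul m f = mul n f"
  by (auto simp: mul_def)

lemma mul_1: "f \<in> H2 J \<Longrightarrow> mul (\<lambda>z. 1) f = f"
  by (auto simp: mul_def fun_eq_iff H2_outside)

lemma mul_diff_fun: "mul m (\<lambda>z. f z - g z) = (\<lambda>z. mul m f z - mul m g z)"
  by (auto simp: mul_def scC_diff_right)

lemma mul_add_fun: "mul m (\<lambda>z. f z + g z) = (\<lambda>z. mul m f z + mul m g z)"
  by (auto simp: mul_def scC_add_right)

lemma mul_diff_symbol: "mul (\<lambda>z. m z - n z) f = (\<lambda>z. mul m f z - mul n f z)"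
  by (auto simp: mul_def scC_diff_left)

lemma mul_const: "f \<in> H2 J \<Longrightarrow> mul (\<lambda>z. c) f = (\<lambda>z. scC J c (f z))"
  by (auto simp: mul_def fun_eq_iff H2_outside)

lemma mul_z_H2:
  assumes "f \<in> H2 J"
  shows "mul (\<lambda>z. z) f \<in> H2 J" "N (mul (\<lambda>z. z) f) \<le> N f"
  using H2_mul[of "\<lambda>z. z" 1, OF _ _ assms] by (auto intro: holomorphic_intros)

lemma mul_1z_H2: "f \<in> H2 J \<Longrightarrow> mul (\<lambda>z. 1 - z) f \<in> H2 J"
proof (rule H2_mul(1)[where C = 2])
  show "norm (1 - z) \<le> 2" if "z \<in> disc" for z :: complex
    using that norm_triangle_ineq4[of 1 z] by simp
qed (auto intro: holomorphic_intros)

text \<open>Multiplication by \<open>vker c\<close> is a contraction and \<open>1 - vker c z\<close> is divisible by \<open>1 - z\<close>; that it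
  tends strongly to 0 as \<open>c \<rightarrow> 1\<close> makes the multiples of \<open>1 - z\<close> dense.\<close>

definition vker :: "real \<Rightarrow> complex \<Rightarrow> complex" where
  "vker c z = of_real (1 - c) / (1 - of_real c * z)"

lemma vker:
  assumes c: "0 < c" "c < 1"
  shows "vker c holomorphic_on disc" and "\<And>z. z \<in> disc \<Longrightarrow> 1 - of_real c * z \<noteq> 0"
    and "\<And>z. z \<in> disc \<Longrightarrow> norm (vker c z) \<le> 1"
proof -
  have *: "1 - c \<le> norm (1 - of_real c * z)" if "z \<in> disc" for z :: complex
  proof -
    have "c * norm z \<le> c" using that c by (intro mult_left_le) auto
    moreover have "norm (of_real c * z) = c * norm z" using c by (simp add: norm_mult)
    ultimately show ?thesis
      using norm_triangle_ineq2[of 1 "of_real c * z"] by simp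
  qed
  show nz: "\<And>z. z \<in> disc \<Longrightarrow> 1 - complex_of_real c * z \<noteq> 0"
    using * c by fastforce
  show "vker c holomorphic_on disc"
    unfolding vker_def by (intro holomorphic_intros) (use nz in auto)
  show "norm (vker c z) \<le> 1" if "z \<in> disc" for z
    using *[OF that] c unfolding vker_def norm_divide norm_of_real by (simp add: divide_le_eq_1)
qed

text \<open>A property stable under sums and multiplication by z, so that it passes from constants
  to Taylor polynomials.\<close>

definition vanishing :: "(complex \<Rightarrow> 'e) \<Rightarrow> bool" where
  "vanishing f \<longleftrightarrow> f \<in> H2 J \<and> ((\<lambda>c. N (mul (vker c) f)) \<longlongrightarrow> 0) (at_left 1)"

lemma vker_H2:
  assumes "0 < c" "c < 1" "f \<in> H2 J"
  shows "mul (vker c) f \<in> H2 J" "N (mul (vker c) f) \<le> N f"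
  using H2_mul[OF vker(1)[OF assms(1,2)] vker(3)[OF assms(1,2)] assms(3)] by auto

text \<open>The product is a Szego kernel applied to \<open>(1 - c) *\<^sub>R x\<close>, so
  \<open>N_kernel\<close> bounds \<open>N\<close> by (1 - c) / (1 + c) times the squared norm of
  \<open>x\<close>.\<close>

lemma vanishing_konst: "vanishing (konst x)"
  unfolding vanishing_def
proof (rule conjI[OF H2_konst(1) Lim_null_comparison])
  show "((\<lambda>c::real. (1 - c) * (norm x)\<^sup>2) \<longlongrightarrow> 0) (at_left 1)"
    by (rule tendsto_eq_intros refl | simp)+
  show "\<forall>\<^sub>F c in at_left 1. norm (N (mul (vker c) (konst x))) \<le> (1 - c) * (norm x)\<^sup>2"
    using eventually_at_left_1
  proof (rule eventually_mono)
    fix c :: real assume "0 < c \<and> c < 1"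
    then have c: "0 < c" "c < 1" by auto
    define y where "y = (1 - c) *\<^sub>R x"
    have "mul (vker c) (konst x) = mul (\<lambda>z. 1 / (1 - of_real c * z)) (konst y)"
      by (auto simp: mul_def konst_def vker_def y_def fun_eq_iff scC_scaleR_right simp flip: scC_scaleR_left)
        (simp add: scaleR_conv_of_real)
    moreover have "(1 - c\<^sup>2) * N (mul (\<lambda>z. 1 / (1 - of_real c * z)) (konst y)) \<le> (norm y)\<^sup>2"
      using N_kernel(2)[of "of_real c" y] c by simp
    ultimately have "(1 - c\<^sup>2) * N (mul (vker c) (konst x)) \<le> (1 - c)\<^sup>2 * (norm x)\<^sup>2"
      by (simp add: y_def power_mult_distrib)
    then have "(1 - c) * ((1 + c) * N (mul (vker c) (konst x))) \<le> (1 - c) * ((1 - c) * (norm x)\<^sup>2)"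
      by (simp add: power2_eq_square algebra_simps)
    then have "(1 + c) * N (mul (vker c) (konst x)) \<le> (1 - c) * (norm x)\<^sup>2"
      using c by simp
    moreover have N0: "0 \<le> N (mul (vker c) (konst x))"
      by (rule N_nonneg[OF vker_H2(1)[OF c H2_konst(1)]])
    ultimately show "norm (N (mul (vker c) (konst x))) \<le> (1 - c) * (norm x)\<^sup>2"
      using mult_right_mono[of 1 "1 + c" "N (mul (vker c) (konst x))"] c by simp
  qed
qed

lemma vanishing_add:
  assumes "vanishing f" "vanishing g"
  shows "vanishing (\<lambda>z. f z + g z)"
  unfolding vanishing_def
proof (rule conjI[OF _ Lim_null_comparison])
  have H: "f \<in> H2 J" "g \<in> H2 J" using assms by (auto simp: vanishing_def)
  then show "(\<lambda>z. f z + g z) \<in> H2 J" by (rule H2_add)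
  show "((\<lambda>c. 2 * N (mul (vker c) f) + 2 * N (mul (vker c) g)) \<longlongrightarrow> 0) (at_left 1)"
    using assms unfolding vanishing_def by (auto intro!: tendsto_eq_intros)
  show "\<forall>\<^sub>F c in at_left 1. norm (N (mul (vker c) (\<lambda>z. f z + g z))) \<le> 2 * N (mul (vker c) f) + 2 * N (mul (vker c) g)"
    using eventually_at_left_1
  proof (rule eventually_mono)
    fix c :: real assume "0 < c \<and> c < 1"
    then have "mul (vker c) f \<in> H2 J" "mul (vker c) g \<in> H2 J" using H vker_H2 by auto
    from H2_add[OF this] N_nonneg[OF H2_add(1)[OF this]]
    show "norm (N (mul (vker c) (\<lambda>z. f z + g z))) \<le> 2 * N (mul (vker c) f) + 2 * N (mul (vker c) g)"
      by (simp add: mul_add_fun)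
  qed
qed

lemma vanishing_mul_z:
  assumes "vanishing f"
  shows "vanishing (mul (\<lambda>z. z) f)"
  unfolding vanishing_def
proof (rule conjI[OF _ Lim_null_comparison])
  have H: "f \<in> H2 J" and lim: "((\<lambda>c. N (mul (vker c) f)) \<longlongrightarrow> 0) (at_left 1)"
    using assms by (auto simp: vanishing_def)
  show "mul (\<lambda>z. z) f \<in> H2 J" by (rule mul_z_H2[OF H])
  show "((\<lambda>c. N (mul (vker c) f)) \<longlongrightarrow> 0) (at_left 1)" by (rule lim)
  show "\<forall>\<^sub>F c in at_left 1. norm (N (mul (vker c) (mul (\<lambda>z. z) f))) \<le> N (mul (vker c) f)"
    using eventually_at_left_1
  proof (rule eventually_mono)
    fix c :: real assume "0 < c \<and> c < 1"
    then have k: "mul (vker c) f \<in> H2 J" using H vker_H2 by auto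
    have "mul (vker c) (mul (\<lambda>z. z) f) = mul (\<lambda>z. z) (mul (vker c) f)"
      by (simp add: mul_mul mult.commute)
    then show "norm (N (mul (vker c) (mul (\<lambda>z. z) f))) \<le> N (mul (vker c) f)"
      using mul_z_H2[OF k] N_nonneg[OF mul_z_H2(1)[OF k]] by simp
  qed
qed

text \<open>The witnesses are the Taylor polynomial and its remainder, the n-th shift times z^n. The
  function varies in the induction because the hypothesis is applied to \<open>L f\<close>.\<close>

lemma vanishing_initial_part:
  assumes "f \<in> H2 J"
  shows "\<exists>p. vanishing p \<and> (\<exists>g\<in>H2 J. N g \<le> N ((L ^^ n) f) \<and> f = (\<lambda>z. p z + g z))"
  using assms
proof (induction n arbitrary: f)
  case 0
  have "vanishing (konst 0)" by (rule vanishing_konst)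
  then show ?case
    using 0 by (intro exI[of _ "konst 0"]) (auto simp: konst_def)
next
  case (Suc n)
  obtain p g where p: "vanishing p" and g: "g \<in> H2 J" "N g \<le> N ((L ^^ n) (L f))" and eq: "L f = (\<lambda>z. p z + g z)"
    using Suc.IH[OF H2_L[OF Suc.prems]] by blast
  have "vanishing (\<lambda>z. konst (f 0) z + mul (\<lambda>z. z) p z)"
    by (intro vanishing_add vanishing_konst vanishing_mul_z p)
  moreover have "mul (\<lambda>z. z) g \<in> H2 J" "N (mul (\<lambda>z. z) g) \<le> N ((L ^^ Suc n) f)"
    using mul_z_H2[OF g(1)] g(2) by (auto simp: funpow_Suc_right simp del: funpow.simps)
  moreover have "f = (\<lambda>z. (konst (f 0) z + mul (\<lambda>z. z) p z) + mul (\<lambda>z. z) g z)"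
    by (rule trans[OF L_eq[OF Suc.prems]]) (simp add: eq mul_add_fun add.assoc)
  ultimately show ?case by blast
qed

lemma vanishing_H2:
  assumes f: "f \<in> H2 J"
  shows "vanishing f"
  unfolding vanishing_def
proof (intro conjI f tendstoI)
  fix e :: real assume "e > 0"
  then have "e / 4 > 0" by simp
  obtain n where n: "N ((L ^^ n) f) < e / 4" using N_Ln_small[OF f \<open>e / 4 > 0\<close>] by blast
  obtain p g where p: "vanishing p" and g: "g \<in> H2 J" "N g \<le> N ((L ^^ n) f)" and eq: "f = (\<lambda>z. p z + g z)"
    using vanishing_initial_part[OF f, of n] by blast
  have "\<forall>\<^sub>F c in at_left 1. dist (N (mul (vker c) p)) 0 < e / 4"
    using p \<open>e / 4 > 0\<close> unfolding vanishing_def by (blast dest: tendstoD)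
  then show "\<forall>\<^sub>F c in at_left 1. dist (N (mul (vker c) f)) 0 < e"
    using eventually_at_left_1
  proof eventually_elim
    fix c :: real assume 1: "dist (N (mul (vker c) p)) 0 < e / 4" and "0 < c \<and> c < 1"
    then have c: "0 < c" "c < 1" by auto
    have pH: "p \<in> H2 J" using p by (simp add: vanishing_def)
    have "N (mul (vker c) f) \<le> 2 * N (mul (vker c) p) + 2 * N (mul (vker c) g)"
      using H2_add(2)[OF vker_H2(1)[OF c pH] vker_H2(1)[OF c g(1)]] by (simp add: eq mul_add_fun)
    then show "dist (N (mul (vker c) f)) 0 < e"
      using 1 vker_H2(2)[OF c g(1)] g(2) n N_nonneg[OF vker_H2(1)[OF c f]] by auto
  qed
qed

lemma dense_1z:
  assumes f: "f \<in> H2 J" and "e > 0"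
  obtains h where "h \<in> H2 J" "N (\<lambda>z. mul (\<lambda>z. 1 - z) h z - f z) < e"
proof -
  have "\<forall>\<^sub>F c in at_left 1. dist (N (mul (vker c) f)) 0 < e"
    using vanishing_H2[OF f] \<open>e > 0\<close> unfolding vanishing_def by (blast dest: tendstoD)
  then have "\<forall>\<^sub>F c in at_left 1. dist (N (mul (vker c) f)) 0 < e \<and> 0 < c \<and> c < 1"
    using eventually_at_left_1 by eventually_elim auto
  then obtain c where c: "dist (N (mul (vker c) f)) 0 < e" "0 < c" "c < 1"
    using eventually_happens'[OF trivial_limit_at_left_real] by blast
  \<comment> \<open>This is (1 - vker c z) / (1 - z), so (1 - z) h misses \<open>f\<close> exactly
    by the product of \<open>vker c\<close> and \<open>f\<close>.\<close>
  define m where "m = (\<lambda>z. of_real c / (1 - of_real c * z) :: complex)"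
  define h where "h = mul m f"
  have cancel: "(x / a) * (a / d) = x / d" if "a \<noteq> 0" for x a d :: complex
    using that by simp
  have nz: "complex_of_real (1 - c) \<noteq> 0" using c by (simp del: of_real_diff)
  have "m = (\<lambda>z. of_real (c / (1 - c)) * vker c z)"
    by (simp only: m_def vker_def of_real_divide cancel[OF nz])
  then have "h = mul (\<lambda>z. of_real (c / (1 - c))) (mul (vker c) f)"
    by (simp add: h_def mul_mul)
  then have "h \<in> H2 J"
    using H2_mul(1)[of "\<lambda>z. of_real (c / (1 - c))" "norm (complex_of_real (c / (1 - c)))", OF _ _ vker_H2(1)[OF c(2,3) f]] by simp
  moreover have "(\<lambda>z. mul (\<lambda>z. 1 - z) h z - f z) = mul (\<lambda>z. - 1) (mul (vker c) f)"
  proof -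
    have "mul (\<lambda>z. (1 - z) * m z - 1) f = mul (\<lambda>z. - 1 * vker c z) f"
    proof (rule mul_cong)
      fix z :: complex assume "z \<in> disc"
      then have "1 - of_real c * z \<noteq> 0" by (rule vker(2)[OF c(2,3)])
      then show "(1 - z) * m z - 1 = - 1 * vker c z"
        by (simp add: m_def vker_def divide_simps) (simp add: algebra_simps)
    qed
    then show ?thesis
      by (simp only: mul_diff_symbol[of "\<lambda>z. (1 - z) * m z" "\<lambda>z. 1"] mul_1[OF f] mul_mul h_def)
  qed
  then have "N (\<lambda>z. mul (\<lambda>z. 1 - z) h z - f z) \<le> N (mul (vker c) f)"
    using H2_mul(2)[of "\<lambda>z. - 1" 1, OF _ _ vker_H2(1)[OF c(2,3) f]] by simp
  ultimately show thesis
    using that c(1) by (simp add: dist_real_def abs_less_iff)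
qed

end

context h2_contraction
begin

lemma T_diff:
  assumes "f \<in> H2 J" "g \<in> H2 J"
  shows "T (\<lambda>z. f z - g z) = (\<lambda>z. T f z - T g z)"
  using T_add[OF assms(1) H2_scC(1)[OF assms(2), of "-1"]] T_scC[OF assms(2), of "-1"] by simp

lemma T_eval_tendsto:
  assumes "\<And>n::nat. g n \<in> H2 J" "f \<in> H2 J" "(\<lambda>n. N (\<lambda>z. g n z - f z)) \<longlonglongrightarrow> 0" "norm w < 1"
  shows "(\<lambda>n. T (g n) w) \<longlonglongrightarrow> T f w"
proof -
  obtain K where K: "K > 0" "\<And>f. f \<in> H2 J \<Longrightarrow> (norm (f w))\<^sup>2 \<le> K * N f"
    using H2_eval[OF assms(4)] by blast
  have "(norm (T (g n) w - T f w))\<^sup>2 \<le> K * N (\<lambda>z. g n z - f z)" for n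
  proof -
    have H: "(\<lambda>z. g n z - f z) \<in> H2 J" using assms H2_diff by blast
    have "(norm (T (g n) w - T f w))\<^sup>2 \<le> K * N (T (\<lambda>z. g n z - f z))"
      using K(2)[OF T_H2[OF H]] by (simp add: T_diff assms)
    also have "\<dots> \<le> K * N (\<lambda>z. g n z - f z)"
      using K(1) N_T[OF H] by (intro mult_left_mono) auto
    finally show ?thesis .
  qed
  then have "(\<lambda>n. (norm (T (g n) w - T f w))\<^sup>2) \<longlonglongrightarrow> 0"
    by (intro Lim_null_comparison[OF _ tendsto_mult_right_zero[OF assms(3), of K]]) simp
  then have "(\<lambda>n. sqrt ((norm (T (g n) w - T f w))\<^sup>2)) \<longlonglongrightarrow> sqrt 0" by (rule tendsto_real_sqrt)
  then show ?thesis by (simp add: tendsto_norm_zero_iff LIM_zero_iff)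
qed

end

text \<open>The times 1 / (n + 1) serve as meshes of the Riemann sums.\<close>

locale h2_phi_commuting = h2_contraction +
  assumes T_phi: "f \<in> H2 J \<Longrightarrow> T (mul (phi (inverse (real (Suc n)))) f) = mul (phi (inverse (real (Suc n)))) (T f)"
begin

text \<open>No series is summed: \<open>phi_sum e\<close> is the reciprocal of an affine function
  \<open>a\<close> of \<open>phi e\<close>. \<open>T\<close> commutes with multiplication by
  \<open>a\<close>, hence with multiplication by its reciprocal.\<close>

lemma T_phi_sum:
  assumes f: "f \<in> H2 J" and e: "e = inverse (real (Suc n))"
  shows "T (mul (phi_sum e) f) = mul (phi_sum e) (T f)"
proof -
  have e01: "0 < e" "e \<le> 1" by (auto simp: e divide_simps)
  have H: "mul (phi_sum e) f \<in> H2 J"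
    by (rule H2_mul(1)[OF phi_sum_holo norm_phi_sum f]) (use e01 in auto)
  define c where "c = exp (- complex_of_real e)"
  define a where "a = (\<lambda>z. (1 - c * phi e z) / of_real e)"
  have a: "a z * phi_sum e z = 1" if z: "z \<in> disc" for z
  proof -
    have "c * phi e z = exp (of_real e * (2 / (z - 1)))"
      unfolding c_def by (rule phi_alt[OF z])
    moreover have "1 - exp (of_real e * (2 / (z - 1))) \<noteq> 0"
      using phi_sum_denom[OF z e01] e01 by auto
    ultimately show ?thesis
      using e01 unfolding a_def phi_sum_def by simp
  qed
  have Ta: "T (mul a g) = mul a (T g)" if g: "g \<in> H2 J" for g
  proof -
    have split: "mul a g = (\<lambda>z. scC J (1 / of_real e) (g z) - scC J (c / of_real e) (mul (phi e) g z))" if "g \<in> H2 J" for g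
      by (auto simp: mul_def a_def fun_eq_iff scC_scC H2_outside[OF that] diff_divide_distrib scC_diff_left)
    have pH: "mul (phi e) g \<in> H2 J"
      by (rule H2_mul(1)[OF phi_holo norm_phi g]) (use e01 in auto)
    show ?thesis
      unfolding split[OF g] split[OF T_H2[OF g]]
      by (simp add: T_diff H2_scC g pH T_scC T_phi[OF g, of n, folded e])
  qed
  have "mul (phi_sum e) (T f) = mul (phi_sum e) (T (mul a (mul (phi_sum e) f)))"
  proof -
    have "mul a (mul (phi_sum e) f) = mul (\<lambda>z. 1) f"
      unfolding mul_mul by (rule mul_cong) (use a in auto)
    then show ?thesis by (simp add: mul_1 f)
  qed
  also have "\<dots> = mul (\<lambda>z. phi_sum e z * a z) (T (mul (phi_sum e) f))"
    by (subst Ta[OF H]) (rule mul_mul)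
  also have "\<dots> = mul (\<lambda>z. 1) (T (mul (phi_sum e) f))"
    by (rule mul_cong) (use a in \<open>auto simp: mult.commute\<close>)
  also have "\<dots> = T (mul (phi_sum e) f)"
    by (rule mul_1[OF T_H2[OF H]])
  finally show ?thesis by simp
qed

text \<open>The factor \<open>1 - z\<close> makes the convergence of \<^const>\<open>phi_sum\<close> to \<open>(1 - z) / 2\<close> uniform on the disc.\<close>

lemma T_1z_square:
  assumes h: "h \<in> H2 J" and w: "w \<in> disc"
  shows "T (mul (\<lambda>z. (1 - z) * (1 - z)) h) w = scC J (1 - w) (T (mul (\<lambda>z. 1 - z) h) w)"
proof -
  define e where "e = (\<lambda>n. inverse (real (Suc n)))"
  have e01: "0 < e n" "e n \<le> 1" for n by (auto simp: e_def divide_simps)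
  have elim: "e \<longlonglongrightarrow> 0" unfolding e_def by (rule LIMSEQ_inverse_real_of_nat)
  define k where "k = mul (\<lambda>z. 1 - z) h"
  have k: "k \<in> H2 J" unfolding k_def by (rule mul_1z_H2[OF h])
  define q where "q = mul (\<lambda>z. (1 - z) / 2) k"
  have "norm ((1 - z) / 2) \<le> 1" if "z \<in> disc" for z :: complex
    using that norm_triangle_ineq4[of 1 z] by (simp add: norm_divide)
  then have q: "q \<in> H2 J"
    unfolding q_def by (intro H2_mul(1)[where C = 1, OF _ _ k]) (auto intro!: holomorphic_intros)
  define p where "p = (\<lambda>n. mul (phi_sum (e n)) k)"
  have p: "p n \<in> H2 J" for n
    unfolding p_def by (rule H2_mul(1)[OF phi_sum_holo norm_phi_sum k]) (use e01 in auto)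
  have le: "N (\<lambda>z. p n z - q z) \<le> (4 * e n)\<^sup>2 * N h" for n
  proof -
    have "(\<lambda>z. p n z - q z) = mul (\<lambda>z. (phi_sum (e n) z - (1 - z) / 2) * (1 - z)) h"
    proof -
      have "(\<lambda>z. p n z - q z) = mul (\<lambda>z. phi_sum (e n) z - (1 - z) / 2) k"
        unfolding p_def q_def by (rule mul_diff_symbol[symmetric])
      then show ?thesis by (simp only: k_def mul_mul)
    qed
    moreover have "N (mul (\<lambda>z. (phi_sum (e n) z - (1 - z) / 2) * (1 - z)) h) \<le> (4 * e n)\<^sup>2 * N h"
      by (intro H2_mul(2)[OF _ _ h] holomorphic_intros phi_sum_holo phi_sum_approx) (use e01 in auto)
    ultimately show ?thesis by simp
  qed
  have "(\<lambda>n. N (\<lambda>z. p n z - q z)) \<longlonglongrightarrow> 0"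
  proof (rule Lim_null_comparison[OF always_eventually[OF allI]])
    show "(\<lambda>n. (4 * e n)\<^sup>2 * N h) \<longlonglongrightarrow> 0"
      using elim by (auto intro!: tendsto_eq_intros)
    show "norm (N (\<lambda>z. p n z - q z)) \<le> (4 * e n)\<^sup>2 * N h" for n
      using le[of n] N_nonneg[OF H2_diff(1)[OF p q]] by simp
  qed
  then have "(\<lambda>n. T (p n) w) \<longlonglongrightarrow> T q w"
    by (rule T_eval_tendsto[OF p q]) (use w in auto)
  moreover have "(\<lambda>n. T (p n) w) \<longlonglongrightarrow> scC J ((1 - w) / 2) (T k w)"
  proof -
    have "(\<lambda>n. (phi_sum (e n) w - (1 - w) / 2) * (1 - w)) \<longlonglongrightarrow> 0"
      using phi_sum_approx[OF w e01]
      by (intro Lim_null_comparison[OF _ tendsto_mult_right_zero[OF elim, of 4]]) auto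
    then have "(\<lambda>n. (phi_sum (e n) w - (1 - w) / 2) * (1 - w) * (1 / (1 - w))) \<longlonglongrightarrow> 0"
      by (rule tendsto_mult_left_zero)
    moreover have "1 - w \<noteq> 0" using w by auto
    ultimately have "(\<lambda>n. phi_sum (e n) w - (1 - w) / 2) \<longlonglongrightarrow> 0"
      by simp
    then have "(\<lambda>n. phi_sum (e n) w) \<longlonglongrightarrow> (1 - w) / 2"
      by (simp add: LIM_zero_iff)
    then have "(\<lambda>n. scC J (phi_sum (e n) w) (T k w)) \<longlonglongrightarrow> scC J ((1 - w) / 2) (T k w)"
      by (intro bounded_bilinear.tendsto[OF bounded_bilinear_scC] tendsto_const)
    moreover have "T (p n) w = scC J (phi_sum (e n) w) (T k w)" for n
      using T_phi_sum[OF k, of "e n" n] w by (simp add: p_def e_def mul_def)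
    ultimately show ?thesis by simp
  qed
  ultimately have eq: "T q w = scC J ((1 - w) / 2) (T k w)"
    by (rule LIMSEQ_unique)
  have "mul (\<lambda>z. (1 - z) * (1 - z)) h = (\<lambda>z. scC J 2 (q z))"
    by (auto simp: q_def k_def mul_def scC_scC fun_eq_iff)
  then have "T (mul (\<lambda>z. (1 - z) * (1 - z)) h) w = scC J 2 (T q w)"
    by (simp add: T_scC[OF q])
  then show ?thesis by (simp add: eq scC_scC k_def diff_divide_distrib)
qed

text \<open>On multiples of 1 - z this is \<open>T_1z_square\<close> rearranged; such multiples are
  dense, and both sides are continuous in \<open>f\<close>.\<close>

lemma T_mul_z:
  assumes f: "f \<in> H2 J" and w: "w \<in> disc"
  shows "T (mul (\<lambda>z. z) f) w = scC J w (T f w)"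
proof -
  have range: "T (mul (\<lambda>z. z) k) w = scC J w (T k w)" if k: "k = mul (\<lambda>z. 1 - z) h" and h: "h \<in> H2 J" for k h
  proof -
    have kH: "k \<in> H2 J" unfolding k by (rule mul_1z_H2[OF h])
    have "mul (\<lambda>z. 1 - z) k = (\<lambda>z. k z - mul (\<lambda>z. z) k z)"
      by (simp only: mul_diff_symbol mul_1[OF kH])
    then have "T k w - T (mul (\<lambda>z. z) k) w = T (mul (\<lambda>z. 1 - z) k) w"
      by (simp add: T_diff kH mul_z_H2)
    also have "\<dots> = scC J (1 - w) (T k w)"
      using T_1z_square[OF h w] by (simp add: k mul_mul)
    finally show ?thesis by (simp add: scC_diff_left)
  qed
  have "\<exists>h. h \<in> H2 J \<and> N (\<lambda>z. mul (\<lambda>z. 1 - z) h z - f z) < inverse (real (Suc n))" for n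
    using dense_1z[OF f, of "inverse (real (Suc n))"] by (metis inverse_positive_iff_positive of_nat_0_less_iff zero_less_Suc)
  then obtain h where h: "\<And>n. h n \<in> H2 J" "\<And>n. N (\<lambda>z. mul (\<lambda>z. 1 - z) (h n) z - f z) < inverse (real (Suc n))"
    by metis
  define k where "k = (\<lambda>n. mul (\<lambda>z. 1 - z) (h n))"
  have k: "k n \<in> H2 J" for n unfolding k_def by (rule mul_1z_H2[OF h(1)])
  have D: "(\<lambda>z. k n z - f z) \<in> H2 J" for n by (rule H2_diff[OF k f])
  have lim: "(\<lambda>n. N (\<lambda>z. k n z - f z)) \<longlonglongrightarrow> 0"
  proof (rule Lim_null_comparison[OF always_eventually LIMSEQ_inverse_real_of_nat], rule allI)
    show "norm (N (\<lambda>z. k n z - f z)) \<le> inverse (real (Suc n))" for n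
      using h(2)[of n] N_nonneg[OF D, of n] by (simp add: k_def)
  qed
  have "(\<lambda>n. N (\<lambda>z. mul (\<lambda>z. z) (k n) z - mul (\<lambda>z. z) f z)) \<longlonglongrightarrow> 0"
    using mul_z_H2[OF D] N_nonneg[OF mul_z_H2(1)[OF D]]
    by (intro Lim_null_comparison[OF _ lim]) (auto simp: mul_diff_fun)
  then have "(\<lambda>n. T (mul (\<lambda>z. z) (k n)) w) \<longlonglongrightarrow> T (mul (\<lambda>z. z) f) w"
    by (rule T_eval_tendsto[OF mul_z_H2(1)[OF k] mul_z_H2(1)[OF f]]) (use w in auto)
  moreover have "(\<lambda>n. scC J w (T (k n) w)) \<longlonglongrightarrow> scC J w (T f w)"
    by (intro bounded_bilinear.tendsto[OF bounded_bilinear_scC] tendsto_const T_eval_tendsto k f lim) (use w in auto)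
  moreover have "T (mul (\<lambda>z. z) (k n)) w = scC J w (T (k n) w)" for n
    by (rule range[OF _ h(1)]) (simp add: k_def)
  ultimately show ?thesis using LIMSEQ_unique by simp
qed

lemma T_multiplier:
  assumes f: "f \<in> H2 J" and w: "w \<in> disc"
  shows "T f w = T (konst (f w)) w"
proof -
  obtain g where g: "g \<in> H2 J" and eq: "f = (\<lambda>z. konst (f w) z + mul (\<lambda>z. z - w) g z)"
    using H2_quotient[OF f, of w] w by auto
  have split: "mul (\<lambda>z. z - w) g = (\<lambda>z. mul (\<lambda>z. z) g z - scC J w (g z))"
    by (simp only: mul_diff_symbol mul_const[OF g])
  have H: "mul (\<lambda>z. z - w) g \<in> H2 J"
    unfolding split by (intro H2_diff mul_z_H2 H2_scC g)
  have "T f w = T (konst (f w)) w + T (mul (\<lambda>z. z - w) g) w"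
    by (subst eq) (simp add: T_add[OF H2_konst(1) H])
  also have "T (mul (\<lambda>z. z - w) g) w = 0"
    by (simp add: split T_diff mul_z_H2 H2_scC g T_scC T_mul_z[OF g w])
  finally show ?thesis by simp
qed

text \<open>Testing on the kernel \<open>x / (1 - cnj w z)\<close>, for which point evaluation at \<open>w\<close> is extremal.\<close>

lemma norm_T_konst:
  assumes w: "w \<in> disc"
  shows "norm (T (konst x) w) \<le> norm x"
proof -
  define f where "f = mul (\<lambda>z. 1 / (1 - cnj w * z)) (konst x)"
  define d where "d = 1 - (norm w)\<^sup>2"
  have d: "d > 0" using w by (simp add: d_def abs_square_less_1)
  have w1: "norm (cnj w) < 1" using w by simp
  have f: "f \<in> H2 J" "d * N f \<le> (norm x)\<^sup>2"
    using N_kernel[OF w1, of x] by (auto simp: f_def d_def)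
  have dw: "1 - cnj w * w = of_real d"
    using complex_norm_square[of w] by (simp add: d_def mult.commute)
  have "f w = scC J (1 / of_real d) x"
    using w by (simp add: f_def mul_def konst_def dw)
  then have "T f w = scC J (1 / of_real d) (T (konst x) w)"
    using T_multiplier[OF f(1) w] by (simp add: konst_scC T_scC[OF H2_konst(1)])
  then have "d * norm (T f w) = norm (T (konst x) w)"
    using d by (simp add: norm_scC norm_divide)
  \<comment> \<open>One factor \<open>d\<close> is spent in \<open>sharp_eval\<close>, the other in
    \<open>N_kernel\<close>; both being sharp, no constant above 1 survives.\<close>
  then have "(norm (T (konst x) w))\<^sup>2 = d * (d * (norm (T f w))\<^sup>2)"
    by (simp add: power2_eq_square mult_ac flip: \<open>d * norm (T f w) = norm (T (konst x) w)\<close>)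
  also have "\<dots> \<le> d * N (T f)"
    using sharp_eval[OF T_H2[OF f(1)], of w] w d by (intro mult_left_mono) (auto simp: d_def)
  also have "\<dots> \<le> d * N f" using N_T[OF f(1)] d by (intro mult_left_mono) auto
  also have "\<dots> \<le> (norm x)\<^sup>2" by (rule f(2))
  finally show ?thesis by (rule power2_le_imp_le) simp
qed

end

section \<open>The symbol of a commuting semigroup\<close>

context complex_hilbert
begin

text \<open>Left multiplication by \<open>J\<close> as a complex structure on operators. It makes
  \<open>scCop\<close> an instance of \<open>scC\<close>, so the criterion \<open>dq\<close> also
  yields holomorphy in operator norm.\<close>

definition Jop :: "('e \<Rightarrow>\<^sub>L 'e) \<Rightarrow>\<^sub>L ('e \<Rightarrow>\<^sub>L 'e)" where
  "Jop = Blinfun (\<lambda>A. J o\<^sub>L A)"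

lemma scC_Jop: "scC Jop c A = scCop J c A"
proof -
  have "Jop A = J o\<^sub>L A"
    unfolding Jop_def
    by (subst bounded_linear_Blinfun_apply[OF bounded_bilinear.bounded_linear_right[OF bounded_bilinear_blinfun_compose]])
      (rule refl)
  then show ?thesis by (simp add: scC_def scCop_def)
qed

lemma scC_Jop_apply: "scC Jop c A x = scC J c (A x)"
  unfolding scC_Jop by (simp add: scCop_def scC_def blinfun.bilinear_simps)

sublocale op: complex_banach Jop
proof
  show "scC Jop c (scC Jop d A) = scC Jop (c * d) A" for c d A
    by (rule blinfun_eqI) (simp add: scC_Jop_apply scC_scC)
  note mult = this
  have le: "norm (scC Jop c A) \<le> norm c * norm A" for c A
    by (rule norm_blinfun_bound)
      (auto simp: scC_Jop_apply norm_scC mult.assoc intro!: mult_left_mono norm_blinfun)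
  show "norm (scC Jop c A) = norm c * norm A" for c A
  proof (cases "c = 0")
    case True
    then show ?thesis by (simp add: scC_def)
  next
    case False
    have "scC Jop 1 A = A" by (simp add: scC_def)
    then have "A = scC Jop (1 / c) (scC Jop c A)"
      using mult[of "1 / c" c A] False by simp
    then have "norm A \<le> norm (1 / c) * norm (scC Jop c A)"
      using le by metis
    then have "norm c * norm A \<le> norm (scC Jop c A)"
      using False by (simp add: norm_divide pos_le_divide_eq mult.commute)
    then show ?thesis using le[of c A] by linarith
  qed
qed

lemma scC_of_real: "scC J (of_real r) x = r *\<^sub>R x"
  by (simp add: scC_def)

lemma mul_phi_H2: "f \<in> H2 J \<Longrightarrow> t \<ge> 0 \<Longrightarrow> mul (phi t) f \<in> H2 J"
  by (rule H2_mul(1)[OF phi_holo norm_phi])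

lemma mul_phi_add: "mul (phi s) (mul (phi t) f) = mul (phi (s + t)) f"
  unfolding mul_mul by (rule mul_cong) (simp add: phi_def distrib_right add_divide_distrib exp_add)

lemma M_phi_z_eq: "M_phi_z J t f = mul (phi t) f"
  by (auto simp: M_phi_z_def mul_def phi_def)

end

section \<open>From rational to real times\<close>

locale h2_semigroup = complex_hilbert J for J :: "'e::{real_inner, banach} \<Rightarrow>\<^sub>L 'e" +
  fixes T :: "real \<Rightarrow> (complex \<Rightarrow> 'e) \<Rightarrow> (complex \<Rightarrow> 'e)"
  assumes semigroup: "sc_contraction_semigroup J T"
    and commute: "t \<ge> 0 \<Longrightarrow> f \<in> H2 J \<Longrightarrow> T t (M_phi_z J t f) = M_phi_z J t (T t f)"
begin

lemma contraction_T: "t \<ge> 0 \<Longrightarrow> h2_contraction J (T t)"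
proof
  assume t: "t \<ge> 0"
  show "T t f \<in> H2 J" if "f \<in> H2 J" for f
    using semigroup t that unfolding sc_contraction_semigroup_def by blast
  show "T t (\<lambda>z. f z + g z) = (\<lambda>z. T t f z + T t g z)" if "f \<in> H2 J" "g \<in> H2 J" for f g
    using semigroup t that unfolding sc_contraction_semigroup_def by blast
  show "T t (\<lambda>z. scC J c (f z)) = (\<lambda>z. scC J c (T t f z))" if "f \<in> H2 J" for f c
    using semigroup t that unfolding sc_contraction_semigroup_def by blast
  have "h2norm (T t f) \<le> h2norm f" if "f \<in> H2 J" for f
    using semigroup t that unfolding sc_contraction_semigroup_def by blast
  then show "N (T t f) \<le> N f" if "f \<in> H2 J" for f
    using that by (simp add: h2norm_N)
qed

lemma T_H2: "t \<ge> 0 \<Longrightarrow> f \<in> H2 J \<Longrightarrow> T t f \<in> H2 J"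
  by (rule h2_contraction.T_H2[OF contraction_T])

lemma T_0: "f \<in> H2 J \<Longrightarrow> T 0 f = f"
  and T_plus: "s \<ge> 0 \<Longrightarrow> t \<ge> 0 \<Longrightarrow> f \<in> H2 J \<Longrightarrow> T (s + t) f = T s (T t f)"
  and T_tendsto: "f \<in> H2 J \<Longrightarrow> ((\<lambda>t. h2norm (\<lambda>z. T t f z - f z)) \<longlongrightarrow> 0) (at_right 0)"
  using semigroup unfolding sc_contraction_semigroup_def by blast+

text \<open>The hypothesis only relates equal times; commutation at commensurable times follows by
  passing to a common divisor.\<close>

lemma commute_multiples:
  assumes s: "s \<ge> 0" and f: "f \<in> H2 J"
  shows "T (real k * s) (mul (phi (real l * s)) f) = mul (phi (real l * s)) (T (real k * s) f)"
proof -
  have 1: "T (real k * s) (mul (phi s) f) = mul (phi s) (T (real k * s) f)" if f: "f \<in> H2 J" for f k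
  proof (induction k)
    case 0
    then show ?case by (simp add: T_0 f mul_phi_H2 s)
  next
    case (Suc k)
    have eq: "T (real (Suc k) * s) g = T s (T (real k * s) g)" if "g \<in> H2 J" for g
      using T_plus[of s "real k * s" g] s that by (simp add: algebra_simps)
    have "T s (mul (phi s) (T (real k * s) f)) = mul (phi s) (T s (T (real k * s) f))"
      using commute[OF s T_H2[OF _ f], of "real k * s"] s by (simp add: M_phi_z_eq)
    then show ?case
      using Suc by (simp add: eq f mul_phi_H2 s del: of_nat_Suc)
  qed
  show ?thesis
  proof (induction l)
    case 0
    have "mul (phi 0) g = g" if "g \<in> H2 J" for g
      using mul_cong[of "phi 0" "\<lambda>z. 1" g] mul_1[OF that] by (simp add: phi_def)
    then show ?case using f s by (simp add: T_H2)
  next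
    case (Suc l)
    have "mul (phi (real (Suc l) * s)) g = mul (phi s) (mul (phi (real l * s)) g)" for g
      by (simp add: mul_phi_add algebra_simps)
    then show ?case
      using Suc by (simp add: 1 f mul_phi_H2 s del: of_nat_Suc)
  qed
qed

lemma commuting_rational:
  assumes t: "t \<ge> 0" "t \<in> \<rat>"
  shows "h2_phi_commuting J (T t)"
proof -
  interpret h2_contraction J "T t" by (rule contraction_T[OF t(1)])
  show ?thesis
  proof
    fix f n assume f: "f \<in> H2 J"
    obtain m q :: nat where q: "q \<noteq> 0" and tq: "\<bar>t\<bar> = real m / real q"
      using Rats_abs_nat_div_natE[OF t(2)] by blast
    \<comment> \<open>A common divisor of both times: t = m/q is \<open>m * Suc n\<close> times
      \<open>s\<close>, and the mesh 1 / (n + 1) is \<open>q\<close> times \<open>s\<close>.\<close>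
    define s where "s = 1 / (real q * real (Suc n))"
    have s: "s \<ge> 0" by (simp add: s_def)
    have tq': "t = real m / real q" using tq t(1) by simp
    have "t = real (m * Suc n) * s"
      unfolding tq' s_def of_nat_mult using q by (simp del: of_nat_Suc)
    moreover have "inverse (real (Suc n)) = real q * s"
      unfolding s_def using q by (simp add: inverse_eq_divide del: of_nat_Suc)
    ultimately show "T t (mul (phi (inverse (real (Suc n)))) f) = mul (phi (inverse (real (Suc n)))) (T t f)"
      using commute_multiples[OF s f, of "m * Suc n" q] by (simp only:)
  qed
qed

text \<open>Approaching from the right, \<open>T (u n)\<close> factors as \<open>T t\<close> after
  \<open>T (u n - t)\<close>, and strong continuity at 0 applies. This suits the rational sequences
  below, which lie above \<open>t\<close>.\<close>

lemma T_right_continuous: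
  assumes t: "t \<ge> 0" and f: "f \<in> H2 J" and w: "w \<in> disc" and u: "\<And>n::nat. t < u n" "u \<longlonglongrightarrow> t"
  shows "(\<lambda>n. T (u n) f w) \<longlonglongrightarrow> T t f w"
proof -
  interpret h2_contraction J "T t" by (rule contraction_T[OF t])
  have "(\<lambda>n. u n - t) \<longlonglongrightarrow> 0" using u(2) by (simp add: LIM_zero)
  then have "filterlim (\<lambda>n. u n - t) (at_right 0) sequentially"
    using u(1) less_imp_neq[OF u(1), symmetric] by (auto simp: filterlim_at)
  from filterlim_compose[OF T_tendsto[OF f] this]
  have "(\<lambda>n. (h2norm (\<lambda>z. T (u n - t) f z - f z))\<^sup>2) \<longlonglongrightarrow> 0\<^sup>2"
    by (rule tendsto_power)
  moreover have H: "T (u n - t) f \<in> H2 J" for n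
    using h2_contraction.T_H2[OF contraction_T f] u(1)[of n] by simp
  moreover have "(h2norm (\<lambda>z. T (u n - t) f z - f z))\<^sup>2 = N (\<lambda>z. T (u n - t) f z - f z)" for n
    using N_nonneg[OF H2_diff(1)[OF H[of n] f]] by (simp add: h2norm_N)
  ultimately have "(\<lambda>n. N (\<lambda>z. T (u n - t) f z - f z)) \<longlonglongrightarrow> 0" by simp
  then have "(\<lambda>n. T t (T (u n - t) f) w) \<longlonglongrightarrow> T t f w"
    by (rule T_eval_tendsto[OF H f]) (use w in simp)
  moreover have "T t (T (u n - t) f) = T (u n) f" for n
    using T_plus[OF t _ f, of "u n - t"] u(1)[of n] by simp
  ultimately show ?thesis by simp
qed

lemma rational_sequence:
  assumes "t \<ge> (0::real)"
  obtains u :: "nat \<Rightarrow> real" where "\<And>n. t < u n" "\<And>n. u n \<in> \<rat>" "u \<longlonglongrightarrow> t"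
proof -
  have "\<exists>q\<in>\<rat>. t < q \<and> q < t + inverse (real (Suc n))" for n
    by (rule Rats_dense_in_real) simp
  then obtain u where u: "\<And>n. u n \<in> \<rat>" "\<And>n. t < u n" "\<And>n. u n < t + inverse (real (Suc n))"
    by metis
  have "u \<longlonglongrightarrow> t"
  proof (rule tendsto_sandwich[OF always_eventually always_eventually tendsto_const])
    show "(\<lambda>n. t + inverse (real (Suc n))) \<longlonglongrightarrow> t"
      using tendsto_add[OF tendsto_const[of t] LIMSEQ_inverse_real_of_nat] by simp
  qed (use u(2,3) less_imp_le in blast)+
  then show thesis using u that by blast
qed

lemma T_multiplier:
  assumes t: "t \<ge> 0" and f: "f \<in> H2 J" and w: "w \<in> disc"
  shows "T t f w = T t (konst (f w)) w"
proof -
  obtain u where u: "\<And>n. t < u n" "\<And>n. u n \<in> \<rat>" "u \<longlonglongrightarrow> t"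
    using rational_sequence[OF t] by blast
  have "T (u n) f w = T (u n) (konst (f w)) w" for n
    using h2_phi_commuting.T_multiplier[OF commuting_rational f w] u(1,2)[of n] t by simp
  then have "(\<lambda>n. T (u n) f w) \<longlonglongrightarrow> T t (konst (f w)) w"
    using T_right_continuous[OF t H2_konst(1) w u(1,3), of "f w"] by simp
  then show ?thesis
    using T_right_continuous[OF t f w u(1,3)] LIMSEQ_unique by blast
qed

lemma norm_T_konst:
  assumes t: "t \<ge> 0" and w: "w \<in> disc"
  shows "norm (T t (konst x) w) \<le> norm x"
proof -
  obtain u where u: "\<And>n. t < u n" "\<And>n. u n \<in> \<rat>" "u \<longlonglongrightarrow> t"
    using rational_sequence[OF t] by blast
  have "norm (T (u n) (konst x) w) \<le> norm x" for n
    using h2_phi_commuting.norm_T_konst[OF commuting_rational w] u(1,2)[of n] t by simp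
  then show ?thesis
    by (intro LIMSEQ_le_const2[OF tendsto_norm[OF T_right_continuous[OF t H2_konst(1) w u(1,3)]]]) blast
qed

section \<open>The fibre semigroups and their cogenerators\<close>

definition G :: "complex \<Rightarrow> real \<Rightarrow> 'e \<Rightarrow>\<^sub>L 'e" where
  "G w t = Blinfun (\<lambda>x. T t (konst x) w)"

lemma T_konst_scC:
  assumes "t \<ge> 0"
  shows "T t (konst (scC J c x)) w = scC J c (T t (konst x) w)"
  by (simp add: konst_scC h2_contraction.T_scC[OF contraction_T[OF assms] H2_konst(1)])

lemma G_apply:
  assumes "t \<ge> 0" "w \<in> disc"
  shows "G w t x = T t (konst x) w"
proof -
  interpret h2_contraction J "T t" by (rule contraction_T[OF assms(1)])
  have "bounded_linear (\<lambda>x. T t (konst x) w)"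
  proof (rule bounded_linear_intro[where K = 1])
    show "T t (konst (x + y)) w = T t (konst x) w + T t (konst y) w" for x y
      by (simp add: konst_add T_add H2_konst)
    show "T t (konst (r *\<^sub>R x)) w = r *\<^sub>R T t (konst x) w" for r x
      using T_konst_scC[OF assms(1), of "of_real r" x w] by (simp add: scC_of_real)
  qed (use norm_T_konst[OF assms] in auto)
  then show ?thesis by (simp add: G_def bounded_linear_Blinfun_apply)
qed

text \<open>The semigroup law holds in the fibre because \<open>T s\<close> sees only the value at
  \<open>w\<close> of \<open>T t (konst x)\<close>. Strong continuity descends through bounded point
  evaluation.\<close>

lemma c0_G:
  assumes w: "w \<in> disc"
  shows "c0_contraction (G w)"
proof
  show "G w 0 x = x" for x
    using w by (simp add: G_apply T_0[OF H2_konst(1)]) (simp add: konst_def)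
  show "G w (s + t) x = G w s (G w t x)" if "s \<ge> 0" "t \<ge> 0" for s t x
    using that w T_multiplier[OF that(1) T_H2[OF that(2) H2_konst(1)] w, of x]
    by (simp add: G_apply T_plus H2_konst)
  show "norm (G w t x) \<le> norm x" if "t \<ge> 0" for t x
    unfolding G_apply[OF that w] by (rule norm_T_konst[OF that w])
  show "((\<lambda>t. G w t x) \<longlongrightarrow> x) (at_right 0)" for x
  proof -
    obtain K where K: "K > 0" "\<And>f. f \<in> H2 J \<Longrightarrow> (norm (f w))\<^sup>2 \<le> K * N f"
      using H2_eval[of w] w by auto
    have "((\<lambda>t. G w t x - x) \<longlongrightarrow> 0) (at_right 0)"
    proof (rule Lim_null_comparison)
      show "((\<lambda>t. sqrt K * h2norm (\<lambda>z. T t (konst x) z - konst x z)) \<longlongrightarrow> 0) (at_right 0)"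
        by (rule tendsto_mult_right_zero[OF T_tendsto[OF H2_konst(1)]])
      show "\<forall>\<^sub>F t in at_right 0. norm (G w t x - x) \<le> sqrt K * h2norm (\<lambda>z. T t (konst x) z - konst x z)"
        using eventually_at_right_less[of "0::real"]
      proof (rule eventually_mono)
        fix t :: real assume t: "0 < t"
        have "(norm (T t (konst x) w - konst x w))\<^sup>2 \<le> K * N (\<lambda>z. T t (konst x) z - konst x z)"
          using K(2)[OF H2_diff(1)[OF T_H2[OF _ H2_konst(1)] H2_konst(1)], of t x x] t by simp
        then have "norm (T t (konst x) w - konst x w) \<le> sqrt (K * N (\<lambda>z. T t (konst x) z - konst x z))"
          by (rule real_le_rsqrt)
        then show "norm (G w t x - x) \<le> sqrt K * h2norm (\<lambda>z. T t (konst x) z - konst x z)"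
          using t w by (simp add: G_apply konst_def h2norm_N real_sqrt_mult)
      qed
    qed
    then show ?thesis by (rule LIM_zero_cancel)
  qed
qed

definition symbol :: "complex \<Rightarrow> 'e \<Rightarrow>\<^sub>L 'e" where
  "symbol w = c0_contraction.cogen (G w)"

text \<open>The constant is independent of \<open>t\<close> because \<open>norm_T_konst\<close> is.
  A quarter of the distance to the unit circle leaves room in the disc for the contour of radius
  \<open>2 * \<rho>\<close>.\<close>

lemma dq_G:
  assumes w: "w \<in> disc" and t: "t \<ge> 0" and \<rho>: "\<rho> = (1 - norm w) / 4"
  shows "dq w \<rho> (norm x / \<rho>\<^sup>2) (\<lambda>z. T t (konst x) z)"
proof (rule dq_weakI)
  have sub: "ball w (1 - norm w) \<subseteq> disc"
  proof
    fix z assume "z \<in> ball w (1 - norm w)"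
    then show "z \<in> disc"
      using norm_triangle_sub[of z w] by (simp add: dist_norm norm_minus_commute)
  qed
  show "(\<lambda>z. cin y (T t (konst x) z)) holomorphic_on ball w (1 - norm w)" for y
    using holo_E_cin[OF H2_holo[OF T_H2[OF t H2_konst(1)]]] sub holomorphic_on_subset by blast
  show "norm (T t (konst x) z) \<le> norm x" if "z \<in> ball w (1 - norm w)" for z
    using norm_T_konst[OF t] sub that by blast
qed (use w \<rho> in auto)

text \<open>The inequality is integrated as it stands: the weight exp(-t) has total mass at most 1,
  so the constant is preserved and nothing is differentiated under the integral.\<close>

lemma dq_R:
  assumes w: "w \<in> disc" and \<rho>: "\<rho> = (1 - norm w) / 4"
    and hk: "norm h \<le> \<rho>" "norm k \<le> \<rho>"
  shows "norm (scC J k (c0_contraction.R (G (w + h)) x - c0_contraction.R (G w) x)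
       - scC J h (c0_contraction.R (G (w + k)) x - c0_contraction.R (G w) x))
     \<le> norm x / \<rho>\<^sup>2 * (norm h * norm k * norm (h - k))"
proof -
  define C where "C = norm x / \<rho>\<^sup>2 * (norm h * norm k * norm (h - k))"
  have C: "0 \<le> C" by (simp add: C_def)
  have disc: "w + h \<in> disc" "w + k \<in> disc"
    using norm_triangle_ineq[of w h] norm_triangle_ineq[of w k] hk w \<rho> by auto
  have I: "((\<lambda>t. exp (- t) *\<^sub>R G z t x) has_integral c0_contraction.P (G z) x b) {0..b}" if "z \<in> disc" for z b
    using c0_contraction.integrable_expG[OF c0_G[OF that], of 0 x b]
    by (simp add: c0_contraction.P_def[OF c0_G[OF that]] integrable_integral)
  note lin = has_integral_linear[OF _ bounded_bilinear.bounded_linear_right[OF bounded_bilinear_scC], unfolded o_def]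
  have "norm (scC J k (c0_contraction.P (G (w + h)) x b - c0_contraction.P (G w) x b)
       - scC J h (c0_contraction.P (G (w + k)) x b - c0_contraction.P (G w) x b)) \<le> C" (is "norm ?D \<le> C")
    if b: "b \<ge> 0" for b
  proof -
    have D: "((\<lambda>t. scC J k (exp (- t) *\<^sub>R G (w + h) t x - exp (- t) *\<^sub>R G w t x)
        - scC J h (exp (- t) *\<^sub>R G (w + k) t x - exp (- t) *\<^sub>R G w t x)) has_integral ?D) {0..b}"
      by (intro has_integral_diff lin I disc w)
    have E: "((\<lambda>t. exp (- t) * C) has_integral (- exp (- b) * C - (- exp (- 0) * C))) {0..b}"
      by (rule fundamental_theorem_of_calculus[OF b])
        (auto intro!: derivative_eq_intros simp flip: has_real_derivative_iff_has_vector_derivative)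
    have "norm ?D \<le> integral {0..b} (\<lambda>t. exp (- t) * C)"
      unfolding integral_unique[OF D, symmetric]
    proof (rule integral_norm_bound_integral)
      fix t assume t: "t \<in> {0..b}"
      have "norm (scC J k (G (w + h) t x - G w t x) - scC J h (G (w + k) t x - G w t x)) \<le> C"
        using dq_G[OF w _ \<rho>, of t x] t disc w hk by (simp add: dq_def G_apply C_def)
      moreover have "scC J k (exp (- t) *\<^sub>R G (w + h) t x - exp (- t) *\<^sub>R G w t x)
        - scC J h (exp (- t) *\<^sub>R G (w + k) t x - exp (- t) *\<^sub>R G w t x)
        = exp (- t) *\<^sub>R (scC J k (G (w + h) t x - G w t x) - scC J h (G (w + k) t x - G w t x))"
        by (simp only: scaleR_diff_right scC_diff_right scC_scaleR_right)
      ultimately show "norm (scC J k (exp (- t) *\<^sub>R G (w + h) t x - exp (- t) *\<^sub>R G w t x)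
        - scC J h (exp (- t) *\<^sub>R G (w + k) t x - exp (- t) *\<^sub>R G w t x)) \<le> exp (- t) * C"
        by simp
    qed (use D E in blast)+
    also have "\<dots> \<le> C" using integral_unique[OF E] C by simp
    finally show ?thesis .
  qed
  then have le: "norm (scC J k (c0_contraction.P (G (w + h)) x (real n) - c0_contraction.P (G w) x (real n))
       - scC J h (c0_contraction.P (G (w + k)) x (real n) - c0_contraction.P (G w) x (real n))) \<le> C" for n
    by simp
  note lim = c0_contraction.P_tendsto[OF c0_G]
  have "(\<lambda>n. norm (scC J k (c0_contraction.P (G (w + h)) x (real n) - c0_contraction.P (G w) x (real n))
       - scC J h (c0_contraction.P (G (w + k)) x (real n) - c0_contraction.P (G w) x (real n))))
     \<longlonglongrightarrow> norm (scC J k (c0_contraction.R (G (w + h)) x - c0_contraction.R (G w) x)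
       - scC J h (c0_contraction.R (G (w + k)) x - c0_contraction.R (G w) x))"
    by (intro tendsto_norm tendsto_diff bounded_bilinear.tendsto[OF bounded_bilinear_scC] tendsto_const lim disc w)
  then have "norm (scC J k (c0_contraction.R (G (w + h)) x - c0_contraction.R (G w) x)
       - scC J h (c0_contraction.R (G (w + k)) x - c0_contraction.R (G w) x)) \<le> C"
    by (rule LIMSEQ_le_const2) (use le in blast)
  then show ?thesis by (simp add: C_def)
qed

text \<open>The identity part of the cogenerator cancels in differences. The bound of
  \<open>dq_R\<close> is linear in \<open>norm x\<close>, hence a bound in operator norm.\<close>

lemma dq_symbol:
  assumes w: "w \<in> disc" and \<rho>: "\<rho> = (1 - norm w) / 4"
  shows "op.dq w \<rho> (2 / \<rho>\<^sup>2) symbol"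
  unfolding op.dq_def
proof (intro conjI allI impI norm_blinfun_bound)
  fix h k :: complex and x assume hk: "norm h \<le> \<rho>" "norm k \<le> \<rho>"
  have disc: "w + h \<in> disc" "w + k \<in> disc"
    using norm_triangle_ineq[of w h] norm_triangle_ineq[of w k] hk w \<rho> by auto
  have s: "symbol z x = x - 2 *\<^sub>R c0_contraction.R (G z) x" if "z \<in> disc" for z
    unfolding symbol_def by (rule c0_contraction.cogen_apply[OF c0_G[OF that]])
  have "(scC Jop k (symbol (w + h) - symbol w) - scC Jop h (symbol (w + k) - symbol w)) x
     = - 2 *\<^sub>R (scC J k (c0_contraction.R (G (w + h)) x - c0_contraction.R (G w) x)
       - scC J h (c0_contraction.R (G (w + k)) x - c0_contraction.R (G w) x))"
    by (simp add: blinfun.diff_left scC_Jop_apply s[OF disc(1)] s[OF disc(2)] s[OF w]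
        scC_diff_right scC_scaleR_right scaleR_diff_right)
  then have "norm ((scC Jop k (symbol (w + h) - symbol w) - scC Jop h (symbol (w + k) - symbol w)) x)
      = 2 * norm (scC J k (c0_contraction.R (G (w + h)) x - c0_contraction.R (G w) x)
       - scC J h (c0_contraction.R (G (w + k)) x - c0_contraction.R (G w) x))"
    by simp
  also have "\<dots> \<le> 2 * (norm x / \<rho>\<^sup>2 * (norm h * norm k * norm (h - k)))"
    by (intro mult_left_mono dq_R[OF w \<rho> hk]) simp
  also have "\<dots> = 2 / \<rho>\<^sup>2 * (norm h * norm k * norm (h - k)) * norm x" by simp
  finally show "norm ((scC Jop k (symbol (w + h) - symbol w) - scC Jop h (symbol (w + k) - symbol w)) x)
     \<le> 2 / \<rho>\<^sup>2 * (norm h * norm k * norm (h - k)) * norm x" .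
qed auto

lemma symbol_J:
  assumes w: "w \<in> disc"
  shows "symbol w (J x) = J (symbol w x)"
proof -
  interpret G: c0_contraction "G w" by (rule c0_G[OF w])
  have J: "J x = scC J \<i> x" for x by (simp add: scC_def)
  have GJ: "G w t (J x) = J (G w t x)" if "t \<ge> 0" for t x
    unfolding G_apply[OF that w] using T_konst_scC[OF that, of \<i> x w] by (simp add: J[symmetric])
  have "G.P (J x) (real n) = J (G.P x (real n))" for n
  proof -
    have "J (G.P x (real n)) = integral {0..real n} (J \<circ> (\<lambda>t. exp (- t) *\<^sub>R G w t x))"
      unfolding G.P_def by (rule integral_linear[symmetric])
        (auto simp: G.integrable_expG blinfun.bounded_linear_right)
    also have "\<dots> = G.P (J x) (real n)"
      unfolding G.P_def by (rule integral_cong) (auto simp: blinfun.bilinear_simps GJ)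
    finally show ?thesis by simp
  qed
  then have "(\<lambda>n. J (G.P x (real n))) \<longlonglongrightarrow> G.R (J x)"
    using G.P_tendsto[of "J x"] by simp
  moreover have "(\<lambda>n. J (G.P x (real n))) \<longlonglongrightarrow> J (G.R x)"
    by (rule bounded_linear.tendsto[OF blinfun.bounded_linear_right G.P_tendsto])
  ultimately have "G.R (J x) = J (G.R x)" by (rule LIMSEQ_unique)
  then show ?thesis by (simp add: symbol_def G.cogen_apply blinfun.bilinear_simps)
qed

lemma symbol_classC: "symbol \<in> classC J"
proof -
  have "clinear_op J (symbol z)" if "z \<in> disc" for z
    unfolding clinear_op_def by (rule blinfun_eqI) (simp add: symbol_J[OF that])
  moreover have "\<exists>A. (symbol has_derivative (\<lambda>h. scCop J h A)) (at z)" if "z \<in> disc" for z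
    by (rule op.dq_has_derivative[OF dq_symbol[OF that refl]]) (use that in \<open>auto simp: scC_Jop\<close>)
  moreover have "norm (symbol z) \<le> 1" if "z \<in> disc" for z
  proof -
    interpret G: c0_contraction "G z" by (rule c0_G[OF that])
    show ?thesis unfolding symbol_def by (rule G.cog.norm_T)
  qed
  moreover have "x = 0" if "z \<in> disc" "symbol z x = x" for z x
  proof -
    interpret G: c0_contraction "G z" by (rule c0_G[OF that(1)])
    show ?thesis using that(2) unfolding symbol_def by (rule G.cog.no_fixed)
  qed
  ultimately show ?thesis unfolding classC_def Hinf_def by blast
qed

lemma T_eq_M_phi_psi:
  assumes t: "t \<ge> 0" and f: "f \<in> H2 J"
  shows "T t f = M_phi_psi t symbol f"
proof
  fix z
  show "T t f z = M_phi_psi t symbol f z"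
  proof (cases "z \<in> disc")
    case True
    interpret G: c0_contraction "G z" by (rule c0_G[OF True])
    show ?thesis
      using True T_multiplier[OF t f True] G.phi_op_cogen[OF t, of "f z"]
      by (simp add: M_phi_psi_def symbol_def G_apply t)
  next
    case False
    then show ?thesis using H2_outside[OF T_H2[OF t f]] by (simp add: M_phi_psi_def)
  qed
qed

text \<open>Evaluating on constant functions turns equality of the semigroups into
  \<open>phi_op t (\<psi> z) x = G z t x\<close>, and a contraction without fixed vectors is
  recovered from these.\<close>

lemma symbol_unique:
  assumes \<psi>: "\<psi> \<in> classC J" and eq: "\<And>t f. t \<ge> 0 \<Longrightarrow> f \<in> H2 J \<Longrightarrow> T t f = M_phi_psi t \<psi> f"
    and z: "z \<in> disc"
  shows "\<psi> z = symbol z"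
proof -
  interpret G: c0_contraction "G z" by (rule c0_G[OF z])
  have "contraction_no_fixed (\<psi> z)"
    by standard (use \<psi> z in \<open>auto simp: classC_def\<close>)
  moreover have "G z t x = phi_op t (\<psi> z) x" if "t \<ge> 0" for t x
    using fun_cong[OF eq[OF that H2_konst(1)], of x z] z that
    by (simp add: G_apply M_phi_psi_def konst_def)
  ultimately show ?thesis unfolding symbol_def by (rule G.cogen_unique)
qed

end

text \<open>Uniqueness is asserted on the disc because membership in \<open>classC\<close> leaves
  the values elsewhere free.\<close>

theorem theorem3p1:
  fixes J :: "'e::{real_inner, banach} \<Rightarrow>\<^sub>L 'e"
    and T :: "real \<Rightarrow> (complex \<Rightarrow> 'e) \<Rightarrow> (complex \<Rightarrow> 'e)"
  assumes "complex_structure J"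
    and "separable_space TYPE('e)"
    and "sc_contraction_semigroup J T"
    and "\<forall>t\<ge>0. \<forall>f\<in>H2 J. T t (M_phi_z J t f) = M_phi_z J t (T t f)"
  shows "\<exists>\<psi>\<in>classC J. (\<forall>t\<ge>0. \<forall>f\<in>H2 J. T t f = M_phi_psi t \<psi> f)
           \<and> (\<forall>\<psi>'\<in>classC J. (\<forall>t\<ge>0. \<forall>f\<in>H2 J. T t f = M_phi_psi t \<psi>' f)
                 \<longrightarrow> (\<forall>z\<in>disc. \<psi>' z = \<psi> z))"
proof -
  interpret h2_semigroup J T
    by (intro h2_semigroup.intro complex_hilbert.intro h2_semigroup_axioms.intro assms(1,3))
      (rule assms(4)[rule_format])
  show ?thesis
  proof (intro bexI[of _ symbol] conjI allI impI ballI)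
    show "T t f = M_phi_psi t symbol f" if "0 \<le> t" "f \<in> H2 J" for t f
      using that by (rule T_eq_M_phi_psi)
    fix \<psi>' z
    assume "\<psi>' \<in> classC J" "\<forall>t\<ge>0. \<forall>f\<in>H2 J. T t f = M_phi_psi t \<psi>' f" "z \<in> disc"
    then show "\<psi>' z = symbol z" by (intro symbol_unique) auto
  qed (rule symbol_classC)
qed

end
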